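(* Consider a random bijective queue-channel (as defined in the context) with input alphabet $\mathcal{X}$, Poisson arrivals of rate $\lambda<1$ and i.i.d. service times of mean $1$, and let $\pi$ be the limiting distribution of the waiting time process $\{W_i\}$. When the receiver knows the arrival and departure times of the symbols, the capacity is $$\lambda\left(\log|\mathcal{X}|-\mathbf{E}_\pi[H(N(W))]\right).$$ When the receiver does not know the arrival and departure times, and assuming that the queue is unpredictable given noise, the capacity is $$\lambda\left(\log|\mathcal{X}|-H\left(\mathbf{E}_\pi[N(W)]\right)\right).$$
   Context: Queue. Symbols (qubits) $j=1,2,\dots$ are sent sequentially to a single-server FIFO queue (an M/GI/1 queue). Interarrival times are i.i.d. exponential with parameter $\lambda$; service times $S_j$ are i.i.d. with cumulative distribution $F_S$ and mean $1$ (service rate $\mu=1$); $\lambda<1$ for stability. $A_j$ and $D_j$ are the times when the $j$th symbol arrives at the queue and departs from the queue, respectively, and $W_j=D_j-A_j$ is the time that the $j$th symbol spends in the queue. $\{W_j\}$ is a Markov process with a unique limiting distribution $\pi$. Queue-channel. Inputs $X_j\in\mathcal{X}$, outputs $Y_j\in\mathcal{Y}$; no information is encoded in the timings, so the inputs are independent of the arrival and departure times. For an $n$-length transmission the channel law is $\prod_{j=1}^n\mathbf{P}(Y_j\mid X_j,W_j)$, the outputs depending on the arrival and departure times only through the $W_j$. The channel can be described by a noise sequence $\{N_i\}$ with values in a finite set $\tilde{\mathcal{X}}$, independent of $\{X_i\}$ and, conditioned on $\{W_i\}$, an independent (not identically distributed) sequence with laws $\mathbf{P}(N_i\mid W_i)$,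 together with a map $g:\mathcal{X}\times\tilde{\mathcal{X}}\to\mathcal{Y}$ such that $\{Y_i,W_i,X_i\}$ has the same joint distribution as $\{g(X_i,N_i),W_i,X_i\}$. The queue-channel is called random bijective if $\mathcal{X}=\tilde{\mathcal{X}}$ and $g(x,\cdot)$ is a bijection for every $x\in\mathcal{X}$. The queue is called unpredictable given noise if for all $n$ and $k$, $\mathbf{P}(W_{n+k}\mid N^n)=\mathbf{P}(W_{n+k})$, where $N^n=(N_1,\dots,N_n)$; i.e. $N^n$ provides no information about the future of the queue process. Notation. $N(W)$ denotes the noise random variable for a given $W$, i.e. with law $\mathbf{P}(N\mid W)$; $H$ is Shannon entropy; $\mathbf{E}_\pi[N(W)]$ inside $H$ stands for the mixture $\int\mathbf{P}(N\in\cdot\mid W=w)\,d\pi(w)$ of the noise laws, and $H(\mathbf{E}_\pi[N(W)])$ for its entropy. Logs are base 2. Capacity (bits/sec). Let $M,\hat M\in\mathcal{M}$ be the transmitted and decoded messages. An $(n,\tilde R,T)$ code consists of an encoding function $X^n=f(M)$ and a decoding function $\hat M=h(Y^n,A^n,D^n)$ (a function of $Y^n$ only, if the receiver does not know the arrival and departure times), where $Z^n=(Z_1,\dots,Z_n)$, $|\mathcal{M}|=2^{n\tilde R}$ and, for each codeword, the expected total time for all the symbols to reach the receiver is less than $T$. The code is $\epsilon$-achievable if the decoder chooses $\hat M$ with average probability of error less than $\epsilon$. If for any $0<\epsilon<1$ there exists an $\epsilon$-achievable $(n,\tilde R,T)$ code, the rate $R=n\tilde R/T$ is said to be achievable. The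 capacity is the supremum of all achievable rates for the given arrival process. The transmitter knows the statistics of the arrival process, but not its realization before encoding.
   Formalization: Besides g(x,·), each map g(·,z) is also assumed bijective (otherwise g(x,z)=z with non-uniform noise has capacity 0), and a rate is achievable only if ε-achievable codes exist for arbitrarily large n (one short block from an empty queue can beat the formula). *)

theory Defs
  imports "HOL-Probability.Probability"
begin

section \<open>The M/GI/1 queue\<close>

text \<open>
  Symbols are numbered from 1; \<open>tau j\<close> is the interarrival time preceding symbol \<open>j\<close> and
  \<open>S j\<close> its service time. Only the symbols \<open>1, 2, \<dots>\<close> use the server, so the system
  is empty until the first arrival. The value at index 0 is a convention: it makes
  \<open>D_(j+1) = max A_(j+1) D_j + S_(j+1)\<close> valid for the first symbol too.
\<close>

definition arrival :: "(nat \<Rightarrow> 'a \<Rightarrow> real) \<Rightarrow> nat \<Rightarrow> 'a \<Rightarrow> real" where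
  "arrival tau j \<omega> = (\<Sum>i=1..j. tau i \<omega>)"

primrec departure ::
  "(nat \<Rightarrow> 'a \<Rightarrow> real) \<Rightarrow> (nat \<Rightarrow> 'a \<Rightarrow> real) \<Rightarrow> nat \<Rightarrow> 'a \<Rightarrow> real" where
  "departure tau S 0 \<omega> = 0"
| "departure tau S (Suc j) \<omega> =
     max (arrival tau (Suc j) \<omega>) (departure tau S j \<omega>) + S (Suc j) \<omega>"

definition waiting ::
  "(nat \<Rightarrow> 'a \<Rightarrow> real) \<Rightarrow> (nat \<Rightarrow> 'a \<Rightarrow> real) \<Rightarrow> nat \<Rightarrow> 'a \<Rightarrow> real" where
  "waiting tau S j \<omega> = departure tau S j \<omega> - arrival tau j \<omega>"

locale mg1_queue = prob_space M
  for M :: "'a measure" +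
  fixes lam :: real and F_S :: "real \<Rightarrow> real" and tau S :: "nat \<Rightarrow> 'a \<Rightarrow> real"
  assumes lam_pos: "0 < lam" and stable: "lam < 1"
    and indep: "indep_vars (\<lambda>_. borel) (case_sum tau S) ({1..} <+> {1..})"
    and interarrival: "\<And>j. 1 \<le> j \<Longrightarrow> distributed M lborel (tau j) (exponential_density lam)"
    and service_cdf: "\<And>j. 1 \<le> j \<Longrightarrow> cdf (distr M borel (S j)) = F_S"
    and service_nonneg: "\<And>j. 1 \<le> j \<Longrightarrow> AE \<omega> in M. 0 \<le> S j \<omega>"
    and service_integrable: "\<And>j. 1 \<le> j \<Longrightarrow> integrable M (S j)"
    and service_mean: "\<And>j. 1 \<le> j \<Longrightarrow> expectation (S j) = 1"
begin

definition timing_algebra :: "'a measure" where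
  "timing_algebra = vimage_algebra (space M)
     (\<lambda>\<omega> j. (arrival tau j \<omega>, departure tau S j \<omega>)) (\<Pi>\<^sub>M j\<in>UNIV. borel)"

lemma rv_tau [measurable]: "1 \<le> j \<Longrightarrow> tau j \<in> borel_measurable M"
  using interarrival[of j] by (auto simp: distributed_def)

lemma rv_S [measurable]: "1 \<le> j \<Longrightarrow> S j \<in> borel_measurable M"
  using service_integrable by auto

lemma rv_arrival [measurable]: "arrival tau j \<in> borel_measurable M"
  unfolding arrival_def [abs_def] by (rule borel_measurable_sum) auto

lemma rv_departure [measurable]: "departure tau S j \<in> borel_measurable M"
proof (induction j)
  case (Suc j)
  note [measurable] = Suc.IH rv_S[of "Suc j", simplified]
  show ?case by simp
qed simp

lemma rv_waiting [measurable]: "waiting tau S j \<in> borel_measurable M"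
  unfolding waiting_def [abs_def] by measurable

lemma subalgebra_timing_algebra: "subalgebra M timing_algebra"
proof -
  have "(\<lambda>\<omega> j. (arrival tau j \<omega>, departure tau S j \<omega>)) \<in> M \<rightarrow>\<^sub>M (\<Pi>\<^sub>M j\<in>UNIV. borel)"
    by (rule measurable_PiM_single') auto
  then show ?thesis
    unfolding subalgebra_def timing_algebra_def by (simp add: sets_vimage_algebra2 measurable_def) blast
qed

end

section \<open>Queue-channels and their noise representation\<close>

text \<open>
  \<open>Q x w\<close> is the channel law \<open>P(Y | X = x, W = w)\<close>. The noise \<open>N\<close> lives on the
  space of the queue. Its law is prescribed conditionally on all arrival and departure times, and
  depends on them only through the \<open>W_i\<close>. The input is not a random variable here:
  inputs are independent of the timings and of the noise, so they enter through deterministic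
  codewords, over which the error probability is averaged below.
\<close>

locale queue_channel = mg1_queue M lam F_S tau S
  for M :: "'a measure" and lam F_S tau S +
  fixes Q :: "'x :: finite \<Rightarrow> real \<Rightarrow> 'y pmf"
    and K :: "real \<Rightarrow> 'z :: finite pmf"
    and N :: "nat \<Rightarrow> 'a \<Rightarrow> 'z"
    and g :: "'x \<Rightarrow> 'z \<Rightarrow> 'y"
  assumes kernel_Q: "\<And>x. (\<lambda>w. measure_pmf (Q x w)) \<in> borel \<rightarrow>\<^sub>M subprob_algebra (count_space UNIV)"
    and kernel_K: "(\<lambda>w. measure_pmf (K w)) \<in> borel \<rightarrow>\<^sub>M subprob_algebra (count_space UNIV)"
    and noise_measurable: "\<And>i. 1 \<le> i \<Longrightarrow> N i \<in> M \<rightarrow>\<^sub>M count_space UNIV"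
    and noise_law: "\<And>n \<nu>. AE \<omega> in M.
          real_cond_exp M timing_algebra
            (indicator {\<omega> \<in> space M. \<forall>i\<in>{1..n}. N i \<omega> = \<nu> i}) \<omega>
          = (\<Prod>i=1..n. pmf (K (waiting tau S i \<omega>)) (\<nu> i))"
    and representation: "\<And>x w. Q x w = map_pmf (g x) (K w)"

text \<open>
  Bijectivity of \<open>g x\<close> gives \<open>H(Y | X, W) = H(N | W)\<close> but says nothing about how \<open>Y\<close> depends on
  the input: \<open>g x z = z\<close> satisfies it. That every noise value permutes the inputs, so that uniform
  inputs yield uniform outputs, is the separate condition \<open>\<forall>z. bij (\<lambda>x. g x z)\<close>.
\<close>

definition random_bijective :: "('x \<Rightarrow> 'x \<Rightarrow> 'y) \<Rightarrow> bool" where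
  "random_bijective g \<longleftrightarrow> (\<forall>x. bij (g x))"

definition unpredictable_given_noise ::
  "'a measure \<Rightarrow> (nat \<Rightarrow> 'a \<Rightarrow> real) \<Rightarrow> (nat \<Rightarrow> 'a \<Rightarrow> 'z) \<Rightarrow> bool" where
  "unpredictable_given_noise M W N \<longleftrightarrow>
     (\<forall>n k \<nu>. \<forall>B \<in> sets borel. 1 \<le> k \<longrightarrow> \<P>(\<omega> in M. \<forall>i\<in>{1..n}. N i \<omega> = \<nu> i) \<noteq> 0 \<longrightarrow>
        \<P>(\<omega> in M. W (n + k) \<omega> \<in> B \<bar> \<forall>i\<in>{1..n}. N i \<omega> = \<nu> i) = \<P>(\<omega> in M. W (n + k) \<omega> \<in> B))"

definition limiting_distribution :: "'a measure \<Rightarrow> (nat \<Rightarrow> 'a \<Rightarrow> real) \<Rightarrow> real measure \<Rightarrow> bool" where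
  "limiting_distribution M W \<pi> \<longleftrightarrow>
     real_distribution \<pi> \<and> weak_conv_m (\<lambda>n. distr M borel (W n)) \<pi>"

section \<open>Codes and capacity\<close>

text \<open>
  The messages are \<open>{..<L}\<close>, the codeword of \<open>m\<close> is \<open>f m 1, \<dots>, f m n\<close>, and a decoder maps
  \<open>(Y^n, A^n, D^n)\<close> to a message. Decoders must be measurable, as otherwise the error integral
  would be meaningless.
\<close>

type_synonym 'y decoder = "(nat \<Rightarrow> 'y) \<Rightarrow> (nat \<Rightarrow> real) \<Rightarrow> (nat \<Rightarrow> real) \<Rightarrow> nat"

definition timing_decoders :: "nat \<Rightarrow> 'y decoder set" where
  "timing_decoders n = {h. \<forall>y. (\<lambda>(a, d). h y a d) \<in>
     (\<Pi>\<^sub>M i\<in>{1..n}. borel) \<Otimes>\<^sub>M (\<Pi>\<^sub>M i\<in>{1..n}. borel) \<rightarrow>\<^sub>M count_space UNIV}"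

definition timing_free_decoders :: "nat \<Rightarrow> 'y decoder set" where
  "timing_free_decoders n = {h. \<exists>h'. \<forall>y a d. h y a d = h' y}"

definition error_probability ::
  "'a measure \<Rightarrow> (nat \<Rightarrow> 'a \<Rightarrow> real) \<Rightarrow> (nat \<Rightarrow> 'a \<Rightarrow> real) \<Rightarrow> ('x \<Rightarrow> real \<Rightarrow> 'y pmf)
    \<Rightarrow> nat \<Rightarrow> (nat \<Rightarrow> nat \<Rightarrow> 'x) \<Rightarrow> 'y decoder \<Rightarrow> nat \<Rightarrow> real" where
  "error_probability M tau S Q n f h m =
     (\<integral>\<omega>. measure_pmf.prob
            (Pi_pmf {1..n} undefined (\<lambda>i. Q (f m i) (waiting tau S i \<omega>)))
            {y. h y (\<lambda>i\<in>{1..n}. arrival tau i \<omega>) (\<lambda>i\<in>{1..n}. departure tau S i \<omega>) \<noteq> m} \<partial>M)"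

text \<open>
  The parameter \<open>Dec\<close> is the class of admissible decoders. The departure times do not depend on
  the codeword, so the time constraint is the same for all codewords.
\<close>

definition eps_achievable_code ::
  "'a measure \<Rightarrow> (nat \<Rightarrow> 'a \<Rightarrow> real) \<Rightarrow> (nat \<Rightarrow> 'a \<Rightarrow> real) \<Rightarrow> ('x \<Rightarrow> real \<Rightarrow> 'y pmf)
    \<Rightarrow> (nat \<Rightarrow> 'y decoder set) \<Rightarrow> real \<Rightarrow> nat \<Rightarrow> real \<Rightarrow> real \<Rightarrow> bool" where
  "eps_achievable_code M tau S Q Dec \<epsilon> n R' T \<longleftrightarrow>
     (\<exists>L f h. h \<in> Dec n \<and> real L = 2 powr (real n * R') \<and>
        (\<integral>\<omega>. departure tau S n \<omega> \<partial>M) < T \<and>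
        (\<Sum>m<L. error_probability M tau S Q n f h m) / real L < \<epsilon>)"

text \<open>
  As usual for capacities, achievability is asymptotic in the block length. Without
  the requirement \<open>n0 \<le> n\<close> a single short block starting in the empty system, whose
  first symbols wait less than in the limit, could beat the long-run rate.
\<close>

definition achievable_rate ::
  "'a measure \<Rightarrow> (nat \<Rightarrow> 'a \<Rightarrow> real) \<Rightarrow> (nat \<Rightarrow> 'a \<Rightarrow> real) \<Rightarrow> ('x \<Rightarrow> real \<Rightarrow> 'y pmf)
    \<Rightarrow> (nat \<Rightarrow> 'y decoder set) \<Rightarrow> real \<Rightarrow> bool" where
  "achievable_rate M tau S Q Dec R \<longleftrightarrow>
     (\<forall>\<epsilon>. 0 < \<epsilon> \<longrightarrow> \<epsilon> < 1 \<longrightarrow> (\<forall>n0. \<exists>n\<ge>n0. \<exists>R' T.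
        R = real n * R' / T \<and> eps_achievable_code M tau S Q Dec \<epsilon> n R' T))"

definition capacity ::
  "'a measure \<Rightarrow> (nat \<Rightarrow> 'a \<Rightarrow> real) \<Rightarrow> (nat \<Rightarrow> 'a \<Rightarrow> real) \<Rightarrow> ('x \<Rightarrow> real \<Rightarrow> 'y pmf)
    \<Rightarrow> (nat \<Rightarrow> 'y decoder set) \<Rightarrow> ereal" where
  "capacity M tau S Q Dec = (SUP R \<in> {R. achievable_rate M tau S Q Dec R}. ereal R)"

section \<open>Entropy of a law on a finite alphabet\<close>

definition shannon_entropy :: "'z measure \<Rightarrow> real" where
  "shannon_entropy P = prob_space.entropy P 2 (count_space UNIV) (\<lambda>z. z)"

lemma shannon_entropy_eq:
  fixes P :: "'z :: finite measure"
  assumes "prob_space P" and "sets P = UNIV"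
  shows "shannon_entropy P = - (\<Sum>z\<in>UNIV. measure P {z} * log 2 (measure P {z}))"
proof -
  interpret prob_space P by fact
  interpret information_space P 2 by standard simp
  have space: "space P = UNIV"
    using assms(2) sets_eq_imp_space_eq[of P "count_space UNIV"] by simp
  have "simple_distributed P (\<lambda>z. z) (\<lambda>z. measure P {z})"
    by (rule simple_distributedI) (auto simp: space simple_function_def assms(2) vimage_def)
  from entropy_simple_distributed[OF this] show ?thesis
    by (simp add: shannon_entropy_def space)
qed

text \<open>\<open>noise_mixture \<pi> K\<close> is the law \<open>\<integral>P(N \<in> \<cdot> | W = w) d\<pi>(w)\<close>.\<close>

definition noise_mixture :: "real measure \<Rightarrow> (real \<Rightarrow> 'z pmf) \<Rightarrow> 'z measure" where
  "noise_mixture \<pi> K = \<pi> \<bind> (\<lambda>w. measure_pmf (K w))"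

end

theory Submission
  imports Defs
begin

text \<open>
  The channel permutes noise words, so coding reduces to the information spectrum of the noise:
  a code with error below one needs at most about \<open>|X|^n\<close> over the size of the typical set of noise
  words many messages, and a threshold decoder attains this for a codebook chosen greedily in
  place of a random one. Hence the capacity is \<open>lam * (log |X| - h)\<close> once the normalised
  information of the noise word converges to \<open>h\<close> in probability and the mean departure time of
  symbol \<open>n\<close> is asymptotically \<open>n / lam\<close>.

  Given its laws, the noise is a product, and Chebyshev's inequality replaces the information by the
  sum of the entropies of these laws. With known timings these are functions of the waiting
  times. The transition operator of the waiting time chain maps bounded measurable functions to
  Lipschitz functions, which upgrades the assumed weak convergence to setwise convergence. Coupling
  with a chain restarted from the empty system, which lies below the true one and has nearly the
  same law, bounds correlations and yields a weak law of large numbers. Without the timings,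
  unpredictability makes the noise symbols independent with laws converging to the mixture.
\<close>

section \<open>Coding over a channel that permutes a finite set of noise words\<close>

text \<open>Three obstacles shape the probabilistic part. The kernel \<open>K\<close> is only
  measurable in the waiting time, so entropies and probabilities of the noise laws are not
  admissible test functions for weak convergence; the smoothing that is needed comes from the
  exponential interarrival density. The service times have only a first moment, so the limit law may
  have infinite mean; hence coupled chains are compared through the bounded decreasing function
  \<open>exp (- lam * w)\<close>, and the mean waiting time is only shown to be \<open>o(n)\<close>,
  by uniform integrability of the service times. Finally the queue starts empty and not in its
  stationary law, so correlation bounds have to hold uniformly in the starting index. On the coding
  side, bijectivity in both arguments makes \<open>g\<close> a Latin square: the noise that turns an
  input into a given output runs once through the alphabet as the input varies. The coding bounds
  hold for every noise law, so they may be averaged over random side information, and one codebook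
  serves all timings.\<close>

lemma code_success_le:
  fixes \<kappa> :: "'z \<Rightarrow> real" and h :: "'y \<Rightarrow> nat"
  assumes nonneg: "\<And>z. z \<in> Z \<Longrightarrow> 0 \<le> \<kappa> z" and t: "0 \<le> t"
    and bij: "\<And>x. bij_betw (G x) Z Y"
  shows "(\<Sum>m<L. \<Sum>z\<in>Z. \<kappa> z * of_bool (h (G (f m) z) = m))
    \<le> real L * (\<Sum>z\<in>Z. \<kappa> z * of_bool (t < \<kappa> z)) + t * real (card Y)"
proof -
  \<comment> \<open>A heavy noise word is charged its full weight for every message; a light one
    contributes at most \<open>t\<close> for each message decoded correctly under it.\<close>
  have "(\<Sum>m<L. \<Sum>z\<in>Z. \<kappa> z * of_bool (h (G (f m) z) = m))
    \<le> (\<Sum>m<L. \<Sum>z\<in>Z. \<kappa> z * of_bool (t < \<kappa> z) + t * of_bool (h (G (f m) z) = m))"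
    using nonneg t by (intro sum_mono) (auto simp: of_bool_def)
  also have "\<dots> = real L * (\<Sum>z\<in>Z. \<kappa> z * of_bool (t < \<kappa> z))
      + t * (\<Sum>m<L. \<Sum>z\<in>Z. of_bool (h (G (f m) z) = m))"
    by (simp add: sum.distrib sum_distrib_left)
  also have "(\<Sum>m<L. \<Sum>z\<in>Z. of_bool (h (G (f m) z) = m)) = (\<Sum>m<L. \<Sum>y\<in>Y. of_bool (h y = m) :: real)"
    by (intro sum.cong refl sum.reindex_bij_betw bij)
  \<comment> \<open>Counting by outputs: the decoder assigns each output to one message only, so the
    successes number at most \<open>card Y\<close>.\<close>
  also have "\<dots> = (\<Sum>y\<in>Y. \<Sum>m<L. of_bool (h y = m))"
    by (rule sum.swap)
  also have "\<dots> \<le> (\<Sum>y\<in>Y. 1)"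
  proof (intro sum_mono)
    fix y
    have "(\<Sum>m<L. of_bool (h y = m) :: real) = (\<Sum>m\<in>{..<L} \<inter> {h y}. 1)"
      by (intro sum.mono_neutral_cong_right) auto
    also have "\<dots> \<le> 1" by (cases "h y < L") auto
    finally show "(\<Sum>m<L. of_bool (h y = m) :: real) \<le> 1" .
  qed
  finally show ?thesis using t by (simp add: mult_left_mono)
qed

text \<open>When the sent message passes the test, the result is at most that message, hence a
  genuine message; the error bound counts every other case as an error.\<close>

definition threshold_decoder :: "('x \<Rightarrow> 'y \<Rightarrow> 'z) \<Rightarrow> real \<Rightarrow> ('z \<Rightarrow> real) \<Rightarrow> (nat \<Rightarrow> 'x) \<Rightarrow> 'y \<Rightarrow> nat" where
  "threshold_decoder J t \<kappa> f y = (LEAST m. t < \<kappa> (J (f m) y))"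

text \<open>The probability that, with \<open>x\<close> sent, the noise word explaining the output
  by \<open>x'\<close> also passes the test: the pairwise term of the union bound.\<close>

definition confusion :: "('x \<Rightarrow> 'z \<Rightarrow> 'y) \<Rightarrow> ('x \<Rightarrow> 'y \<Rightarrow> 'z) \<Rightarrow> 'z set \<Rightarrow> real \<Rightarrow> ('z \<Rightarrow> real) \<Rightarrow> 'x \<Rightarrow> 'x \<Rightarrow> real" where
  "confusion G J Z t \<kappa> x x' = (\<Sum>z\<in>Z. \<kappa> z * of_bool (t < \<kappa> (J x' (G x z))))"

lemma threshold_decoder_error_le:
  assumes nonneg: "\<And>z. z \<in> Z \<Longrightarrow> 0 \<le> \<kappa> z"
    and J: "\<And>x z. z \<in> Z \<Longrightarrow> J x (G x z) = z" and m: "m < L"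
  shows "(\<Sum>z\<in>Z. \<kappa> z * of_bool (threshold_decoder J t \<kappa> f (G (f m) z) \<noteq> m))
    \<le> (\<Sum>z\<in>Z. \<kappa> z * of_bool (\<kappa> z \<le> t)) + (\<Sum>m'\<in>{..<L} - {m}. confusion G J Z t \<kappa> (f m) (f m'))"
proof -
  have pt: "of_bool (threshold_decoder J t \<kappa> f (G (f m) z) \<noteq> m)
     \<le> (of_bool (\<kappa> z \<le> t) + (\<Sum>m'\<in>{..<L} - {m}. of_bool (t < \<kappa> (J (f m') (G (f m) z)))) :: real)"
    if z: "z \<in> Z" for z
  proof (cases "\<kappa> z \<le> t")
    case True
    then show ?thesis by (auto intro: sum_nonneg)
  next
    case False
    let ?P = "\<lambda>m'. t < \<kappa> (J (f m') (G (f m) z))"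
    let ?m = "threshold_decoder J t \<kappa> f (G (f m) z)"
    have Pm: "?P m" using False J[OF z, of "f m"] by simp
    then have P: "?P ?m" and le: "?m \<le> m"
      unfolding threshold_decoder_def by (rule LeastI, rule Least_le)
    show ?thesis
    proof (cases "?m = m")
      case True
      then show ?thesis by (auto intro: sum_nonneg)
    next
      case neq: False
      then have "?m \<in> {..<L} - {m}" using le m by auto
      then have "of_bool (?P ?m) \<le> (\<Sum>m'\<in>{..<L} - {m}. of_bool (?P m') :: real)"
        by (intro member_le_sum) auto
      with P neq show ?thesis by simp
    qed
  qed
  have "(\<Sum>z\<in>Z. \<kappa> z * of_bool (threshold_decoder J t \<kappa> f (G (f m) z) \<noteq> m))
    \<le> (\<Sum>z\<in>Z. \<kappa> z * (of_bool (\<kappa> z \<le> t) + (\<Sum>m'\<in>{..<L} - {m}. of_bool (t < \<kappa> (J (f m') (G (f m) z))))))"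
    using pt nonneg by (intro sum_mono mult_left_mono) auto
  also have "\<dots> = (\<Sum>z\<in>Z. \<kappa> z * of_bool (\<kappa> z \<le> t)) + (\<Sum>m'\<in>{..<L} - {m}. confusion G J Z t \<kappa> (f m) (f m'))"
    unfolding confusion_def distrib_left sum.distrib sum_distrib_left
    by (intro arg_cong2[where f = plus] refl sum.swap)
  finally show ?thesis .
qed

lemma count_above_threshold:
  fixes \<kappa> :: "'z \<Rightarrow> real"
  assumes nonneg: "\<And>z. z \<in> Z \<Longrightarrow> 0 \<le> \<kappa> z" and one: "sum \<kappa> Z = 1" and t: "0 < t"
  shows "(\<Sum>z\<in>Z. of_bool (t < \<kappa> z)) \<le> 1 / t"
proof -
  have "t * (\<Sum>z\<in>Z. of_bool (t < \<kappa> z)) \<le> (\<Sum>z\<in>Z. \<kappa> z)"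
    unfolding sum_distrib_left using nonneg by (intro sum_mono) (auto simp: of_bool_def)
  with one t show ?thesis by (simp add: field_simps)
qed

text \<open>Random coding in counting form. With \<open>x\<close> and \<open>z\<close> fixed, a
  varying \<open>x'\<close> makes the explanation \<open>J x' (G x z)\<close> run once through
  \<open>Z\<close>; with \<open>x'\<close> fixed, a varying \<open>x\<close> makes the output run
  through \<open>Y\<close> and then its explanation through \<open>Z\<close>. Either way the number
  of heavy words remains. Both sums are needed since \<open>confusion\<close> is not
  symmetric.\<close>

lemma confusion_sums:
  fixes \<kappa> :: "'z \<Rightarrow> real"
  assumes nonneg: "\<And>z. z \<in> Z \<Longrightarrow> 0 \<le> \<kappa> z" and one: "sum \<kappa> Z = 1" and t: "0 < t"
    and G: "\<And>x z. z \<in> Z \<Longrightarrow> G x z \<in> Y"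
    and bij_x: "\<And>z. z \<in> Z \<Longrightarrow> bij_betw (\<lambda>x. G x z) X Y"
    and J_x: "\<And>y. y \<in> Y \<Longrightarrow> bij_betw (\<lambda>x. J x y) X Z"
    and J_y: "\<And>x. bij_betw (J x) Y Z"
  shows "(\<Sum>x'\<in>X. confusion G J Z t \<kappa> x x') \<le> 1 / t" and "(\<Sum>x\<in>X. confusion G J Z t \<kappa> x x') \<le> 1 / t"
proof -
  note count = count_above_threshold[OF nonneg one t]
  have "(\<Sum>x'\<in>X. confusion G J Z t \<kappa> x x')
      = (\<Sum>z\<in>Z. \<kappa> z * (\<Sum>x'\<in>X. of_bool (t < \<kappa> (J x' (G x z)))))"
    unfolding confusion_def by (subst sum.swap) (simp add: sum_distrib_left)
  also have "\<dots> = (\<Sum>z\<in>Z. \<kappa> z * (\<Sum>z'\<in>Z. of_bool (t < \<kappa> z')))"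
    by (intro sum.cong refl arg_cong2[where f = times] sum.reindex_bij_betw J_x G)
  also have "\<dots> = (\<Sum>z'\<in>Z. of_bool (t < \<kappa> z'))"
    by (simp add: sum_distrib_right[symmetric] one)
  finally show "(\<Sum>x'\<in>X. confusion G J Z t \<kappa> x x') \<le> 1 / t" using count by simp
  have "(\<Sum>x\<in>X. confusion G J Z t \<kappa> x x')
      = (\<Sum>z\<in>Z. \<kappa> z * (\<Sum>x\<in>X. of_bool (t < \<kappa> (J x' (G x z)))))"
    unfolding confusion_def by (subst sum.swap) (simp add: sum_distrib_left)
  also have "\<dots> = (\<Sum>z\<in>Z. \<kappa> z * (\<Sum>y\<in>Y. of_bool (t < \<kappa> (J x' y))))"
    using sum.reindex_bij_betw[OF bij_x, of _ "\<lambda>y. of_bool (t < \<kappa> (J x' y)) :: real"]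
    by (intro sum.cong refl) simp
  also have "\<dots> = (\<Sum>z\<in>Z. \<kappa> z * (\<Sum>z'\<in>Z. of_bool (t < \<kappa> z')))"
    by (intro sum.cong refl arg_cong2[where f = times] sum.reindex_bij_betw J_y)
  also have "\<dots> = (\<Sum>z'\<in>Z. of_bool (t < \<kappa> z'))"
    by (simp add: sum_distrib_right[symmetric] one)
  finally show "(\<Sum>x\<in>X. confusion G J Z t \<kappa> x x') \<le> 1 / t" using count by simp
qed

text \<open>
  Derandomised random coding: each new codeword is chosen so that its confusion with the previous
  ones is at most the average over all words.
\<close>

lemma greedy_codebook:
  fixes \<beta> :: "'x \<Rightarrow> 'x \<Rightarrow> real"
  assumes fin: "finite X" "X \<noteq> {}"
    and row: "\<And>x. x \<in> X \<Longrightarrow> (\<Sum>x'\<in>X. \<beta> x x') \<le> b" and col: "\<And>x. x \<in> X \<Longrightarrow> (\<Sum>x'\<in>X. \<beta> x' x) \<le> b"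
    and b: "0 \<le> b"
  shows "\<exists>f. (\<forall>m<L. f m \<in> X) \<and>
    (\<Sum>m<L. \<Sum>m'\<in>{..<L} - {m}. \<beta> (f m) (f m')) \<le> (real L)\<^sup>2 * (b / real (card X))"
proof (induction L)
  case 0
  then show ?case by simp
next
  case (Suc L)
  then obtain f where f: "\<And>m. m < L \<Longrightarrow> f m \<in> X" and
    bound: "(\<Sum>m<L. \<Sum>m'\<in>{..<L} - {m}. \<beta> (f m) (f m')) \<le> (real L)\<^sup>2 * (b / real (card X))"
    by blast
  \<comment> \<open>The cross terms, in both directions, that appending \<open>x\<close> would add.
    Their total over all words is at most \<open>2 * L * b\<close>, so some word does not exceed the
    average.\<close>
  define s where "s x = (\<Sum>m<L. \<beta> (f m) x + \<beta> x (f m))" for x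
  have card: "0 < card X" using fin by (simp add: card_gt_0_iff)
  have "(\<Sum>x\<in>X. s x) = (\<Sum>m<L. (\<Sum>x\<in>X. \<beta> (f m) x) + (\<Sum>x\<in>X. \<beta> x (f m)))"
    unfolding s_def by (subst sum.swap) (simp add: sum.distrib)
  also have "\<dots> \<le> (\<Sum>m<L. b + b)"
    using row col f by (intro sum_mono add_mono) auto
  also have "\<dots> = (\<Sum>x\<in>X. 2 * real L * b / real (card X))"
    using card by (simp add: field_simps)
  finally have "\<exists>x\<in>X. s x \<le> 2 * real L * b / real (card X)"
    using sum_strict_mono[of X "\<lambda>_. 2 * real L * b / real (card X)" s] fin by fastforce
  then obtain x where x: "x \<in> X" "s x \<le> 2 * real L * b / real (card X)" by blast
  define f' where "f' = f(L := x)"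
  have "(\<Sum>m<Suc L. \<Sum>m'\<in>{..<Suc L} - {m}. \<beta> (f' m) (f' m'))
      = (\<Sum>m<L. \<Sum>m'\<in>{..<Suc L} - {m}. \<beta> (f' m) (f' m')) + (\<Sum>m'\<in>{..<Suc L} - {L}. \<beta> (f' L) (f' m'))"
    by simp
  also have "(\<Sum>m<L. \<Sum>m'\<in>{..<Suc L} - {m}. \<beta> (f' m) (f' m'))
      = (\<Sum>m<L. (\<Sum>m'\<in>{..<L} - {m}. \<beta> (f m) (f m')) + \<beta> (f m) x)"
  proof (intro sum.cong refl)
    fix m assume "m \<in> {..<L}"
    then have "{..<Suc L} - {m} = insert L ({..<L} - {m})" "m \<noteq> L" by auto
    then show "(\<Sum>m'\<in>{..<Suc L} - {m}. \<beta> (f' m) (f' m')) = (\<Sum>m'\<in>{..<L} - {m}. \<beta> (f m) (f m')) + \<beta> (f m) x"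
      by (simp add: f'_def)
  qed
  also have "(\<Sum>m'\<in>{..<Suc L} - {L}. \<beta> (f' L) (f' m')) = (\<Sum>m<L. \<beta> x (f m))"
    by (intro sum.cong) (auto simp: f'_def)
  also have "(\<Sum>m<L. (\<Sum>m'\<in>{..<L} - {m}. \<beta> (f m) (f m')) + \<beta> (f m) x) + (\<Sum>m<L. \<beta> x (f m))
      = (\<Sum>m<L. \<Sum>m'\<in>{..<L} - {m}. \<beta> (f m) (f m')) + s x"
    by (simp add: s_def sum.distrib)
  also have "\<dots> \<le> (real L)\<^sup>2 * (b / real (card X)) + 2 * real L * b / real (card X)"
    using bound x by simp
  \<comment> \<open>The quadratic form survives because
    \<open>L^2 + 2 * L \<le> (L + 1)^2\<close>.\<close>
  also have "\<dots> \<le> (real (Suc L))\<^sup>2 * (b / real (card X))"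
    using b card by (simp add: field_simps power2_eq_square)
  finally show ?case
    using f x by (intro exI[of _ f']) (auto simp: f'_def less_Suc_eq)
qed

text \<open>
  The weights \<open>\<kappa> \<omega>\<close> are the law of the noise word given the side information \<open>\<omega>\<close>; a
  constant \<open>\<kappa>\<close> describes a decoder without side information.
\<close>

locale noise_channel = prob_space M
  for M :: "'a measure" +
  fixes \<kappa> :: "'a \<Rightarrow> 'z \<Rightarrow> real" and G :: "'x \<Rightarrow> 'z \<Rightarrow> 'y" and J :: "'x \<Rightarrow> 'y \<Rightarrow> 'z"
    and X :: "'x set" and Y :: "'y set" and Z :: "'z set"
  assumes finite_X: "finite X" and nonempty_X: "X \<noteq> {}" and finite_Z: "finite Z"
    and \<kappa>_measurable [measurable]: "\<And>z. z \<in> Z \<Longrightarrow> (\<lambda>\<omega>. \<kappa> \<omega> z) \<in> borel_measurable M"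
    and \<kappa>_nonneg: "\<And>\<omega> z. z \<in> Z \<Longrightarrow> 0 \<le> \<kappa> \<omega> z"
    and \<kappa>_sum: "\<And>\<omega>. sum (\<kappa> \<omega>) Z = 1"
    and bij_G: "\<And>x. bij_betw (G x) Z Y"
    and bij_G_input: "\<And>z. z \<in> Z \<Longrightarrow> bij_betw (\<lambda>x. G x z) X Y"
    and J_G: "\<And>x z. z \<in> Z \<Longrightarrow> J x (G x z) = z"
begin

lemma card_Y: "card Y = card X"
proof -
  have "Z \<noteq> {}" using \<kappa>_sum by auto
  then obtain z where "z \<in> Z" by auto
  then show ?thesis using bij_betw_same_card[OF bij_G_input] by metis
qed

lemma G_J: "y \<in> Y \<Longrightarrow> J x y \<in> Z \<and> G x (J x y) = y"
  using bij_G[of x] J_G by (force simp: bij_betw_def)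

lemma bij_J: "bij_betw (J x) Y Z"
  by (rule bij_betw_byWitness[where f' = "G x"]) (use G_J J_G bij_G[of x] in \<open>auto simp: bij_betw_def\<close>)

text \<open>The Latin square property: if two inputs needed the same noise \<open>z\<close> for the
  output \<open>y\<close>, then \<open>\<lambda>x. G x z\<close> would not be injective. Equal
  cardinalities give surjectivity.\<close>

lemma bij_J_input:
  assumes "y \<in> Y" shows "bij_betw (\<lambda>x. J x y) X Z"
proof -
  have inj: "inj_on (\<lambda>x. J x y) X"
  proof (rule inj_onI)
    fix x x' assume "x \<in> X" "x' \<in> X" "J x y = J x' y"
    then show "x = x'"
      using G_J[OF assms, of x] G_J[OF assms, of x'] bij_G_input[of "J x y"]
      by (metis bij_betw_def inj_onD)
  qed
  have "card Z = card X" using card_Y bij_betw_same_card[OF bij_G] by metis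
  then have "(\<lambda>x. J x y) ` X = Z"
    using G_J[OF assms] finite_Z by (intro card_subset_eq) (auto simp: card_image[OF inj])
  with inj show ?thesis by (simp add: bij_betw_def)
qed

text \<open>The information spectrum: the probability that the noise word has conditional
  probability at most \<open>t\<close>, that is, information at least
  \<open>- log 2 t\<close>.\<close>

definition mass_below :: "real \<Rightarrow> real" where
  "mass_below t = (\<integral>\<omega>. (\<Sum>z\<in>Z. \<kappa> \<omega> z * of_bool (\<kappa> \<omega> z \<le> t)) \<partial>M)"

definition code_error :: "(nat \<Rightarrow> 'x) \<Rightarrow> ('a \<Rightarrow> 'y \<Rightarrow> nat) \<Rightarrow> nat \<Rightarrow> real" where
  "code_error f h m = (\<integral>\<omega>. (\<Sum>z\<in>Z. \<kappa> \<omega> z * of_bool (h \<omega> (G (f m) z) \<noteq> m)) \<partial>M)"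

lemma \<kappa>_le_1: "z \<in> Z \<Longrightarrow> \<kappa> \<omega> z \<le> 1"
  using member_le_sum[of z Z "\<kappa> \<omega>"] \<kappa>_nonneg finite_Z \<kappa>_sum by auto

lemma integrable_weighted:
  assumes "\<And>z. z \<in> Z \<Longrightarrow> {\<omega> \<in> space M. P \<omega> z} \<in> sets M"
  shows "integrable M (\<lambda>\<omega>. \<Sum>z\<in>Z. \<kappa> \<omega> z * of_bool (P \<omega> z))"
proof (intro Bochner_Integration.integrable_sum integrable_const_bound[where B = 1] AE_I2)
  fix z assume z: "z \<in> Z"
  have "(\<lambda>\<omega>. of_bool (P \<omega> z) :: real) \<in> borel_measurable M"
    using assms[OF z]
    by (subst measurable_cong[where g = "indicator {\<omega> \<in> space M. P \<omega> z}"]) (auto simp: indicator_def intro!: borel_measurable_indicator)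
  then show "(\<lambda>\<omega>. \<kappa> \<omega> z * of_bool (P \<omega> z)) \<in> borel_measurable M" using z by simp
  show "norm (\<kappa> \<omega> z * of_bool (P \<omega> z)) \<le> 1" for \<omega>
    using \<kappa>_nonneg[OF z] \<kappa>_le_1[OF z] by (auto simp: abs_mult of_bool_def)
qed

lemma weighted_split: "(\<Sum>z\<in>Z. \<kappa> \<omega> z * of_bool (\<not> P z)) = 1 - (\<Sum>z\<in>Z. \<kappa> \<omega> z * of_bool (P z))"
proof -
  have "(\<Sum>z\<in>Z. \<kappa> \<omega> z * of_bool (\<not> P z)) + (\<Sum>z\<in>Z. \<kappa> \<omega> z * of_bool (P z)) = (\<Sum>z\<in>Z. \<kappa> \<omega> z)"
    unfolding sum.distrib[symmetric] by (intro sum.cong) auto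
  then show ?thesis by (simp add: \<kappa>_sum)
qed

text \<open>A converse of Verdu-Han type: once \<open>L\<close> is far above
  \<open>t * card X\<close>, the error is essentially at least the mass of the light words. If
  almost all words are light, this forces the error towards one.\<close>

lemma code_error_ge:
  assumes t: "0 \<le> t" and L: "0 < L"
    and h [measurable]: "\<And>y. y \<in> Y \<Longrightarrow> (\<lambda>\<omega>. h \<omega> y) \<in> M \<rightarrow>\<^sub>M count_space UNIV"
  shows "mass_below t - t * real (card X) / real L \<le> (\<Sum>m<L. code_error f h m) / real L"
proof -
  have int_err: "integrable M (\<lambda>\<omega>. \<Sum>z\<in>Z. \<kappa> \<omega> z * of_bool (h \<omega> (G (f m) z) \<noteq> m))" for m
  proof (rule integrable_weighted)
    fix z assume "z \<in> Z"
    then have [measurable]: "(\<lambda>\<omega>. h \<omega> (G (f m) z)) \<in> M \<rightarrow>\<^sub>M count_space UNIV"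
      using bij_G[of "f m"] by (intro h) (auto simp: bij_betw_def)
    show "{\<omega> \<in> space M. h \<omega> (G (f m) z) \<noteq> m} \<in> sets M" by measurable
  qed
  have int_low: "integrable M (\<lambda>\<omega>. \<Sum>z\<in>Z. \<kappa> \<omega> z * of_bool (\<kappa> \<omega> z \<le> t))"
    by (rule integrable_weighted) measurable
  have "real L * mass_below t - t * real (card X)
      = (\<integral>\<omega>. real L * (\<Sum>z\<in>Z. \<kappa> \<omega> z * of_bool (\<kappa> \<omega> z \<le> t)) - t * real (card X) \<partial>M)"
    using int_low by (simp add: mass_below_def prob_space)
  also have "\<dots> \<le> (\<integral>\<omega>. (\<Sum>m<L. \<Sum>z\<in>Z. \<kappa> \<omega> z * of_bool (h \<omega> (G (f m) z) \<noteq> m)) \<partial>M)"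
  proof (intro integral_mono)
    fix \<omega>
    have "(\<Sum>m<L. \<Sum>z\<in>Z. \<kappa> \<omega> z * of_bool (h \<omega> (G (f m) z) = m))
      \<le> real L * (\<Sum>z\<in>Z. \<kappa> \<omega> z * of_bool (t < \<kappa> \<omega> z)) + t * real (card Y)"
      by (rule code_success_le[OF \<kappa>_nonneg t bij_G]) auto
    moreover have "(\<Sum>z\<in>Z. \<kappa> \<omega> z * of_bool (t < \<kappa> \<omega> z)) = 1 - (\<Sum>z\<in>Z. \<kappa> \<omega> z * of_bool (\<kappa> \<omega> z \<le> t))"
      using weighted_split[of \<omega> "\<lambda>z. \<kappa> \<omega> z \<le> t"] by (simp add: not_le)
    ultimately show "real L * (\<Sum>z\<in>Z. \<kappa> \<omega> z * of_bool (\<kappa> \<omega> z \<le> t)) - t * real (card X)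
      \<le> (\<Sum>m<L. \<Sum>z\<in>Z. \<kappa> \<omega> z * of_bool (h \<omega> (G (f m) z) \<noteq> m))"
      by (simp add: weighted_split[of \<omega> "\<lambda>z. h \<omega> (G (f m) z) = m" for m] sum_subtractf card_Y
            right_diff_distrib)
  qed (use int_err int_low in auto)
  also have "\<dots> = (\<Sum>m<L. code_error f h m)"
    unfolding code_error_def by (intro Bochner_Integration.integral_sum int_err)
  finally have "(real L * mass_below t - t * real (card X)) / real L \<le> (\<Sum>m<L. code_error f h m) / real L"
    by (rule divide_right_mono) simp
  then show ?thesis using L by (simp add: diff_divide_distrib)
qed

text \<open>The factor \<open>1 / (t * card X)\<close> bounds the chance that a random competitor
  passes the test; the union bound multiplies it by the number of messages.\<close>

lemma exists_code:
  assumes t: "0 < t" and L: "0 < L"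
  shows "\<exists>f. (\<forall>m<L. f m \<in> X) \<and>
    (\<Sum>m<L. code_error f (\<lambda>\<omega>. threshold_decoder J t (\<kappa> \<omega>) f) m) / real L
      \<le> mass_below t + real L / (t * real (card X))"
proof -
  \<comment> \<open>Confusion is averaged over the side information before the codebook is chosen,
    because the encoder does not see the timings.\<close>
  define \<beta> where "\<beta> x x' = (\<integral>\<omega>. confusion G J Z t (\<kappa> \<omega>) x x' \<partial>M)" for x x'
  have J_meas [measurable]: "(\<lambda>\<omega>. \<kappa> \<omega> (J x y)) \<in> borel_measurable M" if "y \<in> Y" for x y
    using G_J[OF that] by auto
  have G_in: "G x z \<in> Y" if "z \<in> Z" for x z
    using bij_G[of x] that by (auto simp: bij_betw_def)
  have int_conf: "integrable M (\<lambda>\<omega>. confusion G J Z t (\<kappa> \<omega>) x x')" for x x'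
    unfolding confusion_def
  proof (rule integrable_weighted)
    fix z assume "z \<in> Z"
    note [measurable] = J_meas[OF G_in[OF this]]
    show "{\<omega> \<in> space M. t < \<kappa> \<omega> (J x' (G x z))} \<in> sets M" by measurable
  qed
  have int_low: "integrable M (\<lambda>\<omega>. \<Sum>z\<in>Z. \<kappa> \<omega> z * of_bool (\<kappa> \<omega> z \<le> t))"
    by (rule integrable_weighted) measurable
  note sums = confusion_sums[OF \<kappa>_nonneg \<kappa>_sum t G_in bij_G_input bij_J_input bij_J]
  have row: "(\<Sum>x'\<in>X. \<beta> x x') \<le> 1 / t" for x
  proof -
    have "(\<Sum>x'\<in>X. \<beta> x x') = (\<integral>\<omega>. (\<Sum>x'\<in>X. confusion G J Z t (\<kappa> \<omega>) x x') \<partial>M)"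
      unfolding \<beta>_def using int_conf by (subst Bochner_Integration.integral_sum) auto
    also have "\<dots> \<le> (\<integral>\<omega>. 1 / t \<partial>M)"
      using int_conf sums(1) by (intro integral_mono Bochner_Integration.integrable_sum) auto
    finally show ?thesis by (simp add: prob_space)
  qed
  have col: "(\<Sum>x\<in>X. \<beta> x x') \<le> 1 / t" for x'
  proof -
    have "(\<Sum>x\<in>X. \<beta> x x') = (\<integral>\<omega>. (\<Sum>x\<in>X. confusion G J Z t (\<kappa> \<omega>) x x') \<partial>M)"
      unfolding \<beta>_def using int_conf by (subst Bochner_Integration.integral_sum) auto
    also have "\<dots> \<le> (\<integral>\<omega>. 1 / t \<partial>M)"
      using int_conf sums(2) by (intro integral_mono Bochner_Integration.integrable_sum) auto
    finally show ?thesis by (simp add: prob_space)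
  qed
  obtain f where f: "\<forall>m<L. f m \<in> X" and
    bound: "(\<Sum>m<L. \<Sum>m'\<in>{..<L} - {m}. \<beta> (f m) (f m')) \<le> (real L)\<^sup>2 * (1 / t / real (card X))"
    using greedy_codebook[of X \<beta> "1 / t" L] finite_X nonempty_X row col t by auto
  have err: "code_error f (\<lambda>\<omega>. threshold_decoder J t (\<kappa> \<omega>) f) m
      \<le> mass_below t + (\<Sum>m'\<in>{..<L} - {m}. \<beta> (f m) (f m'))" if m: "m < L" for m
  proof -
    have int_err: "integrable M (\<lambda>\<omega>. \<Sum>z\<in>Z. \<kappa> \<omega> z * of_bool (threshold_decoder J t (\<kappa> \<omega>) f (G (f m) z) \<noteq> m))"
    proof (rule integrable_weighted)
      fix z assume "z \<in> Z"
      note [measurable] = J_meas[OF G_in[OF this]]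
      show "{\<omega> \<in> space M. threshold_decoder J t (\<kappa> \<omega>) f (G (f m) z) \<noteq> m} \<in> sets M"
        unfolding threshold_decoder_def by measurable
    qed
    have "code_error f (\<lambda>\<omega>. threshold_decoder J t (\<kappa> \<omega>) f) m
      \<le> (\<integral>\<omega>. (\<Sum>z\<in>Z. \<kappa> \<omega> z * of_bool (\<kappa> \<omega> z \<le> t))
           + (\<Sum>m'\<in>{..<L} - {m}. confusion G J Z t (\<kappa> \<omega>) (f m) (f m')) \<partial>M)"
      unfolding code_error_def using int_err int_low int_conf
      by (intro integral_mono threshold_decoder_error_le \<kappa>_nonneg J_G m) auto
    also have "\<dots> = mass_below t + (\<Sum>m'\<in>{..<L} - {m}. \<beta> (f m) (f m'))"
      unfolding mass_below_def \<beta>_def using int_low int_conf by simp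
    finally show ?thesis .
  qed
  have "(\<Sum>m<L. code_error f (\<lambda>\<omega>. threshold_decoder J t (\<kappa> \<omega>) f) m)
      \<le> (\<Sum>m<L. mass_below t + (\<Sum>m'\<in>{..<L} - {m}. \<beta> (f m) (f m')))"
    using err by (intro sum_mono) auto
  also have "\<dots> \<le> real L * mass_below t + (real L)\<^sup>2 * (1 / t / real (card X))"
    using bound by (simp add: sum.distrib)
  finally have "(\<Sum>m<L. code_error f (\<lambda>\<omega>. threshold_decoder J t (\<kappa> \<omega>) f) m) / real L
      \<le> mass_below t + real L / (t * real (card X))"
    using L by (simp add: field_simps power2_eq_square)
  with f show ?thesis by blast
qed

end

section \<open>Information of independent noise symbols\<close>

lemma shannon_entropy_pmf:
  fixes p :: "'z :: finite pmf"
  shows "shannon_entropy (measure_pmf p) = - (\<Sum>z\<in>UNIV. pmf p z * log 2 (pmf p z))"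
  using shannon_entropy_eq[of "measure_pmf p"] by (simp add: measure_pmf.prob_space_axioms pmf.rep_eq)

text \<open>Independence of \<open>p\<close> is the point: the variance of the information of a
  symbol becomes bounded uniformly over all noise laws.\<close>

lemma mult_log_square_le:
  fixes p :: real
  assumes "0 \<le> p" "p \<le> 1"
  shows "p * (log 2 p)\<^sup>2 \<le> 4 / (ln 2)\<^sup>2"
proof (cases "p = 0")
  case False
  with assms have p: "0 < p" by simp
  \<comment> \<open>Passing to the root halves the logarithm, and \<open>- ln s \<le> 1 / s\<close>
    gives \<open>p * (ln s)^2 \<le> 1\<close>; this is the origin of the 4.\<close>
  define s where "s = sqrt p"
  have s: "0 < s" "s \<le> 1" "s\<^sup>2 = p" using p assms by (auto simp: s_def)
  have "0 \<le> - ln s" using s by (simp add: ln_le_zero_iff)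
  moreover have "- ln s \<le> 1 / s"
    using ln_le_minus_one[of "1 / s"] s by (simp add: ln_div)
  ultimately have "(- ln s)\<^sup>2 \<le> (1 / s)\<^sup>2" by (intro power_mono)
  then have "(ln s)\<^sup>2 * p \<le> 1" using s p by (simp add: power_divide field_simps)
  moreover have "ln p = 2 * ln s" using s by (simp add: s_def ln_sqrt p)
  ultimately have "p * (ln p)\<^sup>2 \<le> 4" by (simp add: power_mult_distrib mult_ac)
  then show ?thesis by (simp add: log_def power_divide divide_right_mono)
qed simp

lemma Pi_pmf_expectation_component:
  fixes \<phi> :: "'z :: finite \<Rightarrow> real"
  assumes "finite A" "i \<in> A"
  shows "measure_pmf.expectation (Pi_pmf A d p) (\<lambda>f. \<phi> (f i)) = (\<Sum>z\<in>UNIV. pmf (p i) z * \<phi> z)"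
proof -
  have "measure_pmf.expectation (Pi_pmf A d p) (\<lambda>f. \<phi> (f i))
      = measure_pmf.expectation (map_pmf (\<lambda>f. f i) (Pi_pmf A d p)) \<phi>"
    by simp
  also have "map_pmf (\<lambda>f. f i) (Pi_pmf A d p) = p i"
    using assms by (simp add: Pi_pmf_component)
  finally show ?thesis by (simp add: integral_measure_pmf[of UNIV])
qed

lemma finite_set_Pi_pmf:
  fixes p :: "'i \<Rightarrow> 'z :: finite pmf"
  assumes "finite A" shows "finite (set_pmf (Pi_pmf A d p))"
proof (rule finite_subset)
  show "set_pmf (Pi_pmf A d p) \<subseteq> PiE_dflt A d (\<lambda>_. UNIV)"
    using set_Pi_pmf_subset[OF assms, of d p] by (auto simp: PiE_dflt_def)
qed (use assms in \<open>auto intro: finite_PiE_dflt\<close>)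

lemma (in prob_space) second_moment_sum:
  fixes Y :: "'i \<Rightarrow> 'a \<Rightarrow> real"
  assumes "\<And>i j. i \<in> I \<Longrightarrow> j \<in> I \<Longrightarrow> integrable M (\<lambda>\<omega>. Y i \<omega> * Y j \<omega>)"
  shows "integrable M (\<lambda>\<omega>. (\<Sum>i\<in>I. Y i \<omega>)\<^sup>2)"
    and "expectation (\<lambda>\<omega>. (\<Sum>i\<in>I. Y i \<omega>)\<^sup>2) = (\<Sum>i\<in>I. \<Sum>j\<in>I. expectation (\<lambda>\<omega>. Y i \<omega> * Y j \<omega>))"
  unfolding power2_eq_square sum_product using assms by auto

text \<open>Chebyshev's inequality with a constant that does not depend on the laws
  \<open>p i\<close>, so that the estimate can later be averaged over random laws.\<close>

lemma information_deviation:
  fixes p :: "nat \<Rightarrow> 'z :: finite pmf"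
  assumes n: "0 < n" and \<delta>: "0 < \<delta>"
  shows "measure_pmf.prob (Pi_pmf {1..n} d p)
      {z. real n * \<delta> \<le> \<bar>(\<Sum>i=1..n. - log 2 (pmf (p i) (z i))) - (\<Sum>i=1..n. shannon_entropy (measure_pmf (p i)))\<bar>}
    \<le> 4 * real CARD('z) / (ln 2)\<^sup>2 / (real n * \<delta>\<^sup>2)"
proof -
  let ?P = "Pi_pmf {1..n} d p"
  let ?C = "4 * real CARD('z) / (ln 2)\<^sup>2"
  define \<phi> where "\<phi> i z = - log 2 (pmf (p i) z) - shannon_entropy (measure_pmf (p i))" for i z
  have mean: "(\<Sum>z\<in>UNIV. pmf (p i) z * \<phi> i z) = 0" for i
    by (simp add: \<phi>_def right_diff_distrib sum_subtractf sum_distrib_right[symmetric] sum_pmf_eq_1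
        shannon_entropy_pmf sum_negf)
  have int: "integrable (measure_pmf ?P) f" for f :: "_ \<Rightarrow> real"
    by (intro integrable_measure_pmf_finite finite_set_Pi_pmf) simp
  have var: "measure_pmf.expectation ?P (\<lambda>z. \<phi> i (z i) * \<phi> i (z i)) \<le> ?C" if i: "i \<in> {1..n}" for i
  proof -
    let ?H = "shannon_entropy (measure_pmf (p i))"
    have "measure_pmf.expectation ?P (\<lambda>z. \<phi> i (z i) * \<phi> i (z i))
        = (\<Sum>z\<in>UNIV. pmf (p i) z * (\<phi> i z * \<phi> i z))"
      using i by (intro Pi_pmf_expectation_component) auto
    \<comment> \<open>With this expansion the middle sum vanishes by \<open>mean\<close> and the
      last one is \<open>?H * ?H\<close>, leaving the second moment minus the squared
      entropy.\<close>
    also have "\<dots> = (\<Sum>z\<in>UNIV. pmf (p i) z * (log 2 (pmf (p i) z))\<^sup>2 - ?H * (pmf (p i) z * \<phi> i z) - ?H * (pmf (p i) z * - log 2 (pmf (p i) z)))"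
      by (intro sum.cong) (auto simp: \<phi>_def power2_eq_square algebra_simps)
    also have "\<dots> = (\<Sum>z\<in>UNIV. pmf (p i) z * (log 2 (pmf (p i) z))\<^sup>2) - ?H * 0 - ?H * ?H"
      unfolding sum_subtractf sum_distrib_left[symmetric] mean
      by (simp add: shannon_entropy_pmf sum_negf)
    also have "\<dots> \<le> (\<Sum>z\<in>UNIV. pmf (p i) z * (log 2 (pmf (p i) z))\<^sup>2)" by simp
    also have "\<dots> \<le> (\<Sum>z\<in>(UNIV::'z set). 4 / (ln 2)\<^sup>2)"
      by (intro sum_mono mult_log_square_le) (auto simp: pmf_le_1)
    finally show ?thesis by (simp add: mult_ac)
  qed
  have cov: "measure_pmf.expectation ?P (\<lambda>z. \<phi> i (z i) * \<phi> j (z j)) = 0"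
    if ij: "i \<in> {1..n}" "j \<in> {1..n}" "i \<noteq> j" for i j
  proof -
    note ps = measure_pmf.prob_space_axioms[of ?P]
    have "prob_space.indep_vars (measure_pmf ?P) (\<lambda>_. count_space UNIV) (\<lambda>x f. f x) {i, j}"
      using ij by (intro prob_space.indep_vars_subset[OF ps indep_vars_Pi_pmf]) auto
    then have "prob_space.indep_vars (measure_pmf ?P) (\<lambda>_. borel) (\<lambda>k f. \<phi> k (f k)) {i, j}"
      by (rule prob_space.indep_vars_compose2[OF ps]) simp
    then have "measure_pmf.expectation ?P (\<lambda>z. \<Prod>k\<in>{i, j}. \<phi> k (z k))
        = (\<Prod>k\<in>{i, j}. measure_pmf.expectation ?P (\<lambda>z. \<phi> k (z k)))"
      by (intro prob_space.indep_vars_lebesgue_integral[OF ps] int) auto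
    moreover have "measure_pmf.expectation ?P (\<lambda>z. \<phi> i (z i)) = 0"
      using ij Pi_pmf_expectation_component[of "{1..n}" i d p "\<phi> i"] mean by simp
    ultimately show ?thesis using ij by simp
  qed
  have "measure_pmf.expectation ?P (\<lambda>z. (\<Sum>i=1..n. \<phi> i (z i))\<^sup>2)
      = (\<Sum>i=1..n. \<Sum>j=1..n. measure_pmf.expectation ?P (\<lambda>z. \<phi> i (z i) * \<phi> j (z j)))"
    by (intro measure_pmf.second_moment_sum int)
  also have "\<dots> = (\<Sum>i=1..n. \<Sum>j\<in>{i}. measure_pmf.expectation ?P (\<lambda>z. \<phi> i (z i) * \<phi> j (z j)))"
    using cov by (intro sum.cong refl sum.mono_neutral_right) auto
  also have "\<dots> \<le> (\<Sum>i=1..n. ?C)"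
    using var by (intro sum_mono) auto
  finally have second: "measure_pmf.expectation ?P (\<lambda>z. (\<Sum>i=1..n. \<phi> i (z i))\<^sup>2) \<le> real n * ?C"
    by simp
  have "measure_pmf.prob ?P {z \<in> space (measure_pmf ?P). real n * \<delta> \<le> \<bar>\<Sum>i=1..n. \<phi> i (z i)\<bar>}
      \<le> measure_pmf.expectation ?P (\<lambda>z. (\<Sum>i=1..n. \<phi> i (z i))\<^sup>2) / (real n * \<delta>)\<^sup>2"
    using n \<delta> by (intro measure_pmf.second_moment_method int) auto
  also have "\<dots> \<le> real n * ?C / (real n * \<delta>)\<^sup>2"
    by (intro divide_right_mono second) simp
  also have "\<dots> = ?C / (real n * \<delta>\<^sup>2)"
    using n \<delta> by (simp add: power2_eq_square)
  finally show ?thesis by (simp add: \<phi>_def sum_subtractf)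
qed

section \<open>Product laws on noise words\<close>

definition word_prob :: "nat \<Rightarrow> (nat \<Rightarrow> 'z pmf) \<Rightarrow> (nat \<Rightarrow> 'z) \<Rightarrow> real" where
  "word_prob n p z = (\<Prod>i=1..n. pmf (p i) (z i))"

abbreviation words :: "nat \<Rightarrow> (nat \<Rightarrow> 'z) set" where
  "words n \<equiv> PiE {1..n} (\<lambda>_. UNIV)"

lemma word_prob_nonneg: "0 \<le> word_prob n p z"
  by (simp add: word_prob_def prod_nonneg)

lemma prob_Pi_pmf_eq_sum_words:
  fixes p :: "nat \<Rightarrow> 'z pmf"
  assumes fin: "finite (UNIV :: 'z set)"
  shows "measure_pmf.prob (Pi_pmf {1..n} undefined p) {z. P z} = (\<Sum>z\<in>words n. word_prob n p z * of_bool (P z))"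
proof -
  let ?P = "Pi_pmf {1..n} undefined p"
  have fw: "finite (words n :: (nat \<Rightarrow> 'z) set)" by (intro finite_PiE fin) auto
  \<comment> \<open>The default value \<open>undefined\<close> places the support of
    \<open>Pi_pmf\<close> inside the extensional functions, so a sum over \<open>words n\<close>
    sees all of it.\<close>
  have supp: "set_pmf ?P \<subseteq> words n"
    using set_Pi_pmf_subset[of "{1..n}" undefined p] by (auto simp: PiE_def extensional_def)
  have "measure_pmf.prob ?P {z. P z} = measure_pmf.expectation ?P (\<lambda>z. of_bool (P z))"
  proof -
    have "(\<lambda>z. of_bool (P z) :: real) = indicator {z. P z}" by (auto simp: indicator_def)
    then show ?thesis by simp
  qed
  also have "\<dots> = (\<Sum>z\<in>words n. pmf ?P z * of_bool (P z))"
    using supp fw by (subst integral_measure_pmf[of "words n"]) auto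
  also have "\<dots> = (\<Sum>z\<in>words n. word_prob n p z * of_bool (P z))"
    by (intro sum.cong refl) (auto simp: word_prob_def pmf_Pi PiE_def extensional_def)
  finally show ?thesis .
qed

lemma sum_word_prob:
  fixes p :: "nat \<Rightarrow> 'z :: finite pmf"
  shows "(\<Sum>z\<in>words n. word_prob n p z) = 1"
  using prob_Pi_pmf_eq_sum_words[where P = "\<lambda>_. True" and p = p and n = n]
  by (simp add: measure_pmf.prob_space[simplified])

lemma log_word_prob:
  assumes "word_prob n p z \<noteq> 0"
  shows "- log 2 (word_prob n p z) = (\<Sum>i=1..n. - log 2 (pmf (p i) (z i)))"
proof -
  have "pmf (p i) (z i) \<noteq> 0" if "i \<in> {1..n}" for i
    using assms that by (auto simp: word_prob_def)
  then show ?thesis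
    unfolding word_prob_def log_def
    by (subst ln_prod) (auto simp: sum_divide_distrib sum_negf pmf_pos less_le)
qed

text \<open>
  The slack \<open>2 * \<delta>\<close> is split between the fluctuation of the information around its mean
  and that of the mean around \<open>h\<close>, which is random when \<open>p\<close> is.
\<close>

lemma information_spectrum:
  fixes p :: "nat \<Rightarrow> 'z :: finite pmf"
  assumes n: "0 < n" and \<delta>: "0 < \<delta>"
  defines "H \<equiv> (\<Sum>i=1..n. shannon_entropy (measure_pmf (p i)))"
    and "c \<equiv> 4 * real CARD('z) / (ln 2)\<^sup>2 / (real n * \<delta>\<^sup>2)"
  shows "(\<Sum>z\<in>words n. word_prob n p z * of_bool (word_prob n p z \<le> 2 powr (- (real n * (h + 2 * \<delta>)))))
      \<le> c + of_bool (real n * \<delta> \<le> \<bar>H - real n * h\<bar>)"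
    and "1 - (\<Sum>z\<in>words n. word_prob n p z * of_bool (word_prob n p z \<le> 2 powr (- (real n * (h - 2 * \<delta>)))))
      \<le> c + of_bool (real n * \<delta> \<le> \<bar>H - real n * h\<bar>)"
proof -
  let ?dev = "\<lambda>z. real n * \<delta> \<le> \<bar>(\<Sum>i=1..n. - log 2 (pmf (p i) (z i))) - H\<bar>"
  have dev: "(\<Sum>z\<in>words n. word_prob n p z * of_bool (?dev z)) \<le> c"
    using information_deviation[OF n \<delta>, of undefined p]
    unfolding c_def H_def by (subst prob_Pi_pmf_eq_sum_words[symmetric]) auto
  \<comment> \<open>If the sum of entropies is already off, the indicator pays for everything. Words
    of probability 0 carry no weight, so \<open>A\<close> need not imply a deviation there, which
    keeps \<open>log 2 0\<close> out of the argument.\<close>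
  have le: "(\<Sum>z\<in>words n. word_prob n p z * of_bool (A z)) \<le> c + of_bool (real n * \<delta> \<le> \<bar>H - real n * h\<bar>)"
    if A: "\<And>z. word_prob n p z \<noteq> 0 \<Longrightarrow> \<bar>H - real n * h\<bar> < real n * \<delta> \<Longrightarrow> A z \<Longrightarrow> ?dev z" for A
  proof (cases "real n * \<delta> \<le> \<bar>H - real n * h\<bar>")
    case True
    have "(\<Sum>z\<in>words n. word_prob n p z * of_bool (A z)) \<le> (\<Sum>z\<in>words n. word_prob n p z)"
      by (intro sum_mono) (auto simp: of_bool_def word_prob_nonneg)
    moreover have "0 \<le> c" unfolding c_def by simp
    ultimately show ?thesis using True sum_word_prob[of n p] by simp
  next
    case False
    have "(\<Sum>z\<in>words n. word_prob n p z * of_bool (A z)) \<le> (\<Sum>z\<in>words n. word_prob n p z * of_bool (?dev z))"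
    proof (rule sum_mono)
      show "word_prob n p z * of_bool (A z) \<le> word_prob n p z * of_bool (?dev z)" for z
        using A[of z] False by (cases "word_prob n p z = 0") (auto simp: word_prob_nonneg)
    qed
    with dev False show ?thesis by simp
  qed
  have pos: "0 < word_prob n p z" if "word_prob n p z \<noteq> 0" for z
    using that word_prob_nonneg[of n p z] by linarith
  show "(\<Sum>z\<in>words n. word_prob n p z * of_bool (word_prob n p z \<le> 2 powr (- (real n * (h + 2 * \<delta>)))))
      \<le> c + of_bool (real n * \<delta> \<le> \<bar>H - real n * h\<bar>)"
  proof (rule le)
    fix z assume nz: "word_prob n p z \<noteq> 0" and close: "\<bar>H - real n * h\<bar> < real n * \<delta>"
      and "word_prob n p z \<le> 2 powr (- (real n * (h + 2 * \<delta>)))"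
    \<comment> \<open>The information is at least \<open>n * (h + 2 * \<delta>)\<close> while
      \<open>H < n * (h + \<delta>)\<close>, so they differ by more than
      \<open>n * \<delta>\<close>.\<close>
    then have "log 2 (word_prob n p z) \<le> - (real n * (h + 2 * \<delta>))"
      using pos[OF nz] by (simp add: log_le_iff)
    with close show "?dev z"
      unfolding log_word_prob[OF nz, symmetric] by (simp add: abs_if algebra_simps split: if_splits)
  qed
  have "1 - (\<Sum>z\<in>words n. word_prob n p z * of_bool (word_prob n p z \<le> 2 powr (- (real n * (h - 2 * \<delta>)))))
     = (\<Sum>z\<in>words n. word_prob n p z * of_bool (\<not> word_prob n p z \<le> 2 powr (- (real n * (h - 2 * \<delta>)))))"
    unfolding sum_word_prob[of n p, symmetric] sum_subtractf[symmetric] by (intro sum.cong) auto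
  also have "\<dots> \<le> c + of_bool (real n * \<delta> \<le> \<bar>H - real n * h\<bar>)"
  proof (rule le)
    fix z assume nz: "word_prob n p z \<noteq> 0" and close: "\<bar>H - real n * h\<bar> < real n * \<delta>"
      and "\<not> word_prob n p z \<le> 2 powr (- (real n * (h - 2 * \<delta>)))"
    then have "- (real n * (h - 2 * \<delta>)) \<le> log 2 (word_prob n p z)"
      using pos[OF nz] by (simp add: le_log_iff)
    with close show "?dev z"
      unfolding log_word_prob[OF nz, symmetric] by (simp add: abs_if algebra_simps split: if_splits)
  qed
  finally show "1 - (\<Sum>z\<in>words n. word_prob n p z * of_bool (word_prob n p z \<le> 2 powr (- (real n * (h - 2 * \<delta>)))))
      \<le> c + of_bool (real n * \<delta> \<le> \<bar>H - real n * h\<bar>)" .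
qed

section \<open>Capacity from the information spectrum\<close>

definition word_output :: "('x \<Rightarrow> 'z \<Rightarrow> 'y) \<Rightarrow> nat \<Rightarrow> (nat \<Rightarrow> 'x) \<Rightarrow> (nat \<Rightarrow> 'z) \<Rightarrow> nat \<Rightarrow> 'y" where
  "word_output g n x z = (\<lambda>i\<in>{1..n}. g (x i) (z i))"

definition word_noise :: "('x \<Rightarrow> 'z \<Rightarrow> 'y) \<Rightarrow> nat \<Rightarrow> (nat \<Rightarrow> 'x) \<Rightarrow> (nat \<Rightarrow> 'y) \<Rightarrow> nat \<Rightarrow> 'z" where
  "word_noise g n x y = (\<lambda>i\<in>{1..n}. inv (g (x i)) (y i))"

lemma word_noise_output:
  assumes "\<forall>x. bij (g x)" "z \<in> words n"
  shows "word_noise g n x (word_output g n x z) = z"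
  using assms by (auto simp: word_noise_def word_output_def fun_eq_iff PiE_def extensional_def bij_def)

lemma bij_betw_word_output:
  assumes "\<forall>x. bij (g x)"
  shows "bij_betw (word_output g n x) (words n) (words n)"
proof (rule bij_betw_byWitness[where f' = "word_noise g n x"])
  show "\<forall>y\<in>words n. word_output g n x (word_noise g n x y) = y"
    using assms
    by (auto simp: word_noise_def word_output_def fun_eq_iff PiE_def extensional_def bij_def surj_f_inv_f)
qed (use word_noise_output[OF assms] in \<open>auto simp: word_output_def word_noise_def\<close>)

lemma bij_betw_word_output_input:
  assumes "\<forall>z. bij (\<lambda>x. g x z)"
  shows "bij_betw (\<lambda>x. word_output g n x z) (words n) (words n)"
  using bij_betw_word_output[of "\<lambda>z x. g x z" n z] assms
  by (simp add: word_output_def[abs_def])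

lemma prob_Pi_pmf_map_eq_sum_words:
  fixes p :: "nat \<Rightarrow> 'z :: finite pmf" and g :: "'x \<Rightarrow> 'z \<Rightarrow> 'y"
  assumes g: "\<forall>x. bij (g x)"
  shows "measure_pmf.prob (Pi_pmf {1..n} undefined (\<lambda>i. map_pmf (g (x i)) (p i))) {y. P y}
    = (\<Sum>z\<in>words n. word_prob n p z * of_bool (P (word_output g n x z)))"
proof -
  \<comment> \<open>The output alphabet inherits finiteness from the noise alphabet through a
    bijection \<open>g x\<close>.\<close>
  have "finite (UNIV :: 'y set)"
    using g bij_betw_finite[of "g undefined" UNIV UNIV] by simp
  then have "measure_pmf.prob (Pi_pmf {1..n} undefined (\<lambda>i. map_pmf (g (x i)) (p i))) {y. P y}
      = (\<Sum>y\<in>words n. word_prob n (\<lambda>i. map_pmf (g (x i)) (p i)) y * of_bool (P y))"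
    by (rule prob_Pi_pmf_eq_sum_words)
  also have "\<dots> = (\<Sum>z\<in>words n. word_prob n (\<lambda>i. map_pmf (g (x i)) (p i)) (word_output g n x z)
      * of_bool (P (word_output g n x z)))"
    by (rule sum.reindex_bij_betw[OF bij_betw_word_output[OF g], symmetric])
  also have "\<dots> = (\<Sum>z\<in>words n. word_prob n p z * of_bool (P (word_output g n x z)))"
  proof (intro sum.cong refl arg_cong2[where f = times])
    fix z :: "nat \<Rightarrow> 'z"
    have "inj (g u)" for u using g by (auto simp: bij_def)
    then show "word_prob n (\<lambda>i. map_pmf (g (x i)) (p i)) (word_output g n x z) = word_prob n p z"
      unfolding word_prob_def by (intro prod.cong) (auto simp: word_output_def pmf_map_inj')
  qed
  finally show ?thesis .
qed

text \<open>\<open>departure_ge\<close> is stated for every block length because the converse has to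
  deal with any admissible \<open>T\<close>; achievability uses the limit.\<close>

locale asymptotic_channel = prob_space M
  for M :: "'a measure" +
  fixes \<kappa> :: "nat \<Rightarrow> 'a \<Rightarrow> (nat \<Rightarrow> 'x :: finite) \<Rightarrow> real" and g :: "'x \<Rightarrow> 'x \<Rightarrow> 'y"
    and tau S :: "nat \<Rightarrow> 'a \<Rightarrow> real" and Q :: "'x \<Rightarrow> real \<Rightarrow> 'y pmf"
    and Dec :: "nat \<Rightarrow> 'y decoder set" and lam h :: real
  assumes law_measurable: "\<And>n z. z \<in> words n \<Longrightarrow> (\<lambda>\<omega>. \<kappa> n \<omega> z) \<in> borel_measurable M"
    and law_nonneg: "\<And>n \<omega> z. z \<in> words n \<Longrightarrow> 0 \<le> \<kappa> n \<omega> z"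
    and law_sum: "\<And>n \<omega>. sum (\<kappa> n \<omega>) (words n) = 1"
    and bij_g: "\<forall>x. bij (g x)" and bij_g_input: "\<forall>z. bij (\<lambda>x. g x z)"
    and lam: "0 < lam"
    and departure_ge: "\<And>n. real n / lam \<le> (\<integral>\<omega>. departure tau S n \<omega> \<partial>M)"
    and departure_limit: "(\<lambda>n. (\<integral>\<omega>. departure tau S n \<omega> \<partial>M) / real n) \<longlonglongrightarrow> 1 / lam"

sublocale asymptotic_channel \<subseteq> ch: noise_channel M "\<kappa> n" "word_output g n" "word_noise g n"
    "words n" "words n" "words n" for n
proof
  show "finite (words n :: (nat \<Rightarrow> 'x) set)" by (intro finite_PiE) auto
  show "(words n :: (nat \<Rightarrow> 'x) set) \<noteq> {}" by (auto simp: PiE_eq_empty_iff)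
qed (use law_measurable law_nonneg law_sum bij_betw_word_output[OF bij_g]
      bij_betw_word_output_input[OF bij_g_input] word_noise_output[OF bij_g] in auto)

text \<open>The decoder class is seen only through three properties: \<open>trivial_decoder\<close>
  gives rate 0, \<open>decoder_of\<close> translates an arbitrary admissible decoder for the
  converse, and \<open>decoder_for\<close> admits threshold decoders. \<open>'b\<close> is the
  common alphabet of inputs and noise.\<close>

locale spectral_channel = asymptotic_channel +
  fixes c :: real
  assumes c_eq: "c = log 2 (real CARD('b))"
    and trivial_decoder: "\<And>n. (\<lambda>_ _ _. 0) \<in> Dec n"
    and mass_below_tendsto_0: "\<And>\<delta>. 0 < \<delta> \<Longrightarrow>
      (\<lambda>n. ch.mass_below n (2 powr (- (real n * (h + \<delta>))))) \<longlonglongrightarrow> 0"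
    and mass_below_tendsto_1: "\<And>\<delta>. 0 < \<delta> \<Longrightarrow>
      (\<lambda>n. ch.mass_below n (2 powr (- (real n * (h - \<delta>))))) \<longlonglongrightarrow> 1"
    and decoder_of: "\<And>n f d. d \<in> Dec n \<Longrightarrow>
      \<exists>d'. (\<forall>y\<in>words n. (\<lambda>\<omega>. d' \<omega> y) \<in> M \<rightarrow>\<^sub>M count_space UNIV) \<and>
        (\<forall>m. error_probability M tau S Q n f d m = ch.code_error n (f :: nat \<Rightarrow> nat \<Rightarrow> 'b) d' m)"
    and decoder_for: "\<And>n f t. 0 < t \<Longrightarrow> \<exists>d\<in>Dec n. \<forall>m. error_probability M tau S Q n f d m
        = ch.code_error n f (\<lambda>\<omega>. threshold_decoder (word_noise g n) t (\<kappa> n \<omega>) f) m"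
begin

section \<open>Capacity from the gap between \<open>c\<close> and \<open>h\<close>\<close>

lemma card_words: "real (card (words n :: (nat \<Rightarrow> 'b) set)) = 2 powr (real n * c)"
proof -
  have "(2::real) powr (real n * c) = (2 powr c) powr real n" by (simp add: powr_powr mult.commute)
  also have "2 powr c = real CARD('b)" by (simp add: c_eq)
  also have "real CARD('b) powr real n = real CARD('b) ^ n" by (simp add: powr_realpow)
  finally have "2 powr (real n * c) = real CARD('b) ^ n" .
  moreover have "card (words n :: (nat \<Rightarrow> 'b) set) = CARD('b) ^ n" by (simp add: card_PiE)
  ultimately show ?thesis by (metis of_nat_power)
qed

lemma powr_neg_tendsto: "0 < \<delta> \<Longrightarrow> (\<lambda>n. 2 powr (- (real n * \<delta>))) \<longlonglongrightarrow> 0"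
  by real_asymp

text \<open>Counting: if \<open>h > c\<close>, all \<open>2 powr (n * c)\<close> words together
  cannot carry mass close to 1 when each has probability at most
  \<open>2 powr (- (n * (c + \<delta>)))\<close>. The converse uses this to know that a rate above
  capacity is positive.\<close>

lemma h_le: "h \<le> c"
proof (rule ccontr)
  assume "\<not> h \<le> c"
  define \<delta> where "\<delta> = (h - c) / 2"
  have \<delta>: "0 < \<delta>" "h - \<delta> = c + \<delta>" using \<open>\<not> h \<le> c\<close> by (auto simp: \<delta>_def field_simps)
  have "ch.mass_below n (2 powr (- (real n * (h - \<delta>)))) \<le> 2 powr (- (real n * \<delta>))" for n
  proof -
    let ?t = "2 powr (- (real n * (h - \<delta>)))"
    have "ch.mass_below n ?t \<le> (\<integral>\<omega>. (\<Sum>z\<in>(words n :: (nat \<Rightarrow> 'b) set). ?t) \<partial>M)"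
      unfolding ch.mass_below_def
    proof (intro integral_mono sum_mono)
      show "integrable M (\<lambda>\<omega>. \<Sum>z\<in>words n. \<kappa> n \<omega> z * of_bool (\<kappa> n \<omega> z \<le> ?t))"
        by (intro ch.integrable_weighted) measurable
    qed (auto simp: of_bool_def)
    also have "\<dots> = 2 powr (real n * c) * ?t"
      unfolding card_words[symmetric] by (simp add: prob_space)
    also have "\<dots> = 2 powr (- (real n * \<delta>))"
      unfolding \<delta> by (simp add: powr_add[symmetric] algebra_simps)
    finally show ?thesis .
  qed
  then have "(1::real) \<le> 0"
    by (intro LIMSEQ_le[OF mass_below_tendsto_1[OF \<delta>(1)] powr_neg_tendsto[OF \<delta>(1)]]) auto
  then show False by simp
qed

lemma achievable:
  assumes R: "0 < R" "R < lam * (c - h)"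
  shows "achievable_rate M tau S Q Dec R"
  unfolding achievable_rate_def
proof (intro allI impI)
  fix \<epsilon> :: real and n0 :: nat
  assume \<epsilon>: "0 < \<epsilon>" "\<epsilon> < 1"
  \<comment> \<open>The gap is cut in four: the rate \<open>r\<close> per symbol stays
    \<open>2 * \<delta>\<close> above \<open>R / lam\<close> and \<open>2 * \<delta>\<close> below
    \<open>c - h\<close>. One \<open>\<delta>\<close> of the latter is spent on the threshold, the
    other is the decay exponent of the confusion term.\<close>
  define \<delta> where "\<delta> = (c - h - R / lam) / 4"
  have \<delta>: "0 < \<delta>" using R lam by (simp add: \<delta>_def field_simps)
  define r where "r = c - h - 2 * \<delta>"
  have "0 < R / lam" using R lam by simp
  moreover have "4 * \<delta> = c - h - R / lam" by (simp add: \<delta>_def)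
  ultimately have r: "0 < r" "R / lam < r" using \<delta> unfolding r_def by linarith+
  have "(\<lambda>n. ch.mass_below n (2 powr (- (real n * (h + \<delta>)))) + 2 * 2 powr (- (real n * \<delta>))) \<longlonglongrightarrow> 0 + 2 * 0"
    by (intro tendsto_intros mass_below_tendsto_0 powr_neg_tendsto \<delta>)
  then have ev1: "\<forall>\<^sub>F n in sequentially.
      ch.mass_below n (2 powr (- (real n * (h + \<delta>)))) + 2 * 2 powr (- (real n * \<delta>)) < \<epsilon>"
    using \<epsilon> by (auto dest: order_tendstoD(2))
  have "1 / lam < r / R" using r R lam by (simp add: field_simps)
  then have ev2: "\<forall>\<^sub>F n in sequentially. (\<integral>\<omega>. departure tau S n \<omega> \<partial>M) / real n < r / R"
    using departure_limit by (auto dest: order_tendstoD(2))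
  obtain n where n: "n0 \<le> n" "1 \<le> n"
    and small: "ch.mass_below n (2 powr (- (real n * (h + \<delta>)))) + 2 * 2 powr (- (real n * \<delta>)) < \<epsilon>"
    and dep: "(\<integral>\<omega>. departure tau S n \<omega> \<partial>M) / real n < r / R"
    using eventually_happens'[OF sequentially_bot, OF eventually_conj[OF eventually_conj[OF ev1 ev2]
          eventually_ge_at_top[of "max n0 1"]]] by auto
  define t where "t = 2 powr (- (real n * (h + \<delta>)))"
  define L where "L = nat \<lceil>2 powr (real n * r)\<rceil>"
  have t: "0 < t" by (simp add: t_def)
  have L_ge: "2 powr (real n * r) \<le> real L" unfolding L_def by linarith
  have ge1: "1 < 2 powr (real n * r)" using r n by simp
  \<comment> \<open>Rounding up at most doubles a number above 1; hence the factor 2 in the eventual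
    bound.\<close>
  have L_le: "real L \<le> 2 * 2 powr (real n * r)" unfolding L_def using ge1 by linarith
  have Lpos: "0 < L" using L_ge ge1 by linarith
  have logL: "real n * r \<le> log 2 (real L)" using L_ge Lpos by (simp add: le_log_iff)
  have nr: "0 < real n * r" using n r by simp
  obtain f where f: "(\<Sum>m<L. ch.code_error n f (\<lambda>\<omega>. threshold_decoder (word_noise g n) t (\<kappa> n \<omega>) f) m) / real L
      \<le> ch.mass_below n t + real L / (t * real (card (words n :: (nat \<Rightarrow> 'b) set)))"
    using ch.exists_code[OF t Lpos] by blast
  obtain d where d: "d \<in> Dec n" "\<And>m. error_probability M tau S Q n f d m
      = ch.code_error n f (\<lambda>\<omega>. threshold_decoder (word_noise g n) t (\<kappa> n \<omega>) f) m"
    using decoder_for[OF t, of n f] by blast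
  have "real L / (t * real (card (words n :: (nat \<Rightarrow> 'b) set)))
      \<le> 2 * 2 powr (real n * r) / (t * 2 powr (real n * c))"
    unfolding card_words using L_le t by (intro divide_right_mono) auto
  also have "\<dots> = 2 * 2 powr (real n * r + real n * (h + \<delta>) - real n * c)"
    by (simp add: t_def powr_minus powr_add powr_diff field_simps)
  also have "real n * r + real n * (h + \<delta>) - real n * c = - (real n * \<delta>)"
    by (simp add: r_def algebra_simps)
  finally have err: "(\<Sum>m<L. error_probability M tau S Q n f d m) / real L < \<epsilon>"
    using f small unfolding d(2) t_def by linarith
  \<comment> \<open>\<open>T\<close> makes the rate exactly \<open>R\<close>. Since
    \<open>n * r \<le> log 2 L\<close>, it is at least \<open>n * r / R\<close>, which exceeds the
    mean departure time.\<close>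
  define T where "T = log 2 (real L) / R"
  define R' where "R' = log 2 (real L) / real n"
  have "(\<integral>\<omega>. departure tau S n \<omega> \<partial>M) < real n * r / R"
    using dep n R by (simp add: field_simps)
  also have "\<dots> \<le> T" unfolding T_def using logL R by (intro divide_right_mono) auto
  finally have "eps_achievable_code M tau S Q Dec \<epsilon> n R' T"
    unfolding eps_achievable_code_def using d(1) err n Lpos
    by (intro exI[of _ L] exI[of _ f] exI[of _ d]) (auto simp: R'_def)
  moreover have "R = real n * R' / T"
    unfolding R'_def T_def using n R logL nr by simp
  ultimately show "\<exists>n\<ge>n0. \<exists>R' T. R = real n * R' / T \<and> eps_achievable_code M tau S Q Dec \<epsilon> n R' T"
    using n by blast
qed

text \<open>A code of rate \<open>R\<close> must carry \<open>R * T \<ge> n * R / lam\<close> bits,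
  and above capacity this drives the error to one. The value 1/2 stands for any bound below one, as
  in a strong converse.\<close>

lemma achievable_le:
  assumes "achievable_rate M tau S Q Dec R"
  shows "R \<le> lam * (c - h)"
proof (rule ccontr)
  assume "\<not> R \<le> lam * (c - h)"
  define \<delta> where "\<delta> = (R / lam - (c - h)) / 2"
  have \<delta>: "0 < \<delta>" and R_lam: "R / lam = c - h + 2 * \<delta>"
    using \<open>\<not> R \<le> lam * (c - h)\<close> lam by (auto simp: \<delta>_def field_simps)
  have "0 < lam * (R / lam)" unfolding R_lam using h_le \<delta> lam by (intro mult_pos_pos) auto
  then have R: "0 < R" using lam by simp
  have "(\<lambda>n. ch.mass_below n (2 powr (- (real n * (h - \<delta>)))) - 2 powr (- (real n * \<delta>))) \<longlonglongrightarrow> 1 - 0"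
    by (intro tendsto_intros mass_below_tendsto_1 powr_neg_tendsto \<delta>)
  then have "\<forall>\<^sub>F n in sequentially.
      1 / 2 < ch.mass_below n (2 powr (- (real n * (h - \<delta>)))) - 2 powr (- (real n * \<delta>))"
    by (auto dest: order_tendstoD(1)[where a = "1 / 2"])
  then obtain n0 where n0: "\<And>n. n0 \<le> n \<Longrightarrow>
      1 / 2 < ch.mass_below n (2 powr (- (real n * (h - \<delta>)))) - 2 powr (- (real n * \<delta>))"
    by (auto simp: eventually_sequentially)
  obtain n R' T where n: "max 1 n0 \<le> n" and RT: "R = real n * R' / T"
    and code: "eps_achievable_code M tau S Q Dec (1 / 2) n R' T"
    using assms[unfolded achievable_rate_def, rule_format, of "1 / 2" "max 1 n0"] by auto
  obtain L f d where d: "d \<in> Dec n" and L: "real L = 2 powr (real n * R')"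
    and T: "(\<integral>\<omega>. departure tau S n \<omega> \<partial>M) < T"
    and err: "(\<Sum>m<L. error_probability M tau S Q n f d m) / real L < 1 / 2"
    using code unfolding eps_achievable_code_def by blast
  have Lpos: "0 < L" using L by (metis of_nat_0_less_iff powr_gt_zero zero_neq_numeral)
  have T_ge: "real n / lam < T" using departure_ge[of n] T by linarith
  moreover have "0 < real n / lam" using n lam by simp
  ultimately have Tpos: "0 < T" by linarith
  have "real n * (R / lam) \<le> R * T"
    using mult_left_mono[of "real n / lam" T R] T_ge R by (simp add: mult_ac)
  also have "R * T = real n * R'" using RT Tpos by simp
  finally have rate: "real n * (c - h + 2 * \<delta>) \<le> real n * R'" unfolding R_lam .
  let ?t = "2 powr (- (real n * (h - \<delta>)))"
  obtain d' where d': "\<forall>y\<in>words n. (\<lambda>\<omega>. d' \<omega> y) \<in> M \<rightarrow>\<^sub>M count_space UNIV"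
    and err': "\<And>m. error_probability M tau S Q n f d m = ch.code_error n f d' m"
    using decoder_of[OF d, of f] by blast
  have "ch.mass_below n ?t - ?t * real (card (words n :: (nat \<Rightarrow> 'b) set)) / real L
      \<le> (\<Sum>m<L. ch.code_error n f d' m) / real L"
    using d' Lpos by (intro ch.code_error_ge) auto
  moreover have "?t * real (card (words n :: (nat \<Rightarrow> 'b) set)) / real L
      = 2 powr (- (real n * (h - \<delta>)) + real n * c - real n * R')"
    unfolding card_words L by (simp only: powr_add powr_diff)
  moreover have "\<dots> \<le> 2 powr (- (real n * \<delta>))"
    using rate by (intro powr_mono) (auto simp: algebra_simps)
  moreover have "1 / 2 < ch.mass_below n ?t - 2 powr (- (real n * \<delta>))"
    using n by (intro n0) simp
  ultimately show False using err unfolding err' by linarith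
qed

text \<open>A single message is never decoded wrongly by the constant decoder. This handles
  nonpositive lower bounds on the capacity, in particular the case \<open>c = h\<close>.\<close>

lemma achievable_0: "achievable_rate M tau S Q Dec 0"
proof -
  have "eps_achievable_code M tau S Q Dec \<epsilon> n 0 ((\<integral>\<omega>. departure tau S n \<omega> \<partial>M) + 1)" if "0 < \<epsilon>" for \<epsilon> n
    unfolding eps_achievable_code_def using trivial_decoder[of n] that
    by (intro exI[of _ 1] exI[of _ "\<lambda>_ _. undefined"] exI[of _ "\<lambda>_ _ _. 0"])
       (auto simp: error_probability_def)
  then show ?thesis unfolding achievable_rate_def by (metis div_0 le_refl mult_zero_right)
qed

lemma capacity_eq: "capacity M tau S Q Dec = ereal (lam * (c - h))"
proof (rule antisym)
  show "capacity M tau S Q Dec \<le> ereal (lam * (c - h))"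
    unfolding capacity_def using achievable_le by (intro SUP_least) auto
  have le: "ereal R \<le> capacity M tau S Q Dec" if "achievable_rate M tau S Q Dec R" for R
    unfolding capacity_def using that by (intro SUP_upper) auto
  show "ereal (lam * (c - h)) \<le> capacity M tau S Q Dec"
  proof (rule dense_le)
    fix y assume y: "y < ereal (lam * (c - h))"
    show "y \<le> capacity M tau S Q Dec"
    proof (cases "y \<le> 0")
      case True
      then show ?thesis using le[OF achievable_0] by (auto intro: order.trans simp: zero_ereal_def)
    next
      case False
      with y obtain R where "y = ereal R" by (cases y) auto
      with y False show ?thesis using le achievable by auto
    qed
  qed
qed

end

section \<open>The waiting time chain\<close>

text \<open>The freezing lemma: by Fubini, the second variable is integrated out with the first held
  fixed.\<close>

lemma (in prob_space) indep_var_integral_eq: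
  fixes F :: "'b \<times> 'b \<Rightarrow> real"
  assumes ind: "indep_var N X N' Y" and F [measurable]: "F \<in> borel_measurable (N \<Otimes>\<^sub>M N')"
    and bound: "\<And>p. \<bar>F p\<bar> \<le> B"
  shows "expectation (\<lambda>\<omega>. F (X \<omega>, Y \<omega>)) = expectation (\<lambda>\<omega>. \<integral>y. F (X \<omega>, y) \<partial>distr M N' Y)"
proof -
  have X [measurable]: "X \<in> M \<rightarrow>\<^sub>M N" and Y [measurable]: "Y \<in> M \<rightarrow>\<^sub>M N'"
    using ind by (auto dest: indep_var_rv1 indep_var_rv2)
  interpret DX: prob_space "distr M N X" by (rule prob_space_distr) fact
  interpret DY: prob_space "distr M N' Y" by (rule prob_space_distr) fact
  interpret P: pair_prob_space "distr M N X" "distr M N' Y" ..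
  have "expectation (\<lambda>\<omega>. F (X \<omega>, Y \<omega>)) = integral\<^sup>L (distr M (N \<Otimes>\<^sub>M N') (\<lambda>\<omega>. (X \<omega>, Y \<omega>))) F"
    by (subst integral_distr) auto
  also have "distr M (N \<Otimes>\<^sub>M N') (\<lambda>\<omega>. (X \<omega>, Y \<omega>)) = distr M N X \<Otimes>\<^sub>M distr M N' Y"
    using ind by (simp add: indep_var_distribution_eq)
  also have "integral\<^sup>L (distr M N X \<Otimes>\<^sub>M distr M N' Y) F
      = (\<integral>x. (\<integral>y. F (x, y) \<partial>distr M N' Y) \<partial>distr M N X)"
    using bound by (intro P.integral_fst'[symmetric] P.integrable_const_bound[where B = B]) auto
  also have "\<dots> = expectation (\<lambda>\<omega>. \<integral>y. F (X \<omega>, y) \<partial>distr M N' Y)"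
    by (subst integral_distr) (auto intro!: DY.borel_measurable_lebesgue_integral)
  finally show ?thesis .
qed

lemma (in prob_space) abs_expectation_le:
  fixes f :: "'a \<Rightarrow> real"
  assumes [measurable]: "f \<in> borel_measurable M" and "\<And>x. \<bar>f x\<bar> \<le> B"
  shows "\<bar>expectation f\<bar> \<le> B"
proof -
  have "\<bar>expectation f\<bar> \<le> expectation (\<lambda>_. B)"
    by (rule integral_abs_bound[THEN order_trans], rule integral_mono)
       (use assms in \<open>auto intro!: integrable_const_bound[where B = B]\<close>)
  then show ?thesis by (simp add: prob_space)
qed

text \<open>
  \<open>chain i k\<close> is what the waiting time of symbol \<open>i + k\<close> would be if symbol \<open>i\<close> departed at
  the moment of its arrival, leaving the system empty. The argument collects all interarrival
  times (\<open>Inl\<close>) and service times (\<open>Inr\<close>).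
\<close>

primrec chain :: "nat \<Rightarrow> nat \<Rightarrow> (nat + nat \<Rightarrow> real) \<Rightarrow> real" where
  "chain i 0 x = 0"
| "chain i (Suc k) x = max (chain i k x - x (Inl (Suc (i + k)))) 0 + x (Inr (Suc (i + k)))"

abbreviation chain_vars :: "nat \<Rightarrow> nat \<Rightarrow> (nat + nat) set" where
  "chain_vars i k \<equiv> {i<..i + k} <+> {i<..i + k}"

lemma chain_restrict: "chain_vars i k \<subseteq> A \<Longrightarrow> chain i k (restrict x A) = chain i k x"
proof (induction k)
  case (Suc k)
  have "Inl (Suc (i + k)) \<in> A" "Inr (Suc (i + k)) \<in> A" "chain_vars i k \<subseteq> A"
    using Suc.prems by (auto simp: Plus_def image_subset_iff)
  then show ?case using Suc.IH by simp
qed simp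

lemma measurable_chain: "chain_vars i k \<subseteq> A \<Longrightarrow> (\<lambda>x. chain i k x) \<in> borel_measurable (PiM A (\<lambda>_. borel))"
proof (induction k)
  case (Suc k)
  have *: "Inl (Suc (i + k)) \<in> A" "Inr (Suc (i + k)) \<in> A" "chain_vars i k \<subseteq> A"
    using Suc.prems by (auto simp: Plus_def image_subset_iff)
  note [measurable] = Suc.IH[OF *(3)] measurable_component_singleton[OF *(1), of "\<lambda>_. borel"]
    measurable_component_singleton[OF *(2), of "\<lambda>_. borel"]
  show ?case by simp
next
  case 0
  have "chain i 0 = (\<lambda>_. 0)" by (simp add: fun_eq_iff)
  then show ?case by simp
qed

context mg1_queue
begin

definition path :: "'a \<Rightarrow> nat + nat \<Rightarrow> real" where
  "path \<omega> j = case_sum tau S j \<omega>"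

lemma path_simps [simp]: "path \<omega> (Inl j) = tau j \<omega>" "path \<omega> (Inr j) = S j \<omega>"
  by (auto simp: path_def)

lemma waiting_0: "waiting tau S 0 \<omega> = 0"
  by (simp add: waiting_def arrival_def)

text \<open>Lindley's recursion in the form for the total time in the system: the service time is
  added after the truncation at 0.\<close>

lemma waiting_Suc:
  "waiting tau S (Suc k) \<omega> = max (waiting tau S k \<omega> - tau (Suc k) \<omega>) 0 + S (Suc k) \<omega>"
  by (simp add: waiting_def arrival_def max_def)

lemma waiting_eq_chain: "waiting tau S k \<omega> = chain 0 k (path \<omega>)"
  by (induction k) (auto simp: waiting_0 waiting_Suc)

lemma rv_chain [measurable]: "(\<lambda>\<omega>. chain i k (path \<omega>)) \<in> borel_measurable M"
proof (induction k)
  case (Suc k)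
  note [measurable] = Suc.IH rv_tau[of "Suc (i + k)", simplified] rv_S[of "Suc (i + k)", simplified]
  show ?case by simp
qed simp

section \<open>The one-step law and its transition operator\<close>

definition step_law :: "(real \<times> real) measure" where
  "step_law = density lborel (exponential_density lam) \<Otimes>\<^sub>M distr M borel (S 1)"

lemma sets_step_law [measurable_cong]: "sets step_law = sets (borel \<Otimes>\<^sub>M borel)"
  unfolding step_law_def by (intro sets_pair_measure_cong) auto

sublocale arrival_law: prob_space "density lborel (exponential_density lam)"
  by (rule prob_space_exponential_density[OF lam_pos])

sublocale service_law: prob_space "distr M borel (S 1)"
  by (rule prob_space_distr) (simp add: rv_S)

sublocale step_law: pair_prob_space "density lborel (exponential_density lam)" "distr M borel (S 1)" ..

lemma prob_space_step_law: "prob_space step_law"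
  unfolding step_law_def by (rule step_law.prob_space_axioms)

lemma distr_service: "1 \<le> j \<Longrightarrow> distr M borel (S j) = distr M borel (S 1)"
  using rv_S[of 1] rv_S[of j] service_cdf[of j] service_cdf[of 1]
  by (intro cdf_unique real_distribution_distr) auto

lemma distr_step:
  assumes j: "1 \<le> j"
  shows "distr M (borel \<Otimes>\<^sub>M borel) (\<lambda>\<omega>. (tau j \<omega>, S j \<omega>)) = step_law"
proof -
  have "indep_var (PiM {Inl j} (\<lambda>_. borel)) (\<lambda>\<omega>. restrict (path \<omega>) {Inl j})
     (PiM {Inr j} (\<lambda>_. borel)) (\<lambda>\<omega>. restrict (path \<omega>) {Inr j})"
    using indep_var_restrict[OF indep, of "{Inl j}" "{Inr j}"] j by (auto simp: path_def[abs_def])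
  then have "indep_var borel ((\<lambda>x. x (Inl j)) \<circ> (\<lambda>\<omega>. restrict (path \<omega>) {Inl j}))
     borel ((\<lambda>x. x (Inr j)) \<circ> (\<lambda>\<omega>. restrict (path \<omega>) {Inr j}))"
    by (rule indep_var_compose) (auto intro!: measurable_component_singleton)
  then have "indep_var borel (tau j) borel (S j)" by (simp add: comp_def)
  then have "distr M (borel \<Otimes>\<^sub>M borel) (\<lambda>\<omega>. (tau j \<omega>, S j \<omega>)) = distr M borel (tau j) \<Otimes>\<^sub>M distr M borel (S j)"
    by (simp add: indep_var_distribution_eq)
  also have "distr M borel (S j) = distr M borel (S 1)"
    by (rule distr_service[OF j])
  also have "distr M borel (tau j) = distr M lborel (tau j)"
    by (rule distr_cong) auto
  also have "\<dots> = density lborel (exponential_density lam)"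
    using interarrival[OF j] by (simp add: distributed_def)
  finally show ?thesis by (simp add: step_law_def)
qed

text \<open>\<open>A\<close> may be any set of variables that avoids those of symbol
  \<open>j\<close>, so that test functions can depend on the past of the queue as well as on a
  restarted chain.\<close>

lemma step_integral_eq:
  assumes A: "A \<subseteq> {1..} <+> {1..}" and j: "1 \<le> j" "Inl j \<notin> A" "Inr j \<notin> A"
    and F [measurable]: "F \<in> borel_measurable (PiM A (\<lambda>_. borel) \<Otimes>\<^sub>M (borel \<Otimes>\<^sub>M borel))"
    and bound: "\<And>p. \<bar>F p\<bar> \<le> (B :: real)"
  shows "expectation (\<lambda>\<omega>. F (restrict (path \<omega>) A, tau j \<omega>, S j \<omega>))
    = expectation (\<lambda>\<omega>. \<integral>y. F (restrict (path \<omega>) A, y) \<partial>step_law)"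
proof -
  let ?B = "{Inl j, Inr j} :: (nat + nat) set"
  let ?N = "PiM ?B (\<lambda>_. borel :: real measure)"
  let ?F = "\<lambda>(x, y). F (x, y (Inl j), y (Inr j))"
  have ind: "indep_var (PiM A (\<lambda>_. borel)) (\<lambda>\<omega>. restrict (path \<omega>) A) ?N (\<lambda>\<omega>. restrict (path \<omega>) ?B)"
    using indep_var_restrict[OF indep, of A ?B] A j by (auto simp: path_def[abs_def])
  have X: "(\<lambda>\<omega>. restrict (path \<omega>) A) \<in> M \<rightarrow>\<^sub>M PiM A (\<lambda>_. borel)"
    and Y [measurable]: "(\<lambda>\<omega>. restrict (path \<omega>) ?B) \<in> M \<rightarrow>\<^sub>M ?N"
    using ind by (auto dest: indep_var_rv1 indep_var_rv2)
  have proj [measurable]: "(\<lambda>y. (y (Inl j), y (Inr j))) \<in> ?N \<rightarrow>\<^sub>M borel \<Otimes>\<^sub>M borel"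
    by (intro measurable_Pair measurable_component_singleton) auto
  have "expectation (\<lambda>\<omega>. ?F (restrict (path \<omega>) A, restrict (path \<omega>) ?B))
      = expectation (\<lambda>\<omega>. \<integral>y. ?F (restrict (path \<omega>) A, y) \<partial>distr M ?N (\<lambda>\<omega>. restrict (path \<omega>) ?B))"
    by (rule indep_var_integral_eq[OF ind]) (use bound in auto)
  also have "\<dots> = expectation (\<lambda>\<omega>. \<integral>y. F (restrict (path \<omega>) A, y) \<partial>step_law)"
  proof (intro Bochner_Integration.integral_cong refl)
    fix \<omega> assume "\<omega> \<in> space M"
    then have x: "restrict (path \<omega>) A \<in> space (PiM A (\<lambda>_. borel))" by (rule measurable_space[OF X])
    have Fx [measurable]: "(\<lambda>y. F (restrict (path \<omega>) A, y)) \<in> borel_measurable (borel \<Otimes>\<^sub>M borel)"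
      using measurable_Pair1'[OF x] F by (rule measurable_compose)
    have [measurable]: "(\<lambda>\<omega>. (tau j \<omega>, S j \<omega>)) \<in> M \<rightarrow>\<^sub>M borel \<Otimes>\<^sub>M borel"
      using rv_tau[OF j(1)] rv_S[OF j(1)] by (rule measurable_Pair)
    have "(\<integral>y. ?F (restrict (path \<omega>) A, y) \<partial>distr M ?N (\<lambda>\<omega>. restrict (path \<omega>) ?B))
        = (\<integral>\<omega>'. F (restrict (path \<omega>) A, tau j \<omega>', S j \<omega>') \<partial>M)"
      by (subst integral_distr) (auto intro: measurable_compose[OF proj Fx])
    also have "\<dots> = (\<integral>y. F (restrict (path \<omega>) A, y) \<partial>step_law)"
      unfolding distr_step[OF j(1), symmetric] by (subst integral_distr) auto
    finally show "(\<integral>y. ?F (restrict (path \<omega>) A, y) \<partial>distr M ?N (\<lambda>\<omega>. restrict (path \<omega>) ?B))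
        = (\<integral>y. F (restrict (path \<omega>) A, y) \<partial>step_law)" .
  qed
  finally show ?thesis by simp
qed

definition transition :: "(real \<Rightarrow> real) \<Rightarrow> real \<Rightarrow> real" where
  "transition f w = (\<integral>(t, s). f (max (w - t) 0 + s) \<partial>step_law)"

lemma measurable_transition [measurable]:
  assumes [measurable]: "f \<in> borel_measurable borel"
  shows "transition f \<in> borel_measurable borel"
proof -
  interpret step: prob_space step_law by (rule prob_space_step_law)
  show ?thesis unfolding transition_def[abs_def] by measurable
qed

lemma transition_bound:
  assumes [measurable]: "f \<in> borel_measurable borel" and "\<And>x. \<bar>f x\<bar> \<le> B"
  shows "\<bar>transition f w\<bar> \<le> B"
proof -
  interpret step: prob_space step_law by (rule prob_space_step_law)
  show ?thesis
    unfolding transition_def by (rule step.abs_expectation_le) (use assms in auto)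
qed

text \<open>The factor \<open>U\<close> ranges over bounded functions of all variables in
  \<open>A\<close>; thus the Markov property covers the restarted chain jointly with the queue
  before the restart.\<close>

lemma chain_markov:
  assumes A: "A \<subseteq> {1..} <+> {1..}" "chain_vars i k \<subseteq> A"
      "Inl (Suc (i + k)) \<notin> A" "Inr (Suc (i + k)) \<notin> A"
    and f [measurable]: "f \<in> borel_measurable borel" and fB: "\<And>x. \<bar>f x\<bar> \<le> B"
    and U [measurable]: "U \<in> borel_measurable (PiM A (\<lambda>_. borel))" and UB: "\<And>x. \<bar>U x\<bar> \<le> (C :: real)"
  shows "expectation (\<lambda>\<omega>. U (restrict (path \<omega>) A) * f (chain i (Suc k) (path \<omega>)))
    = expectation (\<lambda>\<omega>. U (restrict (path \<omega>) A) * transition f (chain i k (path \<omega>)))"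
proof -
  note [measurable] = measurable_chain[OF A(2)]
  let ?F = "\<lambda>(x, t, s). U x * f (max (chain i k x - t) 0 + s)"
  have "expectation (\<lambda>\<omega>. ?F (restrict (path \<omega>) A, tau (Suc (i + k)) \<omega>, S (Suc (i + k)) \<omega>))
     = expectation (\<lambda>\<omega>. \<integral>y. ?F (restrict (path \<omega>) A, y) \<partial>step_law)"
  proof (rule step_integral_eq)
    show "\<bar>?F p\<bar> \<le> C * B" for p
      using mult_mono[OF UB fB] UB[THEN order_trans[OF abs_ge_zero]]
      by (auto simp: abs_mult split: prod.split)
  qed (use A in auto)
  also have "\<dots> = expectation (\<lambda>\<omega>. U (restrict (path \<omega>) A) * transition f (chain i k (path \<omega>)))"
    by (simp add: transition_def case_prod_unfold chain_restrict[OF A(2)])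
  finally show ?thesis by (simp add: chain_restrict[OF A(2)])
qed

lemma chain_step:
  assumes f [measurable]: "f \<in> borel_measurable borel" and fB: "\<And>x. \<bar>f x\<bar> \<le> B"
  shows "expectation (\<lambda>\<omega>. f (chain i (Suc k) (path \<omega>))) = expectation (\<lambda>\<omega>. transition f (chain i k (path \<omega>)))"
proof -
  have "chain_vars i k \<subseteq> {1..} <+> {1..}" "chain_vars i k \<subseteq> chain_vars i k"
    "Inl (Suc (i + k)) \<notin> chain_vars i k" "Inr (Suc (i + k)) \<notin> chain_vars i k"
    by auto
  from chain_markov[OF this f fB, of "\<lambda>_. 1" 1] show ?thesis by simp
qed

lemma waiting_step:
  assumes f [measurable]: "f \<in> borel_measurable borel" and fB: "\<And>x. \<bar>f x\<bar> \<le> B"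
  shows "expectation (\<lambda>\<omega>. f (waiting tau S (Suc k) \<omega>)) = expectation (\<lambda>\<omega>. transition f (waiting tau S k \<omega>))"
  unfolding waiting_eq_chain by (rule chain_step[OF f fB])

text \<open>Equality in law, proved for all test functions at once because removing a step replaces
  \<open>f\<close> by \<open>transition f\<close>.\<close>

lemma chain_shift:
  fixes f :: "real \<Rightarrow> real"
  assumes "f \<in> borel_measurable borel" and "\<And>x. \<bar>f x\<bar> \<le> B"
  shows "expectation (\<lambda>\<omega>. f (chain i k (path \<omega>))) = expectation (\<lambda>\<omega>. f (waiting tau S k \<omega>))"
  using assms
proof (induction k arbitrary: f)
  case (Suc k)
  have "expectation (\<lambda>\<omega>. f (chain i (Suc k) (path \<omega>))) = expectation (\<lambda>\<omega>. transition f (chain i k (path \<omega>)))"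
    by (rule chain_step[OF Suc.prems])
  also have "\<dots> = expectation (\<lambda>\<omega>. transition f (waiting tau S k \<omega>))"
    by (intro Suc.IH measurable_transition transition_bound Suc.prems)
  also have "\<dots> = expectation (\<lambda>\<omega>. f (waiting tau S (Suc k) \<omega>))"
    by (rule waiting_step[OF Suc.prems, symmetric])
  finally show ?case .
qed (simp add: waiting_0)

text \<open>
  The strong Feller property: by lack of memory, starting from \<open>v + d\<close> instead of \<open>v\<close> merely shifts
  the exponential density by \<open>d\<close>.
\<close>

lemma transition_diff_le:
  assumes f [measurable]: "f \<in> borel_measurable borel" and fB: "\<And>x. \<bar>f x\<bar> \<le> B" and vw: "v \<le> w"
  shows "\<bar>transition f w - transition f v\<bar> \<le> 2 * B * (1 - exp (- lam * (w - v)))"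
proof -
  define e where "e = exponential_density lam"
  define d where "d = w - v"
  define G where "G u = (\<integral>s. f (max u 0 + s) \<partial>distr M borel (S 1))" for u
  have B: "0 \<le> B" using fB[of 0] by linarith
  have d: "0 \<le> d" using vw by (simp add: d_def)
  have e_nonneg: "0 \<le> e t" for t unfolding e_def by (rule exponential_density_nonneg[OF lam_pos])
  have e_meas [measurable]: "e \<in> borel_measurable borel" unfolding e_def by measurable
  have G_meas [measurable]: "G \<in> borel_measurable borel"
    unfolding G_def[abs_def] by (rule service_law.borel_measurable_lebesgue_integral) measurable
  have G_bound: "\<bar>G u\<bar> \<le> B" for u
    unfolding G_def by (rule service_law.abs_expectation_le) (use fB in auto)
  have e_int: "integrable lborel e" and e_one: "(\<integral>t. e t \<partial>lborel) = 1"
  proof -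
    have "(\<integral>\<^sup>+t. ennreal (e t) \<partial>lborel) = 1"
      using arrival_law.emeasure_space_1 by (simp add: emeasure_density e_def)
    then show "integrable lborel e" "(\<integral>t. e t \<partial>lborel) = 1"
      using e_nonneg by (auto simp: integrable_iff_bounded integral_eq_nn_integral)
  qed
  \<comment> \<open>After averaging over the service time, the transition is a convolution with the
    exponential density, so a change of the starting point can be moved onto the density.\<close>
  have trans: "transition f x = (\<integral>t. e t * G (x - t) \<partial>lborel)" for x
  proof -
    have "transition f x = (\<integral>t. (\<integral>s. f (max (x - t) 0 + s) \<partial>distr M borel (S 1)) \<partial>density lborel e)"
      unfolding transition_def step_law_def e_def
    proof (subst step_law.integral_fst'[symmetric])
      show "integrable (density lborel (exponential_density lam) \<Otimes>\<^sub>M distr M borel (S 1))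
          (\<lambda>(t, s). f (max (x - t) 0 + s))"
        by (rule step_law.integrable_const_bound[where B = B]) (use fB in auto)
    qed simp
    also have "\<dots> = (\<integral>t. G (x - t) \<partial>density lborel e)" by (simp add: G_def)
    also have "\<dots> = (\<integral>t. e t * G (x - t) \<partial>lborel)"
      using e_nonneg by (subst integral_density) auto
    finally show ?thesis .
  qed
  have shift: "integrable lborel (\<lambda>t. e (d + t))" "(\<integral>t. e (d + t) \<partial>lborel) = 1"
    using lborel_integrable_real_affine[of e 1 d] lborel_integral_real_affine[of 1 e d] e_int e_one by auto
  have w: "transition f w = (\<integral>t. e (d + t) * G (v - t) \<partial>lborel)"
    unfolding trans by (subst lborel_integral_real_affine[of 1 _ d]) (auto simp: d_def)
  have intG: "integrable lborel (\<lambda>t. a t * G (v - t))" if a: "integrable lborel a" for a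
  proof (rule Bochner_Integration.integrable_bound)
    show "integrable lborel (\<lambda>t. a t * B)" using a by simp
    show "AE t in lborel. norm (a t * G (v - t)) \<le> norm (a t * B)"
      using G_bound B by (auto simp: abs_mult intro!: mult_left_mono)
  qed (use a in auto)
  \<comment> \<open>In fact an equality. In this form the first two terms integrate to 0 and only
    the last one contributes.\<close>
  have pointwise: "\<bar>e (d + t) - e t\<bar> \<le> e (d + t) - e t + 2 * (1 - exp (- lam * d)) * e t" for t
  proof (cases "t < 0")
    case True
    then have "e t = 0" by (simp add: e_def exponential_density_def)
    then show ?thesis using e_nonneg[of "d + t"] by simp
  next
    case False
    then have "e (d + t) = exp (- lam * d) * e t"
      using d by (simp add: e_def exponential_density_def exp_add[symmetric] algebra_simps)
    moreover have "exp (- lam * d) * e t \<le> 1 * e t"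
      using d lam_pos e_nonneg by (intro mult_right_mono) auto
    ultimately show ?thesis by (simp add: abs_if algebra_simps)
  qed
  have "transition f w - transition f v = (\<integral>t. (e (d + t) - e t) * G (v - t) \<partial>lborel)"
    unfolding w trans[of v] left_diff_distrib
    by (intro Bochner_Integration.integral_diff[symmetric] intG shift e_int)
  also have "\<bar>\<dots>\<bar> \<le> (\<integral>t. \<bar>(e (d + t) - e t) * G (v - t)\<bar> \<partial>lborel)"
    by (rule integral_abs_bound)
  also have "\<dots> \<le> (\<integral>t. (e (d + t) - e t + 2 * (1 - exp (- lam * d)) * e t) * B \<partial>lborel)"
  proof (rule integral_mono)
    show "\<bar>(e (d + t) - e t) * G (v - t)\<bar> \<le> (e (d + t) - e t + 2 * (1 - exp (- lam * d)) * e t) * B" for t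
      unfolding abs_mult using pointwise G_bound by (intro mult_mono order.trans[OF abs_ge_zero pointwise]) auto
    show "integrable lborel (\<lambda>t. \<bar>(e (d + t) - e t) * G (v - t)\<bar>)"
      using shift e_int by (intro Bochner_Integration.integrable_abs intG) auto
  qed (use shift e_int in auto)
  also have "\<dots> = 2 * B * (1 - exp (- lam * d))"
    using shift e_int e_one by simp
  finally show ?thesis by (simp add: d_def)
qed

lemma isCont_transition:
  assumes f: "f \<in> borel_measurable borel" and fB: "\<And>x. \<bar>f x\<bar> \<le> B"
  shows "isCont (transition f) x"
  unfolding continuous_at LIM_zero_iff[symmetric, of "transition f"]
proof (rule Lim_null_comparison)
  have "\<bar>transition f y - transition f x\<bar> \<le> 2 * B * (1 - exp (- lam * \<bar>y - x\<bar>))" for y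
    using transition_diff_le[OF f fB, of x y] transition_diff_le[OF f fB, of y x]
    by (cases "x \<le> y") (auto simp: abs_minus_commute)
  then show "\<forall>\<^sub>F y in at x. norm (transition f y - transition f x) \<le> 2 * B * (1 - exp (- lam * \<bar>y - x\<bar>))"
    by simp
  have "((\<lambda>y. 2 * B * (1 - exp (- lam * \<bar>y - x\<bar>))) \<longlongrightarrow> 2 * B * (1 - exp (- lam * \<bar>x - x\<bar>))) (at x)"
    by (intro tendsto_intros)
  then show "((\<lambda>y. 2 * B * (1 - exp (- lam * \<bar>y - x\<bar>))) \<longlongrightarrow> 0) (at x)" by simp
qed

end

section \<open>Ergodicity of the waiting times\<close>

lemma chain_nonneg: "(\<And>j. 0 \<le> x (Inr (Suc j))) \<Longrightarrow> 0 \<le> chain i k x"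
  by (cases k) (auto intro: add_nonneg_nonneg)

text \<open>Lindley's recursion is monotone in its starting value, and the restart lowers that value
  to 0.\<close>

lemma chain_le_full:
  assumes "\<And>j. 0 \<le> x (Inr (Suc j))"
  shows "chain i k x \<le> chain 0 (i + k) x"
proof (induction k)
  case 0
  then show ?case using chain_nonneg[of x 0 i] assms by simp
next
  case (Suc k)
  then show ?case by (simp add: max_def)
qed

lemma chain_le_sum_service:
  assumes "\<And>j. 0 \<le> x (Inr (Suc j))" and "\<And>j. 0 \<le> x (Inl (Suc j))"
  shows "chain 0 k x \<le> (\<Sum>i=1..k. x (Inr i))"
proof (induction k)
  case (Suc k)
  then show ?case using assms(2)[of k] chain_nonneg[of x 0 k] assms(1) by simp
qed simp

locale ergodic_queue = mg1_queue +
  fixes \<pi> :: "real measure"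
  assumes limiting: "limiting_distribution M (waiting tau S) \<pi>"
begin

sublocale limit_law: real_distribution \<pi>
  using limiting by (simp add: limiting_distribution_def)

abbreviation W :: "nat \<Rightarrow> 'a \<Rightarrow> real" where "W \<equiv> waiting tau S"

section \<open>Convergence to a stationary limit law\<close>

lemma integrable_bounded:
  "X \<in> borel_measurable M \<Longrightarrow> (\<And>\<omega>. \<bar>X \<omega>\<bar> \<le> B) \<Longrightarrow> integrable M X" for X :: "'a \<Rightarrow> real"
  by (rule integrable_const_bound[where B = B]) auto

text \<open>One step of the chain is spent on turning \<open>f\<close> into a continuous test
  function. The price is \<open>transition f\<close> in the limit, which stationarity removes
  afterwards.\<close>

lemma limit_transition:
  assumes f [measurable]: "f \<in> borel_measurable borel" and fB: "\<And>x. \<bar>f x\<bar> \<le> B"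
  shows "(\<lambda>n. expectation (\<lambda>\<omega>. f (W (Suc n) \<omega>))) \<longlonglongrightarrow> (\<integral>w. transition f w \<partial>\<pi>)"
proof -
  have "(\<lambda>n. \<integral>w. transition f w \<partial>distr M borel (W n)) \<longlonglongrightarrow> (\<integral>w. transition f w \<partial>\<pi>)"
  proof (rule weak_conv_imp_integral_bdd_continuous_conv)
    show "weak_conv_m (\<lambda>n. distr M borel (W n)) \<pi>"
      using limiting by (simp add: limiting_distribution_def)
    show "isCont (transition f) x" for x by (rule isCont_transition[OF f fB])
    show "norm (transition f x) \<le> B" for x using transition_bound[OF f fB] by simp
  qed (auto intro: real_distribution_distr limit_law.real_distribution_axioms)
  also have "(\<lambda>n. \<integral>w. transition f w \<partial>distr M borel (W n)) = (\<lambda>n. expectation (\<lambda>\<omega>. f (W (Suc n) \<omega>)))"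
    by (simp add: integral_distr waiting_step[OF f fB])
  finally show ?thesis .
qed

text \<open>\<open>\<pi>'\<close> is the law after one step from \<open>\<pi>\<close>. The laws of
  \<open>W (Suc n)\<close> converge weakly to both, and comparing limits of characteristic functions
  identifies the two.\<close>

lemma limit_law_stationary:
  assumes f [measurable]: "f \<in> borel_measurable borel" and fB: "\<And>x. \<bar>f x\<bar> \<le> B"
  shows "(\<integral>w. transition f w \<partial>\<pi>) = (\<integral>w. f w \<partial>\<pi>)"
proof -
  interpret step: prob_space step_law by (rule prob_space_step_law)
  interpret P: pair_prob_space \<pi> step_law ..
  let ?next = "\<lambda>(w, t, s). max (w - t) 0 + s :: real"
  define \<pi>' where "\<pi>' = distr (\<pi> \<Otimes>\<^sub>M step_law) borel ?next"
  have next_meas [measurable]: "?next \<in> \<pi> \<Otimes>\<^sub>M step_law \<rightarrow>\<^sub>M borel" by measurable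
  have int: "(\<integral>w. h w \<partial>\<pi>') = (\<integral>w. transition h w \<partial>\<pi>)"
    if h [measurable]: "h \<in> borel_measurable borel" and hC: "\<And>x. \<bar>h x\<bar> \<le> C" for h :: "real \<Rightarrow> real" and C
  proof -
    have "(\<integral>w. h w \<partial>\<pi>') = (\<integral>p. h (?next p) \<partial>(\<pi> \<Otimes>\<^sub>M step_law))"
      unfolding \<pi>'_def by (subst integral_distr) auto
    also have "\<dots> = (\<integral>w. (\<integral>y. h (?next (w, y)) \<partial>step_law) \<partial>\<pi>)"
      by (rule P.integral_fst'[symmetric], rule P.integrable_const_bound[where B = C])
         (use hC in auto)
    finally show ?thesis by (simp add: transition_def case_prod_unfold)
  qed
  have \<pi>': "real_distribution \<pi>'"
    unfolding \<pi>'_def by (rule P.real_distribution_distr) measurable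
  then interpret \<pi>': real_distribution \<pi>' .
  have rd: "real_distribution (distr M borel (W (Suc n)))" for n
    by (rule real_distribution_distr) simp
  have "weak_conv_m (\<lambda>n. distr M borel (W (Suc n))) \<pi>'"
    unfolding weak_conv_m_def weak_conv_def
  proof (intro allI impI)
    fix x
    \<comment> \<open>Indicators are legitimate test functions here, so the distribution functions
      converge at every point, not only at continuity points.\<close>
    have "(\<lambda>n. expectation (\<lambda>\<omega>. indicator {..x} (W (Suc n) \<omega>) :: real)) \<longlonglongrightarrow> (\<integral>w. indicator {..x} w \<partial>\<pi>')"
      using limit_transition[of "indicator {..x}" 1] int[of "indicator {..x}" 1] by (simp add: indicator_def)
    moreover have "expectation (\<lambda>\<omega>. indicator {..x} (W n \<omega>) :: real) = cdf (distr M borel (W n)) x" for n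
      unfolding cdf_def2 using integral_distr[of "W n" M borel "indicator {..x} :: real \<Rightarrow> real"] by simp
    ultimately show "(\<lambda>n. cdf (distr M borel (W (Suc n))) x) \<longlonglongrightarrow> cdf \<pi>' x"
      by (simp add: cdf_def2)
  qed
  then have 1: "(\<lambda>n. char (distr M borel (W (Suc n))) t) \<longlonglongrightarrow> char \<pi>' t" for t
    by (intro levy_continuity1 rd \<pi>')
  have "weak_conv_m (\<lambda>n. distr M borel (W (Suc n))) \<pi>"
    using limiting
    by (auto simp: limiting_distribution_def weak_conv_m_def weak_conv_def intro: LIMSEQ_Suc)
  then have 2: "(\<lambda>n. char (distr M borel (W (Suc n))) t) \<longlonglongrightarrow> char \<pi> t" for t
    by (intro levy_continuity1 rd limit_law.real_distribution_axioms)
  have "\<pi>' = \<pi>"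
    using LIMSEQ_unique[OF 1 2] by (intro Levy_uniqueness \<pi>' limit_law.real_distribution_axioms) auto
  with int[OF f fB] show ?thesis by simp
qed

lemma expectation_waiting_tendsto:
  fixes f :: "real \<Rightarrow> real"
  assumes f: "f \<in> borel_measurable borel" and fB: "\<And>x. \<bar>f x\<bar> \<le> B"
  shows "(\<lambda>n. expectation (\<lambda>\<omega>. f (W n \<omega>))) \<longlonglongrightarrow> (\<integral>w. f w \<partial>\<pi>)"
  using limit_transition[OF f fB] unfolding limit_law_stationary[OF f fB] by (rule LIMSEQ_imp_Suc)

lemma waiting_tight:
  assumes "0 < \<eta>"
  shows "\<exists>c>0. \<forall>\<^sub>F n in sequentially. prob {\<omega> \<in> space M. c < W n \<omega>} < \<eta>"
proof -
  have "\<forall>\<^sub>F c in at_top. 1 - \<eta> < cdf \<pi> c"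
    using limit_law.cdf_lim_at_top_prob assms by (intro order_tendstoD) auto
  then obtain c where c: "0 < c" "1 - \<eta> < cdf \<pi> c"
    using eventually_happens'[OF _ eventually_conj[OF _ eventually_gt_at_top[of 0]]] trivial_limit_at_top_linorder
    by blast
  have "(\<lambda>n. expectation (\<lambda>\<omega>. indicator {c<..} (W n \<omega>) :: real)) \<longlonglongrightarrow> (\<integral>w. indicator {c<..} w \<partial>\<pi>)"
    by (rule expectation_waiting_tendsto[where B = 1]) (auto simp: indicator_def)
  moreover have "expectation (\<lambda>\<omega>. indicator {c<..} (W n \<omega>) :: real) = prob {\<omega> \<in> space M. c < W n \<omega>}" for n
  proof -
    have "expectation (\<lambda>\<omega>. indicator {c<..} (W n \<omega>) :: real) = expectation (indicator {\<omega> \<in> space M. c < W n \<omega>})"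
      by (rule Bochner_Integration.integral_cong) (auto simp: indicator_def)
    then show ?thesis by (simp add: Int_absorb1)
  qed
  moreover have "(\<integral>w. indicator {c<..} w \<partial>\<pi>) = 1 - cdf \<pi> c"
    using limit_law.prob_compl[of "{..c}"] by (simp add: cdf_def2 Compl_atMost[symmetric] Compl_eq_Diff_UNIV)
  ultimately have "(\<lambda>n. prob {\<omega> \<in> space M. c < W n \<omega>}) \<longlonglongrightarrow> 1 - cdf \<pi> c" by simp
  then have "\<forall>\<^sub>F n in sequentially. prob {\<omega> \<in> space M. c < W n \<omega>} < \<eta>"
    using c by (intro order_tendstoD) auto
  with c show ?thesis by blast
qed

section \<open>Decay of correlations and the weak law\<close>

lemma AE_path_nonneg: "AE \<omega> in M. \<forall>j. 0 \<le> tau (Suc j) \<omega> \<and> 0 \<le> S (Suc j) \<omega>"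
  unfolding AE_all_countable
proof
  fix j
  have "AE \<omega> in M. 0 \<le> tau (Suc j) \<omega>"
    using interarrival[of "Suc j"]
    by (subst distributed_AE2[where X = "tau (Suc j)" and N = lborel])
       (auto simp: exponential_density_def)
  moreover have "AE \<omega> in M. 0 \<le> S (Suc j) \<omega>" by (rule service_nonneg) simp
  ultimately show "AE \<omega> in M. 0 \<le> tau (Suc j) \<omega> \<and> 0 \<le> S (Suc j) \<omega>" by simp
qed

text \<open>Independence of \<open>W i\<close> and the chain restarted there. Peeling off the last
  step leaves the factor \<open>u (W i)\<close> untouched, so no joint law has to be
  computed.\<close>

lemma chain_product:
  fixes f u :: "real \<Rightarrow> real"
  assumes "f \<in> borel_measurable borel" and "\<And>x. \<bar>f x\<bar> \<le> B"
    and u [measurable]: "u \<in> borel_measurable borel" and uC: "\<And>x. \<bar>u x\<bar> \<le> C"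
  shows "expectation (\<lambda>\<omega>. u (W i \<omega>) * f (chain i k (path \<omega>)))
    = expectation (\<lambda>\<omega>. u (W i \<omega>)) * expectation (\<lambda>\<omega>. f (W k \<omega>))"
  using assms(1,2)
proof (induction k arbitrary: f)
  case 0
  then show ?case by (simp add: waiting_0 prob_space)
next
  case (Suc k)
  let ?A = "{0<..i + k} <+> {0<..i + k}"
  have sub: "chain_vars 0 i \<subseteq> ?A" by auto
  have A: "?A \<subseteq> {1..} <+> {1..}" "chain_vars i k \<subseteq> ?A" "Inl (Suc (i + k)) \<notin> ?A" "Inr (Suc (i + k)) \<notin> ?A"
    by auto
  note [measurable] = measurable_chain[OF sub]
  have U: "(\<lambda>x. u (chain 0 i x)) \<in> borel_measurable (PiM ?A (\<lambda>_. borel))" by measurable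
  have "expectation (\<lambda>\<omega>. u (W i \<omega>) * f (chain i (Suc k) (path \<omega>)))
      = expectation (\<lambda>\<omega>. u (W i \<omega>) * transition f (chain i k (path \<omega>)))"
    using chain_markov[OF A Suc.prems U uC]
    by (simp add: chain_restrict[OF sub] waiting_eq_chain)
  also have "\<dots> = expectation (\<lambda>\<omega>. u (W i \<omega>)) * expectation (\<lambda>\<omega>. transition f (W k \<omega>))"
    by (intro Suc.IH measurable_transition transition_bound Suc.prems)
  also have "expectation (\<lambda>\<omega>. transition f (W k \<omega>)) = expectation (\<lambda>\<omega>. f (W (Suc k) \<omega>))"
    by (rule waiting_step[OF Suc.prems, symmetric])
  finally show ?case .
qed

text \<open>Since the restarted chain lies below the true one, the mean gap of a decreasing function
  between the two is a difference of expectations, hence depends only on the laws of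
  \<open>W m\<close> and \<open>W (i + m)\<close>. The function \<open>exp (- lam * w)\<close> fits
  because the modulus of continuity \<open>1 - exp (- lam * (w - v))\<close> of the transition
  operator is its gap times \<open>exp (lam * v)\<close>, a factor controlled by the level
  \<open>c\<close>.\<close>

lemma transition_full_minus_restarted:
  fixes u :: "real \<Rightarrow> real"
  assumes u [measurable]: "u \<in> borel_measurable borel" and uB: "\<And>x. \<bar>u x\<bar> \<le> B" and c: "0 \<le> c"
  shows "expectation (\<lambda>\<omega>. \<bar>transition u (W (i + m) \<omega>) - transition u (chain i m (path \<omega>))\<bar>)
    \<le> 2 * B * (exp (lam * c) * (expectation (\<lambda>\<omega>. exp (- lam * max (W m \<omega>) 0))
          - expectation (\<lambda>\<omega>. exp (- lam * max (W (i + m) \<omega>) 0)))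
        + prob {\<omega> \<in> space M. c < W m \<omega>})"
proof -
  \<comment> \<open>The truncation bounds \<open>\<phi>\<close> by 1 everywhere; waiting times are
    nonnegative only almost surely.\<close>
  define \<phi> where "\<phi> w = exp (- lam * max w 0)" for w
  have \<phi> [measurable]: "\<phi> \<in> borel_measurable borel" unfolding \<phi>_def[abs_def] by measurable
  have \<phi>1: "\<bar>\<phi> x\<bar> \<le> 1" for x using lam_pos by (auto simp: \<phi>_def)
  let ?V = "\<lambda>\<omega>. chain i m (path \<omega>)"
  have B: "0 \<le> B" using uB[of 0] by linarith
  have int\<phi>: "integrable M (\<lambda>\<omega>. \<phi> (X \<omega>))" if [measurable]: "X \<in> borel_measurable M" for X
    by (rule integrable_bounded[where B = 1]) (use \<phi>1 in auto)
  have intI: "integrable M (\<lambda>\<omega>. indicator {c<..} (?V \<omega>) :: real)"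
    by (rule integrable_bounded[where B = 1]) (auto simp: indicator_def)
  have tB: "\<bar>transition u x\<bar> \<le> B" for x by (rule transition_bound[OF u uB])
  have intT: "integrable M (\<lambda>\<omega>. transition u (X \<omega>))" if [measurable]: "X \<in> borel_measurable M" for X
    by (rule integrable_bounded[where B = B]) (use tB in auto)
  have "expectation (\<lambda>\<omega>. \<bar>transition u (W (i + m) \<omega>) - transition u (?V \<omega>)\<bar>)
     \<le> expectation (\<lambda>\<omega>. 2 * B * (exp (lam * c) * (\<phi> (?V \<omega>) - \<phi> (W (i + m) \<omega>)) + indicator {c<..} (?V \<omega>)))"
  proof (rule integral_mono_AE)
    show "AE \<omega> in M. \<bar>transition u (W (i + m) \<omega>) - transition u (?V \<omega>)\<bar>
        \<le> 2 * B * (exp (lam * c) * (\<phi> (?V \<omega>) - \<phi> (W (i + m) \<omega>)) + indicator {c<..} (?V \<omega>))"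
      using AE_path_nonneg
    proof eventually_elim
      case (elim \<omega>)
      let ?v = "?V \<omega>" and ?w = "W (i + m) \<omega>"
      have v: "0 \<le> ?v" using elim by (intro chain_nonneg) simp
      have vw: "?v \<le> ?w" unfolding waiting_eq_chain using elim by (intro chain_le_full) simp
      have "1 - exp (- lam * (?w - ?v)) \<le> exp (lam * c) * (\<phi> ?v - \<phi> ?w) + indicator {c<..} ?v"
      proof (cases "?v \<le> c")
        case True
        have "exp (lam * ?v) * exp (- lam * ?v) = 1" by (simp add: exp_minus)
        moreover have "exp (lam * ?v) * exp (- lam * ?w) = exp (- lam * (?w - ?v))"
          by (simp add: exp_add[symmetric] algebra_simps)
        ultimately have "1 - exp (- lam * (?w - ?v)) = exp (lam * ?v) * (\<phi> ?v - \<phi> ?w)"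
          using v vw by (simp add: \<phi>_def right_diff_distrib)
        also have "\<dots> \<le> exp (lam * c) * (\<phi> ?v - \<phi> ?w)"
          using True v vw lam_pos by (intro mult_right_mono) (auto simp: \<phi>_def)
        finally show ?thesis using True by simp
      next
        \<comment> \<open>Above the level \<open>c\<close> the left side is at most 1, which the
          indicator pays.\<close>
        case False
        have "0 \<le> exp (lam * c) * (\<phi> ?v - \<phi> ?w)" using v vw lam_pos by (simp add: \<phi>_def)
        moreover have "0 \<le> exp (- lam * (?w - ?v))" by simp
        ultimately show ?thesis using False by (simp del: exp_ge_zero)
      qed
      then have "2 * B * (1 - exp (- lam * (?w - ?v))) \<le> 2 * B * (exp (lam * c) * (\<phi> ?v - \<phi> ?w) + indicator {c<..} ?v)"
        using B by (intro mult_left_mono) auto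
      with transition_diff_le[OF u uB vw] show ?case by linarith
    qed
  qed (use intT int\<phi> intI in auto)
  also have "\<dots> = 2 * B * (exp (lam * c) * (expectation (\<lambda>\<omega>. \<phi> (?V \<omega>)) - expectation (\<lambda>\<omega>. \<phi> (W (i + m) \<omega>)))
      + expectation (\<lambda>\<omega>. indicator {c<..} (?V \<omega>)))"
    using int\<phi> intI by simp
  also have "expectation (\<lambda>\<omega>. \<phi> (?V \<omega>)) = expectation (\<lambda>\<omega>. \<phi> (W m \<omega>))"
    by (rule chain_shift[where B = 1]) (use \<phi>1 in auto)
  also have "expectation (\<lambda>\<omega>. indicator {c<..} (?V \<omega>) :: real) = expectation (\<lambda>\<omega>. indicator {c<..} (W m \<omega>))"
    by (rule chain_shift[where B = 1]) (auto simp: indicator_def)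
  also have "expectation (\<lambda>\<omega>. indicator {c<..} (W m \<omega>) :: real) = expectation (indicator {\<omega> \<in> space M. c < W m \<omega>})"
    by (rule Bochner_Integration.integral_cong) (auto simp: indicator_def)
  finally show ?thesis by (simp add: \<phi>_def Int_absorb1)
qed

text \<open>The last step is smoothed into \<open>transition u\<close>, and its argument is replaced
  by the chain restarted after symbol \<open>i\<close>. That contribution factors, with one factor
  close to the mean 0; the replacement is cheap because the expectations of
  \<open>exp (- lam * max (W n) 0)\<close> form a Cauchy sequence. Both estimates are uniform in
  \<open>i\<close>.\<close>

lemma decorrelation:
  fixes u :: "real \<Rightarrow> real"
  assumes u [measurable]: "u \<in> borel_measurable borel" and uB: "\<And>x. \<bar>u x\<bar> \<le> B"
    and mean: "(\<integral>w. u w \<partial>\<pi>) = 0" and \<epsilon>: "0 < \<epsilon>"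
  shows "\<exists>m0. \<forall>m\<ge>m0. \<forall>i. \<bar>expectation (\<lambda>\<omega>. u (W i \<omega>) * u (W (i + m) \<omega>))\<bar> \<le> \<epsilon>"
proof -
  have B: "0 \<le> B" using uB[of 0] by linarith
  \<comment> \<open>\<open>B * \<eta>\<close> will come from the factored term and
    \<open>B * (2 * B * (\<eta> + \<eta>))\<close> from the replacement; the 1 guards against
    \<open>B = 0\<close>.\<close>
  define \<eta> where "\<eta> = \<epsilon> / (B + 4 * B\<^sup>2 + 1)"
  have den: "0 < B + 4 * B\<^sup>2 + 1" using B by (simp add: add_nonneg_pos)
  have \<eta>: "0 < \<eta>" "(B + 4 * B\<^sup>2) * \<eta> \<le> \<epsilon>"
    using \<epsilon> den by (auto simp: \<eta>_def field_simps)
  obtain c where c: "0 < c" and tight: "\<forall>\<^sub>F n in sequentially. prob {\<omega> \<in> space M. c < W n \<omega>} < \<eta>"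
    using waiting_tight[OF \<eta>(1)] by blast
  define \<phi> where "\<phi> n = expectation (\<lambda>\<omega>. exp (- lam * max (W n \<omega>) 0))" for n
  have "convergent \<phi>"
    unfolding \<phi>_def[abs_def] convergent_def
    using expectation_waiting_tendsto[of "\<lambda>w. exp (- lam * max w 0)" 1] lam_pos by auto
  then have "Cauchy \<phi>" by (rule convergent_Cauchy)
  then obtain m1 where m1: "\<And>m n. m1 \<le> m \<Longrightarrow> m1 \<le> n \<Longrightarrow> dist (\<phi> m) (\<phi> n) < \<eta> * exp (- lam * c)"
    using metric_CauchyD[of \<phi> "\<eta> * exp (- lam * c)"] \<eta>(1) by auto
  have "(\<lambda>n. \<bar>expectation (\<lambda>\<omega>. u (W n \<omega>))\<bar>) \<longlonglongrightarrow> \<bar>0\<bar>"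
    using expectation_waiting_tendsto[OF u uB] unfolding mean by (rule tendsto_rabs)
  then have "\<forall>\<^sub>F n in sequentially. \<bar>expectation (\<lambda>\<omega>. u (W n \<omega>))\<bar> < \<eta>"
    using \<eta>(1) by (intro order_tendstoD) auto
  from eventually_conj[OF tight this] obtain m2 where m2: "\<And>n. m2 \<le> n \<Longrightarrow> prob {\<omega> \<in> space M. c < W n \<omega>} < \<eta>"
      "\<And>n. m2 \<le> n \<Longrightarrow> \<bar>expectation (\<lambda>\<omega>. u (W n \<omega>))\<bar> < \<eta>"
    unfolding eventually_sequentially by blast
  have tB: "\<bar>transition u x\<bar> \<le> B" for x by (rule transition_bound[OF u uB])
  have bound: "\<bar>expectation (\<lambda>\<omega>. u (W i \<omega>) * u (W (Suc (i + m)) \<omega>))\<bar> \<le> \<epsilon>" if m: "max m1 m2 \<le> m" for i m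
  proof -
    let ?A = "{0<..i + m} <+> {0<..i + m}"
    have sub: "chain_vars 0 i \<subseteq> ?A" by auto
    have A: "?A \<subseteq> {1..} <+> {1..}" "chain_vars 0 (i + m) \<subseteq> ?A" "Inl (Suc (0 + (i + m))) \<notin> ?A" "Inr (Suc (0 + (i + m))) \<notin> ?A"
      by auto
    note [measurable] = measurable_chain[OF sub]
    have U: "(\<lambda>x. u (chain 0 i x)) \<in> borel_measurable (PiM ?A (\<lambda>_. borel))" by measurable
    let ?V = "\<lambda>\<omega>. chain i m (path \<omega>)"
    let ?\<Delta> = "\<lambda>\<omega>. transition u (W (i + m) \<omega>) - transition u (?V \<omega>)"
    have int: "integrable M (\<lambda>\<omega>. u (X \<omega>) * transition u (Y \<omega>))"
      if [measurable]: "X \<in> borel_measurable M" "Y \<in> borel_measurable M" for X Y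
      by (rule integrable_bounded[where B = "B * B"])
         (use uB tB B in \<open>auto simp: abs_mult intro!: mult_mono\<close>)
    have int\<Delta>: "integrable M ?\<Delta>"
      by (intro Bochner_Integration.integrable_diff integrable_bounded[where B = B]) (use tB in auto)
    have int_u\<Delta>: "integrable M (\<lambda>\<omega>. u (W i \<omega>) * ?\<Delta> \<omega>)"
      unfolding right_diff_distrib by (intro Bochner_Integration.integrable_diff int) auto
    have "expectation (\<lambda>\<omega>. u (W i \<omega>) * u (W (Suc (i + m)) \<omega>))
        = expectation (\<lambda>\<omega>. u (W i \<omega>) * transition u (W (i + m) \<omega>))"
      using chain_markov[OF A u uB U uB]
      by (simp add: chain_restrict[OF sub] waiting_eq_chain)
    also have "\<dots> = expectation (\<lambda>\<omega>. u (W i \<omega>) * transition u (?V \<omega>) + u (W i \<omega>) * ?\<Delta> \<omega>)"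
      by (simp add: algebra_simps)
    also have "\<dots> = expectation (\<lambda>\<omega>. u (W i \<omega>) * transition u (?V \<omega>)) + expectation (\<lambda>\<omega>. u (W i \<omega>) * ?\<Delta> \<omega>)"
      by (intro Bochner_Integration.integral_add int int_u\<Delta>) auto
    also have "expectation (\<lambda>\<omega>. u (W i \<omega>) * transition u (?V \<omega>))
        = expectation (\<lambda>\<omega>. u (W i \<omega>)) * expectation (\<lambda>\<omega>. u (W (Suc m) \<omega>))"
      unfolding waiting_step[OF u uB] by (rule chain_product[OF _ tB u uB]) measurable
    finally have eq: "expectation (\<lambda>\<omega>. u (W i \<omega>) * u (W (Suc (i + m)) \<omega>))
        = expectation (\<lambda>\<omega>. u (W i \<omega>)) * expectation (\<lambda>\<omega>. u (W (Suc m) \<omega>)) + expectation (\<lambda>\<omega>. u (W i \<omega>) * ?\<Delta> \<omega>)" .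
    have "\<bar>expectation (\<lambda>\<omega>. u (W i \<omega>)) * expectation (\<lambda>\<omega>. u (W (Suc m) \<omega>))\<bar> \<le> B * \<eta>"
      unfolding abs_mult
    proof (rule mult_mono)
      show "\<bar>expectation (\<lambda>\<omega>. u (W i \<omega>))\<bar> \<le> B" by (rule abs_expectation_le) (use uB in auto)
      show "\<bar>expectation (\<lambda>\<omega>. u (W (Suc m) \<omega>))\<bar> \<le> \<eta>" using m2(2)[of "Suc m"] m by simp
    qed (use B in auto)
    moreover have "\<bar>expectation (\<lambda>\<omega>. u (W i \<omega>) * ?\<Delta> \<omega>)\<bar> \<le> B * expectation (\<lambda>\<omega>. \<bar>?\<Delta> \<omega>\<bar>)"
    proof -
      have "\<bar>expectation (\<lambda>\<omega>. u (W i \<omega>) * ?\<Delta> \<omega>)\<bar> \<le> expectation (\<lambda>\<omega>. \<bar>u (W i \<omega>) * ?\<Delta> \<omega>\<bar>)"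
        by (rule integral_abs_bound)
      also have "\<dots> \<le> expectation (\<lambda>\<omega>. B * \<bar>?\<Delta> \<omega>\<bar>)"
      proof (rule integral_mono)
        show "integrable M (\<lambda>\<omega>. \<bar>u (W i \<omega>) * ?\<Delta> \<omega>\<bar>)"
          by (rule Bochner_Integration.integrable_abs[OF int_u\<Delta>])
        show "\<bar>u (W i \<omega>) * ?\<Delta> \<omega>\<bar> \<le> B * \<bar>?\<Delta> \<omega>\<bar>" for \<omega>
          unfolding abs_mult by (rule mult_right_mono[OF uB]) simp
      qed (use int\<Delta> in auto)
      finally show ?thesis by simp
    qed
    moreover have "expectation (\<lambda>\<omega>. \<bar>?\<Delta> \<omega>\<bar>) \<le> 2 * B * (\<eta> + \<eta>)"
    proof -
      \<comment> \<open>Both indices lie beyond \<open>m1\<close>, whatever \<open>i\<close> is;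
        this is the source of uniformity.\<close>
      have "\<phi> m - \<phi> (i + m) \<le> \<eta> * exp (- lam * c)"
        using m1[of m "i + m"] m by (simp add: dist_real_def)
      then have "exp (lam * c) * (\<phi> m - \<phi> (i + m)) \<le> exp (lam * c) * (\<eta> * exp (- lam * c))"
        by (intro mult_left_mono) auto
      also have "\<dots> = \<eta>" by (simp add: exp_minus)
      finally have "2 * B * (exp (lam * c) * (\<phi> m - \<phi> (i + m)) + prob {\<omega> \<in> space M. c < W m \<omega>}) \<le> 2 * B * (\<eta> + \<eta>)"
        using m2(1)[of m] m B by (intro mult_left_mono add_mono) auto
      with transition_full_minus_restarted[OF u uB, of c i m] c show ?thesis
        unfolding \<phi>_def by linarith
    qed
    then have "B * expectation (\<lambda>\<omega>. \<bar>?\<Delta> \<omega>\<bar>) \<le> B * (2 * B * (\<eta> + \<eta>))"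
      using B by (rule mult_left_mono)
    ultimately have "\<bar>expectation (\<lambda>\<omega>. u (W i \<omega>) * u (W (Suc (i + m)) \<omega>))\<bar> \<le> B * \<eta> + B * (2 * B * (\<eta> + \<eta>))"
      unfolding eq by linarith
    also have "\<dots> = (B + 4 * B\<^sup>2) * \<eta>" by (simp add: power2_eq_square algebra_simps)
    finally show ?thesis using \<eta>(2) by linarith
  qed
  show ?thesis
  \<comment> \<open>The lag includes the smoothing step, hence the successor.\<close>
  proof (intro exI[of _ "Suc (max m1 m2)"] allI impI)
    fix m i assume "Suc (max m1 m2) \<le> m"
    then obtain k where "m = Suc k" "max m1 m2 \<le> k" by (cases m) auto
    then show "\<bar>expectation (\<lambda>\<omega>. u (W i \<omega>) * u (W (i + m) \<omega>))\<bar> \<le> \<epsilon>" using bound[of k i] by simp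
  qed
qed

text \<open>Chebyshev's inequality for the centred sum: each index has at most
  \<open>2 * m0 + 1\<close> partners in the band where correlations may be large, and any other
  partner contributes at most \<open>\<epsilon>\<close>.\<close>

lemma waiting_weak_law:
  fixes f :: "real \<Rightarrow> real"
  assumes f [measurable]: "f \<in> borel_measurable borel" and fB: "\<And>x. \<bar>f x\<bar> \<le> B" and \<delta>: "0 < \<delta>"
  shows "(\<lambda>n. prob {\<omega> \<in> space M. real n * \<delta> \<le> \<bar>(\<Sum>i=1..n. f (W i \<omega>)) - real n * (\<integral>w. f w \<partial>\<pi>)\<bar>}) \<longlonglongrightarrow> 0"
proof -
  define u where "u w = f w - (\<integral>w. f w \<partial>\<pi>)" for w
  have u [measurable]: "u \<in> borel_measurable borel" unfolding u_def[abs_def] by measurable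
  have B: "0 \<le> B" using fB[of 0] by linarith
  have uB: "\<bar>u w\<bar> \<le> 2 * B" for w
  proof -
    have "\<bar>\<integral>w. f w \<partial>\<pi>\<bar> \<le> B" by (rule limit_law.abs_expectation_le) (use fB in auto)
    with fB[of w] show ?thesis unfolding u_def by linarith
  qed
  have "integrable \<pi> f" using fB by (intro limit_law.integrable_const_bound[where B = B]) auto
  then have mean: "(\<integral>w. u w \<partial>\<pi>) = 0"
    using limit_law.prob_space by (simp add: u_def)
  have int: "integrable M (\<lambda>\<omega>. u (W i \<omega>) * u (W j \<omega>))" for i j
  proof (rule integrable_bounded)
    show "\<bar>u (W i \<omega>) * u (W j \<omega>)\<bar> \<le> 2 * B * (2 * B)" for \<omega>
      unfolding abs_mult using B by (intro mult_mono uB) auto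
  qed measurable
  have corr_le: "\<bar>expectation (\<lambda>\<omega>. u (W i \<omega>) * u (W j \<omega>))\<bar> \<le> 4 * B\<^sup>2" for i j
  proof (rule abs_expectation_le)
    show "\<bar>u (W i \<omega>) * u (W j \<omega>)\<bar> \<le> 4 * B\<^sup>2" for \<omega>
      using mult_mono[OF uB uB] B by (simp add: abs_mult power2_eq_square)
  qed measurable
  let ?dev = "\<lambda>n. prob {\<omega> \<in> space M. real n * \<delta> \<le> \<bar>\<Sum>i=1..n. u (W i \<omega>)\<bar>}"
  have "?dev \<longlonglongrightarrow> 0"
  proof (rule LIMSEQ_I)
    fix r :: real assume r: "0 < r"
    \<comment> \<open>Half of the budget \<open>r * \<delta>^2\<close>; the other half absorbs the
      band, whose share is of order \<open>1 / n\<close>.\<close>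
    define \<epsilon> where "\<epsilon> = r * \<delta>\<^sup>2 / 2"
    have \<epsilon>: "0 < \<epsilon>" using r \<delta> by (simp add: \<epsilon>_def)
    obtain m0 where m0: "\<And>m i. m0 \<le> m \<Longrightarrow> \<bar>expectation (\<lambda>\<omega>. u (W i \<omega>) * u (W (i + m) \<omega>))\<bar> \<le> \<epsilon>"
      using decorrelation[OF u uB mean \<epsilon>] by blast
    have far: "expectation (\<lambda>\<omega>. u (W i \<omega>) * u (W j \<omega>)) \<le> \<epsilon>" if "j \<notin> {i - m0..i + m0}" for i j
    proof (cases "i \<le> j")
      case True
      then show ?thesis using m0[of "j - i" i] that by (auto simp: abs_le_iff)
    next
      case False
      then show ?thesis using m0[of "i - j" j] that by (auto simp: abs_le_iff mult.commute)
    qed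
    have second: "expectation (\<lambda>\<omega>. (\<Sum>i=1..n. u (W i \<omega>))\<^sup>2) \<le> real n * (real n * \<epsilon> + 4 * B\<^sup>2 * (2 * real m0 + 1))" for n
    proof -
      have near: "real (card ({1..n} \<inter> {i - m0..i + m0})) \<le> 2 * real m0 + 1" for i
      proof -
        have "card ({1..n} \<inter> {i - m0..i + m0}) \<le> card {i - m0..i + m0}" by (intro card_mono) auto
        also have "\<dots> = Suc (i + m0) - (i - m0)" by (rule card_atLeastAtMost)
        also have "\<dots> \<le> 2 * m0 + 1" by linarith
        finally show ?thesis by linarith
      qed
      have "expectation (\<lambda>\<omega>. (\<Sum>i=1..n. u (W i \<omega>))\<^sup>2)
          = (\<Sum>i=1..n. \<Sum>j=1..n. expectation (\<lambda>\<omega>. u (W i \<omega>) * u (W j \<omega>)))"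
        by (rule second_moment_sum) (rule int)
      also have "\<dots> \<le> (\<Sum>i=1..n. real n * \<epsilon> + 4 * B\<^sup>2 * (2 * real m0 + 1))"
      proof (rule sum_mono)
        fix i
        have "(\<Sum>j=1..n. expectation (\<lambda>\<omega>. u (W i \<omega>) * u (W j \<omega>)))
            \<le> (\<Sum>j=1..n. \<epsilon> + 4 * B\<^sup>2 * of_bool (j \<in> {i - m0..i + m0}))"
        proof (rule sum_mono)
          fix j
          show "expectation (\<lambda>\<omega>. u (W i \<omega>) * u (W j \<omega>)) \<le> \<epsilon> + 4 * B\<^sup>2 * of_bool (j \<in> {i - m0..i + m0})"
            using far[of j i] corr_le[of i j] \<epsilon> by (cases "j \<in> {i - m0..i + m0}") (auto simp: abs_le_iff)
        qed
        also have "\<dots> = real n * \<epsilon> + 4 * B\<^sup>2 * real (card ({1..n} \<inter> {i - m0..i + m0}))"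
        proof -
          have of_bool_card: "(\<Sum>j=1..n. of_bool (j \<in> A)) = real (card ({1..n} \<inter> A))" for A :: "nat set"
            by (simp add: of_bool_def sum.If_cases)
          show ?thesis unfolding sum.distrib sum_distrib_left[symmetric] of_bool_card by simp
        qed
        also have "\<dots> \<le> real n * \<epsilon> + 4 * B\<^sup>2 * (2 * real m0 + 1)"
          by (intro add_left_mono mult_left_mono near) simp
        finally show "(\<Sum>j=1..n. expectation (\<lambda>\<omega>. u (W i \<omega>) * u (W j \<omega>)))
            \<le> real n * \<epsilon> + 4 * B\<^sup>2 * (2 * real m0 + 1)" .
      qed
      finally show ?thesis by simp
    qed
    have "(\<lambda>n. 4 * B\<^sup>2 * (2 * real m0 + 1) / real n) \<longlonglongrightarrow> 0" by real_asymp
    then have "\<forall>\<^sub>F n in sequentially. 4 * B\<^sup>2 * (2 * real m0 + 1) / real n < \<epsilon>"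
      using \<epsilon> by (intro order_tendstoD) auto
    then obtain n0 where n0: "\<And>n. n0 \<le> n \<Longrightarrow> 4 * B\<^sup>2 * (2 * real m0 + 1) / real n < \<epsilon>"
      by (auto simp: eventually_sequentially)
    show "\<exists>n0. \<forall>n\<ge>n0. norm (?dev n - 0) < r"
    proof (intro exI[of _ "max 1 n0"] allI impI)
      fix n assume n: "max 1 n0 \<le> n"
      have "?dev n \<le> expectation (\<lambda>\<omega>. (\<Sum>i=1..n. u (W i \<omega>))\<^sup>2) / (real n * \<delta>)\<^sup>2"
        using n \<delta> by (intro second_moment_method second_moment_sum(1) int) auto
      also have "\<dots> \<le> real n * (real n * \<epsilon> + 4 * B\<^sup>2 * (2 * real m0 + 1)) / (real n * \<delta>)\<^sup>2"
        by (intro divide_right_mono second) simp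
      also have "\<dots> = (\<epsilon> + 4 * B\<^sup>2 * (2 * real m0 + 1) / real n) / \<delta>\<^sup>2"
        using n \<delta> by (simp add: power2_eq_square field_simps)
      also have "\<dots> < (\<epsilon> + \<epsilon>) / \<delta>\<^sup>2"
        using n n0[of n] \<delta> by (intro divide_strict_right_mono add_strict_left_mono) auto
      also have "\<dots> = r" using \<delta> by (simp add: \<epsilon>_def)
      finally show "norm (?dev n - 0) < r" by simp
    qed
  qed
  then show ?thesis by (simp add: u_def sum_subtractf)
qed

section \<open>Mean departure times\<close>

lemma integrable_waiting: "integrable M (W n)"
  and waiting_le_sum_service: "AE \<omega> in M. 0 \<le> W n \<omega> \<and> W n \<omega> \<le> (\<Sum>i=1..n. S i \<omega>)"
proof -
  show AE: "AE \<omega> in M. 0 \<le> W n \<omega> \<and> W n \<omega> \<le> (\<Sum>i=1..n. S i \<omega>)"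
    using AE_path_nonneg
  proof eventually_elim
    case (elim \<omega>)
    then show ?case
      using chain_nonneg[of "path \<omega>" 0 n] chain_le_sum_service[of "path \<omega>" n]
      by (simp add: waiting_eq_chain)
  qed
  show "integrable M (W n)"
  proof (rule Bochner_Integration.integrable_bound)
    show "integrable M (\<lambda>\<omega>. \<Sum>i=1..n. S i \<omega>)"
      by (intro Bochner_Integration.integrable_sum service_integrable) auto
    show "AE \<omega> in M. norm (W n \<omega>) \<le> norm (\<Sum>i=1..n. S i \<omega>)" using AE by eventually_elim auto
  qed simp
qed

lemma service_tail:
  assumes "0 < \<eta>"
  shows "\<exists>c>0. \<forall>i\<ge>1. expectation (\<lambda>\<omega>. S i \<omega> * indicator {c<..} (S i \<omega>)) < \<eta>"
proof -
  have [measurable]: "S 1 \<in> borel_measurable M" by (rule rv_S) simp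
  have "(\<lambda>n. expectation (\<lambda>\<omega>. S 1 \<omega> * indicator {real n<..} (S 1 \<omega>))) \<longlonglongrightarrow> expectation (\<lambda>_. 0)"
  proof (rule integral_dominated_convergence[where w = "\<lambda>\<omega>. \<bar>S 1 \<omega>\<bar>"])
    show "AE \<omega> in M. (\<lambda>n. S 1 \<omega> * indicator {real n<..} (S 1 \<omega>)) \<longlonglongrightarrow> 0"
    proof (rule AE_I2)
      fix \<omega>
      obtain n0 where n0: "S 1 \<omega> < real n0" using reals_Archimedean2 by blast
      show "(\<lambda>n. S 1 \<omega> * indicator {real n<..} (S 1 \<omega>)) \<longlonglongrightarrow> 0"
        by (rule tendsto_eventually, rule eventually_sequentiallyI[of n0]) (use n0 in auto)
    qed
  qed (use service_integrable[of 1] in \<open>auto simp: indicator_def\<close>)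
  then have "\<forall>\<^sub>F n in sequentially. expectation (\<lambda>\<omega>. S 1 \<omega> * indicator {real n<..} (S 1 \<omega>)) < \<eta>"
    using assms by (intro order_tendstoD) auto
  then obtain n where n: "1 \<le> n" "expectation (\<lambda>\<omega>. S 1 \<omega> * indicator {real n<..} (S 1 \<omega>)) < \<eta>"
    using eventually_happens'[OF sequentially_bot eventually_conj[OF _ eventually_ge_at_top[of 1]]] by blast
  have tail_eq: "expectation (\<lambda>\<omega>. S i \<omega> * indicator {real n<..} (S i \<omega>))
      = expectation (\<lambda>\<omega>. S 1 \<omega> * indicator {real n<..} (S 1 \<omega>))" if i: "1 \<le> i" for i
  proof -
    have "expectation (\<lambda>\<omega>. S i \<omega> * indicator {real n<..} (S i \<omega>))
        = (\<integral>s. s * indicator {real n<..} s \<partial>distr M borel (S i))" if "1 \<le> i" for i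
      using rv_S[OF that] by (subst integral_distr) auto
    from this[OF i] this[of 1] show ?thesis by (simp add: distr_service[OF i])
  qed
  show ?thesis
  proof (intro exI[of _ "real n"] conjI allI impI)
    show "expectation (\<lambda>\<omega>. S i \<omega> * indicator {real n<..} (S i \<omega>)) < \<eta>" if "1 \<le> i" for i
      unfolding tail_eq[OF that] by (rule n(2))
  qed (use n in auto)
qed

text \<open>Convergence in law does not control means. On the event \<open>a < W n\<close> the
  waiting time is bounded by the total service, split at the level \<open>c\<close>: the event is
  rare and the excess above \<open>c\<close> has small mean, so the bound is \<open>n\<close> times
  a small number.\<close>

lemma expectation_waiting_le:
  assumes c: "0 \<le> c" and a: "0 \<le> a"
    and tail: "\<And>i. 1 \<le> i \<Longrightarrow> expectation (\<lambda>\<omega>. S i \<omega> * indicator {c<..} (S i \<omega>)) \<le> r"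
  shows "expectation (W n) \<le> a + real n * (r + c * prob {\<omega> \<in> space M. a < W n \<omega>})"
proof -
  let ?E = "{\<omega> \<in> space M. a < W n \<omega>}"
  have int_tail: "integrable M (\<lambda>\<omega>. S i \<omega> * indicator {c<..} (S i \<omega>))" if i: "1 \<le> i" for i
  proof (rule Bochner_Integration.integrable_bound[OF service_integrable[OF i]])
    note [measurable] = rv_S[OF i]
    show "(\<lambda>\<omega>. S i \<omega> * indicator {c<..} (S i \<omega>)) \<in> borel_measurable M" by measurable
  qed (auto simp: indicator_def)
  have intE: "integrable M (indicator ?E :: 'a \<Rightarrow> real)"
    by (rule integrable_bounded[where B = 1]) (auto simp: indicator_def)
  have "expectation (W n) \<le> expectation (\<lambda>\<omega>. a + (\<Sum>i=1..n. S i \<omega> * indicator {c<..} (S i \<omega>) + c * indicator ?E \<omega>))"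
  proof (rule integral_mono_AE)
    show "AE \<omega> in M. W n \<omega> \<le> a + (\<Sum>i=1..n. S i \<omega> * indicator {c<..} (S i \<omega>) + c * indicator ?E \<omega>)"
      using waiting_le_sum_service[of n] AE_path_nonneg AE_space
    proof eventually_elim
      case (elim \<omega>)
      have S: "0 \<le> S i \<omega>" if "i \<in> {1..n}" for i using elim that by (cases i) auto
      show ?case
      proof (cases "a < W n \<omega>")
        case True
        have "W n \<omega> \<le> (\<Sum>i=1..n. S i \<omega>)" using elim by simp
        also have "\<dots> \<le> (\<Sum>i=1..n. S i \<omega> * indicator {c<..} (S i \<omega>) + c * indicator ?E \<omega>)"
          using True elim S c by (intro sum_mono) (auto simp: indicator_def)
        finally show ?thesis using a by simp
      next
        case False
        have "0 \<le> (\<Sum>i=1..n. S i \<omega> * indicator {c<..} (S i \<omega>) + c * indicator ?E \<omega>)"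
          using S c by (intro sum_nonneg) auto
        with False show ?thesis by simp
      qed
    qed
    show "integrable M (\<lambda>\<omega>. a + (\<Sum>i=1..n. S i \<omega> * indicator {c<..} (S i \<omega>) + c * indicator ?E \<omega>))"
      using int_tail intE by (intro Bochner_Integration.integrable_add Bochner_Integration.integrable_sum) auto
  qed (rule integrable_waiting)
  also have "\<dots> = a + expectation (\<lambda>\<omega>. \<Sum>i=1..n. S i \<omega> * indicator {c<..} (S i \<omega>) + c * indicator ?E \<omega>)"
    using int_tail intE by (subst Bochner_Integration.integral_add) (auto simp: prob_space)
  also have "expectation (\<lambda>\<omega>. \<Sum>i=1..n. S i \<omega> * indicator {c<..} (S i \<omega>) + c * indicator ?E \<omega>)
      = (\<Sum>i=1..n. expectation (\<lambda>\<omega>. S i \<omega> * indicator {c<..} (S i \<omega>)) + c * expectation (indicator ?E))"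
    using int_tail intE by (subst Bochner_Integration.integral_sum) auto
  also have "\<dots> \<le> (\<Sum>i=1..n. r + c * expectation (indicator ?E))"
    using tail by (intro sum_mono add_right_mono) auto
  also have "expectation (indicator ?E) = prob ?E" by (simp add: Int_absorb1)
  finally show ?thesis by simp
qed

lemma expectation_waiting_sublinear: "(\<lambda>n. expectation (W n) / real n) \<longlonglongrightarrow> 0"
proof (rule LIMSEQ_I)
  fix r :: real assume r: "0 < r"
  \<comment> \<open>The truncation level \<open>c\<close> is fixed before \<open>b\<close>, since
    the rarity demanded of the event depends on it.\<close>
  obtain c where c: "0 < c" and tail: "\<And>i. 1 \<le> i \<Longrightarrow> expectation (\<lambda>\<omega>. S i \<omega> * indicator {c<..} (S i \<omega>)) < r / 3"
    using service_tail[of "r / 3"] r by auto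
  obtain b where b: "0 < b" and tight: "\<forall>\<^sub>F n in sequentially. prob {\<omega> \<in> space M. b < W n \<omega>} < r / 3 / c"
    using waiting_tight[of "r / 3 / c"] r c by auto
  have "(\<lambda>n. b / real n) \<longlonglongrightarrow> 0" by real_asymp
  then have "\<forall>\<^sub>F n in sequentially. b / real n < r / 3"
    using r by (intro order_tendstoD) auto
  from eventually_conj[OF this tight] obtain n0
    where n0: "\<And>n. n0 \<le> n \<Longrightarrow> b / real n < r / 3 \<and> prob {\<omega> \<in> space M. b < W n \<omega>} < r / 3 / c"
    unfolding eventually_sequentially by blast
  show "\<exists>n0. \<forall>n\<ge>n0. norm (expectation (W n) / real n - 0) < r"
  proof (intro exI[of _ "max 1 n0"] allI impI)
    fix n assume n: "max 1 n0 \<le> n"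
    have "0 \<le> expectation (W n)"
      using waiting_le_sum_service[of n] by (intro integral_nonneg_AE) auto
    moreover have "expectation (W n) / real n \<le> (b + real n * (r / 3 + c * prob {\<omega> \<in> space M. b < W n \<omega>})) / real n"
      using c b tail by (intro divide_right_mono expectation_waiting_le) (auto intro: less_imp_le)
    moreover have "\<dots> = b / real n + r / 3 + c * prob {\<omega> \<in> space M. b < W n \<omega>}"
      using n by (simp add: field_simps)
    moreover have "c * prob {\<omega> \<in> space M. b < W n \<omega>} < r / 3"
      using n0[of n] n c by (simp add: field_simps)
    ultimately show "norm (expectation (W n) / real n - 0) < r"
      using n0[of n] n by simp
  qed
qed

lemma expectation_departure: "expectation (departure tau S n) = real n / lam + expectation (W n)"
proof -
  \<comment> \<open>A nonintegrable variable would have Bochner integral 0 by convention, which the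
    mean \<open>1 / lam\<close> excludes.\<close>
  have int_tau: "integrable M (tau i)" if "1 \<le> i" for i
  proof (rule ccontr)
    assume "\<not> integrable M (tau i)"
    then have "expectation (tau i) = 0" by (rule not_integrable_integral_eq)
    with exponential_distributed_expectation[OF lam_pos interarrival[OF that]] lam_pos show False by simp
  qed
  have "expectation (departure tau S n) = expectation (\<lambda>\<omega>. (\<Sum>i=1..n. tau i \<omega>) + W n \<omega>)"
    by (rule Bochner_Integration.integral_cong) (auto simp: waiting_def arrival_def)
  also have "\<dots> = (\<Sum>i=1..n. expectation (tau i)) + expectation (W n)"
    using int_tau integrable_waiting by (subst Bochner_Integration.integral_add) auto
  also have "(\<Sum>i=1..n. expectation (tau i)) = (\<Sum>i=1..n. 1 / lam)"
    by (intro sum.cong refl exponential_distributed_expectation[OF lam_pos] interarrival) auto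
  finally show ?thesis by simp
qed

lemma departure_ge_arrivals: "real n / lam \<le> expectation (departure tau S n)"
  unfolding expectation_departure
  using waiting_le_sum_service[of n] by (auto intro!: integral_nonneg_AE)

lemma departure_rate: "(\<lambda>n. expectation (departure tau S n) / real n) \<longlonglongrightarrow> 1 / lam"
proof -
  have "(\<lambda>n. 1 / lam + expectation (W n) / real n) \<longlonglongrightarrow> 1 / lam + 0"
    by (intro tendsto_intros expectation_waiting_sublinear)
  moreover have "\<forall>\<^sub>F n in sequentially. 1 / lam + expectation (W n) / real n = expectation (departure tau S n) / real n"
    by (rule eventually_sequentiallyI[of 1]) (simp add: expectation_departure add_divide_distrib)
  ultimately show ?thesis by (simp add: tendsto_cong)
qed

end

section \<open>Random noise laws with stable information\<close>

lemma cesaro_mean_tendsto: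
  fixes a :: "nat \<Rightarrow> real"
  assumes "a \<longlonglongrightarrow> l"
  shows "(\<lambda>n. (\<Sum>i=1..n. a i) / real n) \<longlonglongrightarrow> l"
proof (rule LIMSEQ_I)
  fix r :: real assume r: "0 < r"
  then obtain n0 where n0: "\<And>n. n0 \<le> n \<Longrightarrow> \<bar>a n - l\<bar> < r / 2"
    using LIMSEQ_D[OF assms, of "r / 2"] by auto
  define c where "c = (\<Sum>i<n0. \<bar>a i - l\<bar>)"
  have "(\<lambda>n. c / real n) \<longlonglongrightarrow> 0" by real_asymp
  then have "\<forall>\<^sub>F n in sequentially. c / real n < r / 2" using r by (intro order_tendstoD) auto
  then obtain n1 where n1: "\<And>n. n1 \<le> n \<Longrightarrow> c / real n < r / 2" by (auto simp: eventually_sequentially)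
  show "\<exists>n0. \<forall>n\<ge>n0. norm ((\<Sum>i=1..n. a i) / real n - l) < r"
  proof (intro exI[of _ "max 1 n1"] allI impI)
    fix n assume n: "max 1 n1 \<le> n"
    have "\<bar>(\<Sum>i=1..n. a i) - real n * l\<bar> = \<bar>\<Sum>i=1..n. a i - l\<bar>"
      by (simp add: sum_subtractf)
    also have "\<dots> \<le> (\<Sum>i=1..n. \<bar>a i - l\<bar>)" by (rule sum_abs)
    also have "\<dots> \<le> (\<Sum>i=1..n. r / 2 + (if i < n0 then \<bar>a i - l\<bar> else 0))"
      using n0 r by (intro sum_mono) (auto simp: not_less intro: less_imp_le)
    also have "\<dots> = real n * (r / 2) + (\<Sum>i\<in>{1..n} \<inter> {..<n0}. \<bar>a i - l\<bar>)"
    proof -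
      have "(\<Sum>i=1..n. if i < n0 then \<bar>a i - l\<bar> else 0) = (\<Sum>i\<in>{1..n} \<inter> {..<n0}. \<bar>a i - l\<bar>)"
        by (subst sum.inter_restrict) auto
      then show ?thesis by (simp add: sum.distrib)
    qed
    also have "(\<Sum>i\<in>{1..n} \<inter> {..<n0}. \<bar>a i - l\<bar>) \<le> c"
      unfolding c_def by (intro sum_mono2) auto
    finally have "\<bar>(\<Sum>i=1..n. a i) - real n * l\<bar> / real n \<le> (real n * (r / 2) + c) / real n"
      by (intro divide_right_mono) auto
    also have "\<dots> = r / 2 + c / real n" using n by (simp add: field_simps)
    also have "\<dots> < r" using n1[of n] n by linarith
    also have "\<bar>(\<Sum>i=1..n. a i) - real n * l\<bar> / real n = \<bar>((\<Sum>i=1..n. a i) - real n * l) / real n\<bar>"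
      by simp
    also have "((\<Sum>i=1..n. a i) - real n * l) / real n = (\<Sum>i=1..n. a i) / real n - l"
      using n by (simp add: field_simps)
    finally show "norm ((\<Sum>i=1..n. a i) / real n - l) < r" by simp
  qed
qed

lemma tendsto_mult_log:
  fixes a :: "nat \<Rightarrow> real"
  assumes lim: "a \<longlonglongrightarrow> l" and a: "\<And>n. 0 \<le> a n" "\<And>n. a n \<le> 1"
  shows "(\<lambda>n. a n * log 2 (a n)) \<longlonglongrightarrow> l * log 2 l"
proof (cases "l = 0")
  case False
  moreover have "0 \<le> l" using LIMSEQ_le_const[OF lim] a by auto
  ultimately show ?thesis using lim by (intro tendsto_intros) auto
next
  case True
  \<comment> \<open>At \<open>l = 0\<close> continuity of the logarithm is lost; instead the square
    of the product is bounded by a multiple of \<open>a n\<close>.\<close>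
  have "(\<lambda>n. (a n * log 2 (a n))\<^sup>2) \<longlonglongrightarrow> 0"
  proof (rule Lim_null_comparison)
    show "\<forall>\<^sub>F n in sequentially. norm ((a n * log 2 (a n))\<^sup>2) \<le> a n * (4 / (ln 2)\<^sup>2)"
    proof (rule always_eventually, rule allI)
      fix n
      have "a n * (a n * (log 2 (a n))\<^sup>2) \<le> a n * (4 / (ln 2)\<^sup>2)"
        using a by (intro mult_left_mono mult_log_square_le) auto
      then show "norm ((a n * log 2 (a n))\<^sup>2) \<le> a n * (4 / (ln 2)\<^sup>2)"
        using a by (simp add: power_mult_distrib power2_eq_square mult_ac abs_mult)
    qed
    show "(\<lambda>n. a n * (4 / (ln 2)\<^sup>2)) \<longlonglongrightarrow> 0"
      using tendsto_mult[OF lim tendsto_const[of "4 / (ln 2)\<^sup>2"]] True by simp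
  qed
  then have "(\<lambda>n. sqrt ((a n * log 2 (a n))\<^sup>2)) \<longlonglongrightarrow> sqrt 0" by (rule tendsto_real_sqrt)
  then have "(\<lambda>n. \<bar>a n * log 2 (a n)\<bar>) \<longlonglongrightarrow> 0" by simp
  then show ?thesis using True tendsto_rabs_zero_iff by fastforce
qed

text \<open>Serves both receivers: \<open>q \<omega> i\<close> is \<open>K (W i \<omega>)\<close>
  when the timings are known, and the deterministic marginal law of the noise symbol when they are
  not.\<close>

locale stable_channel = prob_space M
  for M :: "'a measure" +
  fixes q :: "'a \<Rightarrow> nat \<Rightarrow> 'x :: finite pmf" and g :: "'x \<Rightarrow> 'x \<Rightarrow> 'y"
    and tau S :: "nat \<Rightarrow> 'a \<Rightarrow> real" and Q :: "'x \<Rightarrow> real \<Rightarrow> 'y pmf"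
    and Dec :: "nat \<Rightarrow> 'y decoder set" and lam h :: real
  assumes pmf_measurable [measurable]: "\<And>i z. (\<lambda>\<omega>. pmf (q \<omega> i) z) \<in> borel_measurable M"
    and bij_g: "\<forall>x. bij (g x)" and bij_g_input: "\<forall>z. bij (\<lambda>x. g x z)"
    and lam: "0 < lam"
    and departure_ge: "\<And>n. real n / lam \<le> (\<integral>\<omega>. departure tau S n \<omega> \<partial>M)"
    and departure_limit: "(\<lambda>n. (\<integral>\<omega>. departure tau S n \<omega> \<partial>M) / real n) \<longlonglongrightarrow> 1 / lam"
    and entropy_stable: "\<And>\<delta>. 0 < \<delta> \<Longrightarrow> (\<lambda>n. prob {\<omega> \<in> space M. real n * \<delta> \<le>
      \<bar>(\<Sum>i=1..n. shannon_entropy (measure_pmf (q \<omega> i))) - real n * h\<bar>}) \<longlonglongrightarrow> 0"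

sublocale stable_channel \<subseteq> asymptotic_channel M "\<lambda>n \<omega>. word_prob n (q \<omega>)" g tau S Q Dec lam h
proof
  show "(\<lambda>\<omega>. word_prob n (q \<omega>) z) \<in> borel_measurable M" for n z
    unfolding word_prob_def by measurable
qed (use bij_g bij_g_input lam departure_ge departure_limit in \<open>auto simp: word_prob_nonneg sum_word_prob[simplified]\<close>)

context stable_channel
begin

abbreviation deviation :: "nat \<Rightarrow> real \<Rightarrow> 'a set" where
  "deviation n \<delta> \<equiv> {\<omega> \<in> space M. real n * \<delta> \<le>
      \<bar>(\<Sum>i=1..n. shannon_entropy (measure_pmf (q \<omega> i))) - real n * h\<bar>}"

lemma deviation_sets: "deviation n \<delta> \<in> sets M"
  unfolding shannon_entropy_pmf by measurable

lemma expectation_le_deviation: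
  assumes F: "integrable M F" and le: "\<And>\<omega>. F \<omega> \<le> b + of_bool (real n * \<delta> \<le>
      \<bar>(\<Sum>i=1..n. shannon_entropy (measure_pmf (q \<omega> i))) - real n * h\<bar>)"
  shows "expectation F \<le> b + prob (deviation n \<delta>)"
proof -
  have int: "integrable M (indicator (deviation n \<delta>) :: 'a \<Rightarrow> real)"
    by (rule integrable_const_bound[where B = 1]) (use deviation_sets in \<open>auto simp: indicator_def\<close>)
  have "expectation F \<le> expectation (\<lambda>\<omega>. b + indicator (deviation n \<delta>) \<omega>)"
  proof (rule integral_mono[OF F])
    show "F \<omega> \<le> b + indicator (deviation n \<delta>) \<omega>" if "\<omega> \<in> space M" for \<omega>
      using le[of \<omega>] that by (auto simp: indicator_def of_bool_def split: if_splits)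
  qed (use int in auto)
  also have "\<dots> = b + prob (deviation n \<delta>)"
    using int deviation_sets[of n \<delta>] by (simp add: prob_space Int_absorb1)
  finally show ?thesis .
qed

lemma integrable_mass: "integrable M (\<lambda>\<omega>. \<Sum>z\<in>words n. word_prob n (q \<omega>) z * of_bool (word_prob n (q \<omega>) z \<le> t))"
proof (rule ch.integrable_weighted)
  fix z :: "nat \<Rightarrow> 'x" assume "z \<in> words n"
  note [measurable] = ch.\<kappa>_measurable[OF this]
  show "{\<omega> \<in> space M. word_prob n (q \<omega>) z \<le> t} \<in> sets M" by measurable
qed

lemma mass_below_bounds:
  assumes n: "0 < n" and \<delta>: "0 < \<delta>"
  defines "b \<equiv> 4 * real CARD('x) / (ln 2)\<^sup>2 / (real n * \<delta>\<^sup>2)"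
  shows "ch.mass_below n (2 powr (- (real n * (h + 2 * \<delta>)))) \<le> b + prob (deviation n \<delta>)"
    and "1 - ch.mass_below n (2 powr (- (real n * (h - 2 * \<delta>)))) \<le> b + prob (deviation n \<delta>)"
proof -
  show "ch.mass_below n (2 powr (- (real n * (h + 2 * \<delta>)))) \<le> b + prob (deviation n \<delta>)"
    unfolding ch.mass_below_def b_def
    by (rule expectation_le_deviation[OF integrable_mass information_spectrum(1)[OF n \<delta>]])
  have "1 - ch.mass_below n (2 powr (- (real n * (h - 2 * \<delta>))))
      = expectation (\<lambda>\<omega>. 1 - (\<Sum>z\<in>words n. word_prob n (q \<omega>) z *
          of_bool (word_prob n (q \<omega>) z \<le> 2 powr (- (real n * (h - 2 * \<delta>))))))"
    unfolding ch.mass_below_def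
    by (subst Bochner_Integration.integral_diff[OF _ integrable_mass]) (auto simp: prob_space)
  also have "\<dots> \<le> b + prob (deviation n \<delta>)"
    unfolding b_def
    by (rule expectation_le_deviation[OF _ information_spectrum(2)[OF n \<delta>]])
       (intro Bochner_Integration.integrable_diff integrable_mass integrable_const)
  finally show "1 - ch.mass_below n (2 powr (- (real n * (h - 2 * \<delta>)))) \<le> b + prob (deviation n \<delta>)" .
qed

lemma deviation_bound_tendsto:
  assumes "0 < \<delta>"
  shows "(\<lambda>n. 4 * real CARD('x) / (ln 2)\<^sup>2 / (real n * \<delta>\<^sup>2) + prob (deviation n \<delta>)) \<longlonglongrightarrow> 0"
proof -
  have "(\<lambda>n. a / (real n * \<delta>\<^sup>2)) \<longlonglongrightarrow> 0" for a using assms by real_asymp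
  from tendsto_add[OF this[of "4 * real CARD('x) / (ln 2)\<^sup>2"] entropy_stable[OF assms]] show ?thesis by simp
qed

lemma mass_below_tendsto:
  assumes \<delta>: "0 < \<delta>"
  shows "(\<lambda>n. ch.mass_below n (2 powr (- (real n * (h + \<delta>))))) \<longlonglongrightarrow> 0"
    and "(\<lambda>n. ch.mass_below n (2 powr (- (real n * (h - \<delta>))))) \<longlonglongrightarrow> 1"
proof -
  \<comment> \<open>Half of \<open>\<delta>\<close>, because the spectrum bounds carry a slack of
    twice the deviation.\<close>
  let ?b = "\<lambda>n. 4 * real CARD('x) / (ln 2)\<^sup>2 / (real n * (\<delta> / 2)\<^sup>2) + prob (deviation n (\<delta> / 2))"
  have lim: "?b \<longlonglongrightarrow> 0" using \<delta> by (intro deviation_bound_tendsto) simp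
  have weights: "0 \<le> (\<Sum>z\<in>words n. word_prob n (q \<omega>) z * of_bool (P z))"
     "(\<Sum>z\<in>words n. word_prob n (q \<omega>) z * of_bool (P z)) \<le> 1" for n \<omega> P
  proof -
    show "0 \<le> (\<Sum>z\<in>words n. word_prob n (q \<omega>) z * of_bool (P z))"
      by (intro sum_nonneg) (simp add: word_prob_nonneg)
    have "(\<Sum>z\<in>words n. word_prob n (q \<omega>) z * of_bool (P z)) \<le> (\<Sum>z\<in>words n. word_prob n (q \<omega>) z)"
      by (intro sum_mono) (simp add: word_prob_nonneg of_bool_def)
    then show "(\<Sum>z\<in>words n. word_prob n (q \<omega>) z * of_bool (P z)) \<le> 1"
      unfolding sum_word_prob .
  qed
  have ge0: "0 \<le> ch.mass_below n t" for n t
    unfolding ch.mass_below_def by (intro integral_nonneg_AE AE_I2 weights)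
  have "ch.mass_below n t \<le> expectation (\<lambda>_. 1)" for n t
    unfolding ch.mass_below_def by (intro integral_mono integrable_mass integrable_const weights)
  then have le1: "ch.mass_below n t \<le> 1" for n t by (simp add: prob_space)
  have b1: "norm (ch.mass_below n (2 powr (- (real n * (h + \<delta>))))) \<le> ?b n" if "1 \<le> n" for n
    using mass_below_bounds(1)[of n "\<delta> / 2"] ge0[of n "2 powr (- (real n * (h + \<delta>)))"] \<delta> that by simp
  show "(\<lambda>n. ch.mass_below n (2 powr (- (real n * (h + \<delta>))))) \<longlonglongrightarrow> 0"
    by (rule Lim_null_comparison[OF eventually_sequentiallyI[of 1, OF b1] lim])
  have b2: "norm (ch.mass_below n (2 powr (- (real n * (h - \<delta>)))) - 1) \<le> ?b n" if "1 \<le> n" for n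
    using mass_below_bounds(2)[of n "\<delta> / 2"] le1[of n "2 powr (- (real n * (h - \<delta>)))"] \<delta> that by simp
  have "(\<lambda>n. ch.mass_below n (2 powr (- (real n * (h - \<delta>)))) - 1) \<longlonglongrightarrow> 0"
    by (rule Lim_null_comparison[OF eventually_sequentiallyI[of 1, OF b2] lim])
  then show "(\<lambda>n. ch.mass_below n (2 powr (- (real n * (h - \<delta>))))) \<longlonglongrightarrow> 1"
    by (rule LIM_zero_cancel)
qed

lemma capacity_stable_channel:
  assumes "\<And>n. (\<lambda>_ _ _. 0) \<in> Dec n"
    and "\<And>n f d. d \<in> Dec n \<Longrightarrow>
      \<exists>d'. (\<forall>y\<in>words n. (\<lambda>\<omega>. d' \<omega> y) \<in> M \<rightarrow>\<^sub>M count_space UNIV) \<and>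
        (\<forall>m. error_probability M tau S Q n f d m = ch.code_error n (f :: nat \<Rightarrow> nat \<Rightarrow> 'x) d' m)"
    and "\<And>n f t. 0 < t \<Longrightarrow> \<exists>d\<in>Dec n. \<forall>m. error_probability M tau S Q n f d m
        = ch.code_error n f (\<lambda>\<omega>. threshold_decoder (word_noise g n) t (word_prob n (q \<omega>)) f) m"
  shows "capacity M tau S Q Dec = ereal (lam * (log 2 (real CARD('x)) - h))"
proof -
  interpret spectral_channel M "\<lambda>n \<omega>. word_prob n (q \<omega>)" g tau S Q Dec lam h "log 2 (real CARD('x))"
    by unfold_locales (use assms mass_below_tendsto in auto)
  show ?thesis by (rule capacity_eq)
qed

end

section \<open>The two capacities\<close>

lemma word_prob_cong: "(\<And>i. i \<in> {1..n} \<Longrightarrow> p i = p' i) \<Longrightarrow> word_prob n p = word_prob n p'"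
  by (simp add: word_prob_def fun_eq_iff)

text \<open>Any uniform bound suffices for the weak law; this crude one combines
  \<open>\<bar>l\<bar> \<le> 1 + l^2\<close> with the bound on \<open>p * l^2\<close>.\<close>

lemma shannon_entropy_pmf_bound:
  fixes p :: "'z :: finite pmf"
  shows "\<bar>shannon_entropy (measure_pmf p)\<bar> \<le> real CARD('z) * (1 + 4 / (ln 2)\<^sup>2)"
proof -
  have "\<bar>pmf p z * log 2 (pmf p z)\<bar> \<le> 1 + 4 / (ln 2)\<^sup>2" for z
  proof -
    let ?l = "log 2 (pmf p z)"
    have "0 \<le> (\<bar>?l\<bar> - 1)\<^sup>2" by simp
    then have "\<bar>?l\<bar> \<le> 1 + ?l\<^sup>2" by (simp add: power2_eq_square algebra_simps abs_mult_self_eq)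
    then have "pmf p z * \<bar>?l\<bar> \<le> pmf p z * (1 + ?l\<^sup>2)" by (intro mult_left_mono) auto
    also have "\<dots> \<le> 1 + 4 / (ln 2)\<^sup>2"
      using mult_log_square_le[of "pmf p z"] by (simp add: distrib_left pmf_le_1 add_mono)
    finally show ?thesis by (simp add: abs_mult)
  qed
  then have "(\<Sum>z\<in>UNIV. \<bar>pmf p z * log 2 (pmf p z)\<bar>) \<le> (\<Sum>z\<in>(UNIV :: 'z set). 1 + 4 / (ln 2)\<^sup>2)"
    by (intro sum_mono)
  then show ?thesis
    unfolding shannon_entropy_pmf abs_minus_cancel by (intro order.trans[OF sum_abs]) simp
qed

locale bijective_queue_channel = queue_channel M lam F_S tau S Q K N g + ergodic_queue M lam F_S tau S \<pi>
  for M :: "'a measure" and lam F_S tau S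
    and Q :: "'x :: finite \<Rightarrow> real \<Rightarrow> 'y pmf" and K :: "real \<Rightarrow> 'x pmf" and N g \<pi> +
  assumes bij_g: "\<forall>x. bij (g x)" and bij_g_input: "\<forall>z. bij (\<lambda>x. g x z)"
begin

lemma measurable_pmf_K [measurable]: "(\<lambda>w. pmf (K w) z) \<in> borel_measurable borel"
  using measurable_compose[OF kernel_K measurable_measure_subprob_algebra[of "{z}"]]
  by (simp add: pmf.rep_eq)

lemma prob_output_word:
  "measure_pmf.prob (Pi_pmf {1..n} undefined (\<lambda>i. Q (x i) (W i \<omega>))) {y. P y}
    = (\<Sum>z\<in>words n. word_prob n (\<lambda>i. K (W i \<omega>)) z * of_bool (P (word_output g n x z)))"
  unfolding representation by (rule prob_Pi_pmf_map_eq_sum_words[OF bij_g])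

lemma stable_channel_timing: "stable_channel M (\<lambda>\<omega> i. K (W i \<omega>)) g tau S lam (\<integral>w. shannon_entropy (measure_pmf (K w)) \<partial>\<pi>)"
proof
  show "(\<lambda>\<omega>. pmf (K (W i \<omega>)) z) \<in> borel_measurable M" for i z by measurable
  fix \<delta> :: real assume "0 < \<delta>"
  moreover have "(\<lambda>w. shannon_entropy (measure_pmf (K w))) \<in> borel_measurable borel"
    unfolding shannon_entropy_pmf by measurable
  ultimately show "(\<lambda>n. prob {\<omega> \<in> space M. real n * \<delta> \<le>
      \<bar>(\<Sum>i=1..n. shannon_entropy (measure_pmf (K (W i \<omega>)))) - real n * (\<integral>w. shannon_entropy (measure_pmf (K w)) \<partial>\<pi>)\<bar>}) \<longlonglongrightarrow> 0"
    using shannon_entropy_pmf_bound by (intro waiting_weak_law)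
qed (use bij_g bij_g_input lam_pos departure_ge_arrivals departure_rate in auto)

lemma capacity_timing:
  "capacity M tau S Q timing_decoders
    = ereal (lam * (log 2 (real CARD('x)) - (\<integral>w. shannon_entropy (measure_pmf (K w)) \<partial>\<pi>)))"
proof -
  interpret st: stable_channel M "\<lambda>\<omega> i. K (W i \<omega>)" g tau S Q timing_decoders lam
      "\<integral>w. shannon_entropy (measure_pmf (K w)) \<partial>\<pi>"
    by (rule stable_channel_timing)
  let ?A = "\<lambda>n \<omega>. \<lambda>i\<in>{1..n}. arrival tau i \<omega>" and ?D = "\<lambda>n \<omega>. \<lambda>i\<in>{1..n}. departure tau S i \<omega>"
  show ?thesis
  proof (rule st.capacity_stable_channel)
    show "(\<lambda>_ _ _. 0) \<in> timing_decoders n" for n by (simp add: timing_decoders_def)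
    show "\<exists>d'. (\<forall>y\<in>words n. (\<lambda>\<omega>. d' \<omega> y) \<in> M \<rightarrow>\<^sub>M count_space UNIV) \<and>
        (\<forall>m. error_probability M tau S Q n f d m = st.ch.code_error n f d' m)"
      if d: "d \<in> timing_decoders n" for n f d
    \<comment> \<open>Inserting the observed timings turns the decoder into one with side
      information \<open>\<omega>\<close>.\<close>
    proof (intro exI[of _ "\<lambda>\<omega> y. d y (?A n \<omega>) (?D n \<omega>)"] conjI ballI allI)
      fix y
      have "(\<lambda>\<omega>. (?A n \<omega>, ?D n \<omega>)) \<in> M \<rightarrow>\<^sub>M (\<Pi>\<^sub>M i\<in>{1..n}. borel) \<Otimes>\<^sub>M (\<Pi>\<^sub>M i\<in>{1..n}. borel)"
        by (intro measurable_Pair measurable_restrict rv_arrival rv_departure)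
      moreover have "(\<lambda>(a, b). d y a b) \<in> (\<Pi>\<^sub>M i\<in>{1..n}. borel) \<Otimes>\<^sub>M (\<Pi>\<^sub>M i\<in>{1..n}. borel) \<rightarrow>\<^sub>M count_space UNIV"
        using d by (simp add: timing_decoders_def)
      ultimately have "(\<lambda>\<omega>. (\<lambda>(a, b). d y a b) (?A n \<omega>, ?D n \<omega>)) \<in> M \<rightarrow>\<^sub>M count_space UNIV"
        by (rule measurable_compose)
      then show "(\<lambda>\<omega>. d y (?A n \<omega>) (?D n \<omega>)) \<in> M \<rightarrow>\<^sub>M count_space UNIV" by simp
    next
      fix m
      show "error_probability M tau S Q n f d m = st.ch.code_error n f (\<lambda>\<omega> y. d y (?A n \<omega>) (?D n \<omega>)) m"
        unfolding error_probability_def st.ch.code_error_def prob_output_word ..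
    qed
    show "\<exists>d\<in>timing_decoders n. \<forall>m. error_probability M tau S Q n f d m
        = st.ch.code_error n f (\<lambda>\<omega>. threshold_decoder (word_noise g n) t (word_prob n (\<lambda>i. K (W i \<omega>))) f) m"
      if t: "0 < t" for n f t
    proof (intro bexI allI)
      \<comment> \<open>The receiver recovers the waiting times as differences of departures and
        arrivals.\<close>
      let ?d = "\<lambda>y a b. threshold_decoder (word_noise g n) t (word_prob n (\<lambda>i. K (b i - a i))) f y"
      fix m
      have "?d y (?A n \<omega>) (?D n \<omega>) = threshold_decoder (word_noise g n) t (word_prob n (\<lambda>i. K (W i \<omega>))) f y" for y \<omega>
        by (subst word_prob_cong[of n _ "\<lambda>i. K (W i \<omega>)"]) (auto simp: waiting_def)
      then show "error_probability M tau S Q n f ?d m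
        = st.ch.code_error n f (\<lambda>\<omega>. threshold_decoder (word_noise g n) t (word_prob n (\<lambda>i. K (W i \<omega>))) f) m"
        unfolding error_probability_def st.ch.code_error_def prob_output_word by simp
      show "?d \<in> timing_decoders n"
        unfolding timing_decoders_def mem_Collect_eq
      proof
        fix y
        have [measurable]: "(\<lambda>p. word_prob n (\<lambda>i. K (snd p i - fst p i)) z)
            \<in> borel_measurable ((\<Pi>\<^sub>M i\<in>{1..n}. borel) \<Otimes>\<^sub>M (\<Pi>\<^sub>M i\<in>{1..n}. borel))" for z
          unfolding word_prob_def
        proof (rule borel_measurable_prod)
          fix i assume "i \<in> {1..n}"
          note [measurable] = measurable_component_singleton[OF this, of "\<lambda>_. borel :: real measure"]
          show "(\<lambda>p. pmf (K (snd p i - fst p i)) (z i))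
            \<in> borel_measurable ((\<Pi>\<^sub>M i\<in>{1..n}. borel) \<Otimes>\<^sub>M (\<Pi>\<^sub>M i\<in>{1..n}. borel))"
            by measurable
        qed
        show "(\<lambda>(a, b). ?d y a b) \<in> (\<Pi>\<^sub>M i\<in>{1..n}. borel) \<Otimes>\<^sub>M (\<Pi>\<^sub>M i\<in>{1..n}. borel) \<rightarrow>\<^sub>M count_space UNIV"
          unfolding threshold_decoder_def case_prod_unfold by measurable
      qed
    qed
  qed
qed

definition marginal :: "nat \<Rightarrow> 'x pmf" where
  "marginal i = embed_pmf (\<lambda>z. expectation (\<lambda>\<omega>. pmf (K (W i \<omega>)) z))"

lemma integrable_pmf_waiting: "integrable M (\<lambda>\<omega>. pmf (K (W i \<omega>)) z)"
  by (rule integrable_bounded[where B = 1]) (auto simp: pmf_le_1)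

lemma pmf_marginal: "pmf (marginal i) z = expectation (\<lambda>\<omega>. pmf (K (W i \<omega>)) z)"
  unfolding marginal_def
proof (rule pmf_embed_pmf)
  show nonneg: "0 \<le> expectation (\<lambda>\<omega>. pmf (K (W i \<omega>)) z)" for z by (intro integral_nonneg_AE) auto
  have "(\<Sum>z\<in>UNIV. expectation (\<lambda>\<omega>. pmf (K (W i \<omega>)) z)) = expectation (\<lambda>\<omega>. \<Sum>z\<in>UNIV. pmf (K (W i \<omega>)) z)"
    by (rule Bochner_Integration.integral_sum[symmetric]) (rule integrable_pmf_waiting)
  also have "\<dots> = 1" by (simp add: sum_pmf_eq_1 prob_space)
  finally show "(\<integral>\<^sup>+z. ennreal (expectation (\<lambda>\<omega>. pmf (K (W i \<omega>)) z)) \<partial>count_space UNIV) = 1"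
    by (simp add: nn_integral_count_space_finite sum_ennreal nonneg)
qed

lemma kernel_K_limit: "(\<lambda>w. measure_pmf (K w)) \<in> \<pi> \<rightarrow>\<^sub>M subprob_algebra (count_space UNIV)"
  using kernel_K by (simp cong: measurable_cong_sets)

lemma shannon_entropy_noise_mixture:
  "shannon_entropy (noise_mixture \<pi> K)
    = - (\<Sum>z\<in>UNIV. (\<integral>w. pmf (K w) z \<partial>\<pi>) * log 2 (\<integral>w. pmf (K w) z \<partial>\<pi>))"
proof -
  have "prob_space (noise_mixture \<pi> K)"
    unfolding noise_mixture_def
    by (rule limit_law.prob_space_bind[OF _ kernel_K_limit]) (simp add: measure_pmf.prob_space_axioms)
  moreover have "sets (noise_mixture \<pi> K) = UNIV"
    unfolding noise_mixture_def by (subst sets_bind[where N = "count_space UNIV"]) auto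
  moreover have "measure (noise_mixture \<pi> K) {z} = (\<integral>w. pmf (K w) z \<partial>\<pi>)" for z
    unfolding noise_mixture_def pmf.rep_eq
    by (rule limit_law.measure_bind[OF kernel_K_limit]) simp
  ultimately show ?thesis by (subst shannon_entropy_eq) auto
qed

text \<open>Setwise convergence is essential here, as \<open>\<lambda>w. pmf (K w) z\<close> is
  merely measurable.\<close>

lemma entropy_marginal_tendsto:
  "(\<lambda>i. shannon_entropy (measure_pmf (marginal i))) \<longlonglongrightarrow> shannon_entropy (noise_mixture \<pi> K)"
  unfolding shannon_entropy_noise_mixture shannon_entropy_pmf
proof (intro tendsto_minus tendsto_sum tendsto_mult_log)
  show "(\<lambda>i. pmf (marginal i) z) \<longlonglongrightarrow> (\<integral>w. pmf (K w) z \<partial>\<pi>)" for z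
    unfolding pmf_marginal by (rule expectation_waiting_tendsto[where B = 1]) (auto simp: pmf_le_1)
qed (auto simp: pmf_le_1)

text \<open>The laws are deterministic, so by Cesaro averaging the deviation event is empty for all
  large \<open>n\<close>.\<close>

lemma stable_channel_marginal: "stable_channel M (\<lambda>_. marginal) g tau S lam (shannon_entropy (noise_mixture \<pi> K))"
proof
  fix \<delta> :: real assume \<delta>: "0 < \<delta>"
  let ?h = "shannon_entropy (noise_mixture \<pi> K)"
  have "\<forall>\<^sub>F n in sequentially. \<bar>(\<Sum>i=1..n. shannon_entropy (measure_pmf (marginal i))) / real n - ?h\<bar> < \<delta>"
    using tendstoD[OF cesaro_mean_tendsto[OF entropy_marginal_tendsto] \<delta>] by (simp add: dist_real_def)
  then have "\<forall>\<^sub>F n in sequentially. prob {\<omega> \<in> space M. real n * \<delta> \<le>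
      \<bar>(\<Sum>i=1..n. shannon_entropy (measure_pmf (marginal i))) - real n * ?h\<bar>} = 0"
    using eventually_gt_at_top[of 0]
  proof eventually_elim
    case (elim n)
    let ?s = "\<Sum>i=1..n. shannon_entropy (measure_pmf (marginal i))"
    have "?s - real n * ?h = real n * (?s / real n - ?h)"
      using elim(2) by (simp add: right_diff_distrib)
    then have "\<bar>?s - real n * ?h\<bar> = real n * \<bar>?s / real n - ?h\<bar>"
      by (simp only: abs_mult abs_of_nat)
    also have "\<dots> < real n * \<delta>" using elim by (intro mult_strict_left_mono) auto
    finally have "{\<omega> \<in> space M. real n * \<delta> \<le> \<bar>?s - real n * ?h\<bar>} = {}" by auto
    then show ?case by (simp only: measure_empty)
  qed
  then show "(\<lambda>n. prob {\<omega> \<in> space M. real n * \<delta> \<le>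
      \<bar>(\<Sum>i=1..n. shannon_entropy (measure_pmf (marginal i))) - real n * ?h\<bar>}) \<longlonglongrightarrow> 0"
    by (rule tendsto_eventually)
qed (use bij_g bij_g_input lam_pos departure_ge_arrivals departure_rate in auto)

section \<open>Product form of the noise law without timings\<close>

definition noise_event :: "nat \<Rightarrow> (nat \<Rightarrow> 'x) \<Rightarrow> 'a set" where
  "noise_event n \<nu> = {\<omega> \<in> space M. \<forall>i\<in>{1..n}. N i \<omega> = \<nu> i}"

lemma noise_event_sets [measurable]: "noise_event n \<nu> \<in> sets M"
proof -
  have "{\<omega> \<in> space M. N i \<omega> = \<nu> i} \<in> sets M" if "i \<in> {1..n}" for i
    using measurable_sets[OF noise_measurable[of i], of "{\<nu> i}"] that
    by (auto simp: vimage_def Int_def conj_commute)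
  then show ?thesis unfolding noise_event_def by (intro sets.sets_Collect_finite_All) auto
qed

lemma measurable_waiting_timing: "W n \<in> borel_measurable timing_algebra"
proof -
  have "(\<lambda>\<omega> j. (arrival tau j \<omega>, departure tau S j \<omega>)) \<in> timing_algebra \<rightarrow>\<^sub>M (\<Pi>\<^sub>M j\<in>UNIV. borel)"
    unfolding timing_algebra_def by (rule measurable_vimage_algebra1) (auto simp: space_PiM)
  from measurable_compose[OF this measurable_component_singleton[of n UNIV "\<lambda>_. borel"]]
  have "(\<lambda>\<omega>. (arrival tau n \<omega>, departure tau S n \<omega>)) \<in> timing_algebra \<rightarrow>\<^sub>M borel \<Otimes>\<^sub>M borel"
    by (simp add: borel_prod)
  from measurable_compose[OF this, of "\<lambda>p. snd p - fst p" borel]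
  have "(\<lambda>\<omega>. departure tau S n \<omega> - arrival tau n \<omega>) \<in> borel_measurable timing_algebra"
    by simp
  then show ?thesis by (simp add: waiting_def[abs_def])
qed

text \<open>\<open>word_prob\<close> is the conditional probability of the noise event given all
  timings, and every \<open>W k\<close>, also with \<open>k > n\<close>, is a function of the
  timings; its image under \<open>\<phi>\<close> can be pulled through the conditional
  expectation.\<close>

lemma expectation_word_prob_times:
  assumes [measurable]: "\<phi> \<in> borel_measurable borel" and \<phi>B: "\<And>w. \<bar>\<phi> w\<bar> \<le> (B :: real)"
  shows "expectation (\<lambda>\<omega>. \<phi> (W k \<omega>) * word_prob n (\<lambda>i. K (W i \<omega>)) \<nu>)
    = expectation (\<lambda>\<omega>. \<phi> (W k \<omega>) * indicator (noise_event n \<nu>) \<omega>)"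
proof -
  let ?E = "noise_event n \<nu>"
  note [measurable] = measurable_waiting_timing
  interpret finite_measure_subalgebra M timing_algebra
    using subalgebra_timing_algebra by unfold_locales
  have int: "integrable M (\<lambda>\<omega>. \<phi> (W k \<omega>) * indicator ?E \<omega>)"
    by (rule integrable_bounded[where B = B]) (use \<phi>B \<phi>B[THEN order_trans[OF abs_ge_zero]] in \<open>auto simp: indicator_def\<close>)
  have "(\<lambda>\<omega>. \<phi> (W k \<omega>)) \<in> borel_measurable timing_algebra" by measurable
  then have "expectation (\<lambda>\<omega>. \<phi> (W k \<omega>) * real_cond_exp M timing_algebra (indicator ?E) \<omega>)
      = expectation (\<lambda>\<omega>. \<phi> (W k \<omega>) * indicator ?E \<omega>)"
    using int by (intro real_cond_exp_intg(2)) auto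
  moreover have "expectation (\<lambda>\<omega>. \<phi> (W k \<omega>) * real_cond_exp M timing_algebra (indicator ?E) \<omega>)
      = expectation (\<lambda>\<omega>. \<phi> (W k \<omega>) * word_prob n (\<lambda>i. K (W i \<omega>)) \<nu>)"
  proof (rule integral_cong_AE)
    have [measurable]: "real_cond_exp M timing_algebra (indicator ?E) \<in> borel_measurable M"
      by (rule borel_measurable_cond_exp2)
    show "(\<lambda>\<omega>. \<phi> (W k \<omega>) * real_cond_exp M timing_algebra (indicator ?E) \<omega>) \<in> borel_measurable M"
      by measurable
    show "(\<lambda>\<omega>. \<phi> (W k \<omega>) * word_prob n (\<lambda>i. K (W i \<omega>)) \<nu>) \<in> borel_measurable M"
      unfolding word_prob_def by measurable
    show "AE \<omega> in M. \<phi> (W k \<omega>) * real_cond_exp M timing_algebra (indicator ?E) \<omega>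
        = \<phi> (W k \<omega>) * word_prob n (\<lambda>i. K (W i \<omega>)) \<nu>"
      using noise_law[of n \<nu>] unfolding noise_event_def[symmetric] by eventually_elim (simp add: word_prob_def)
  qed
  ultimately show ?thesis by simp
qed

text \<open>Unpredictability with \<open>k = 1\<close>: conditioning on the noise word, realised by
  \<open>uniform_measure\<close>, leaves the law of the next waiting time unchanged.\<close>

lemma expectation_times_noise_word:
  assumes unp: "unpredictable_given_noise M W N"
    and \<phi> [measurable]: "\<phi> \<in> borel_measurable borel"
  shows "expectation (\<lambda>\<omega>. \<phi> (W (Suc n) \<omega>) * indicator (noise_event n \<nu>) \<omega>)
    = expectation (\<lambda>\<omega>. \<phi> (W (Suc n) \<omega>)) * prob (noise_event n \<nu>)"
proof (cases "prob (noise_event n \<nu>) = 0")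
  \<comment> \<open>Unpredictability is silent about noise words of probability 0, where both sides
    vanish.\<close>
  case True
  let ?E = "noise_event n \<nu>"
  have "AE \<omega> in M. \<omega> \<notin> ?E"
    using noise_event_sets True by (intro AE_not_in) (auto simp: null_sets_def emeasure_eq_measure)
  then have "expectation (\<lambda>\<omega>. \<phi> (W (Suc n) \<omega>) * indicator ?E \<omega>) = 0"
    by (intro integral_eq_zero_AE) auto
  with True show ?thesis by simp
next
  case False
  let ?E = "noise_event n \<nu>"
  have pos: "0 < prob ?E" using False by (simp add: zero_less_measure_iff)
  let ?U = "uniform_measure M ?E"
  have law: "distr ?U borel (W (Suc n)) = distr M borel (W (Suc n))"
  proof (rule measure_eqI)
    fix B assume "B \<in> sets (distr ?U borel (W (Suc n)))"
    then have B [measurable]: "B \<in> sets borel" by simp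
    have "\<P>(\<omega> in M. W (n + 1) \<omega> \<in> B \<bar> \<forall>i\<in>{1..n}. N i \<omega> = \<nu> i) = \<P>(\<omega> in M. W (n + 1) \<omega> \<in> B)"
      using unp B False unfolding unpredictable_given_noise_def noise_event_def by blast
    then have "prob {\<omega> \<in> space M. W (Suc n) \<omega> \<in> B \<and> (\<forall>i\<in>{1..n}. N i \<omega> = \<nu> i)} / prob ?E
        = prob {\<omega> \<in> space M. W (Suc n) \<omega> \<in> B}"
      by (simp add: cond_prob_def noise_event_def)
    moreover have "{\<omega> \<in> space M. W (Suc n) \<omega> \<in> B \<and> (\<forall>i\<in>{1..n}. N i \<omega> = \<nu> i)} = ?E \<inter> (W (Suc n) -` B \<inter> space M)"
      by (auto simp: noise_event_def)
    moreover have "{\<omega> \<in> space M. W (Suc n) \<omega> \<in> B} = W (Suc n) -` B \<inter> space M" by auto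
    ultimately have eq: "prob (?E \<inter> (W (Suc n) -` B \<inter> space M)) / prob ?E = prob (W (Suc n) -` B \<inter> space M)"
      by simp
    have "emeasure (distr ?U borel (W (Suc n))) B = emeasure ?U (W (Suc n) -` B \<inter> space M)"
      by (subst emeasure_distr) auto
    also have "\<dots> = emeasure M (?E \<inter> (W (Suc n) -` B \<inter> space M)) / emeasure M ?E"
      by (rule emeasure_uniform_measure) (auto intro: measurable_sets)
    also have "\<dots> = ennreal (prob (?E \<inter> (W (Suc n) -` B \<inter> space M)) / prob ?E)"
      using pos by (simp add: emeasure_eq_measure divide_ennreal)
    also have "\<dots> = emeasure (distr M borel (W (Suc n))) B"
      unfolding eq by (subst emeasure_distr) (auto simp: emeasure_eq_measure)
    finally show "emeasure (distr ?U borel (W (Suc n))) B = emeasure (distr M borel (W (Suc n))) B" .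
  qed simp
  have density: "?U = density M (\<lambda>\<omega>. ennreal (indicator ?E \<omega> / prob ?E))"
    unfolding uniform_measure_def using pos
    by (intro arg_cong2[where f = density] refl ext)
       (auto simp: emeasure_eq_measure divide_ennreal[symmetric] ennreal_indicator[symmetric] indicator_def)
  have "expectation (\<lambda>\<omega>. \<phi> (W (Suc n) \<omega>)) = (\<integral>w. \<phi> w \<partial>distr ?U borel (W (Suc n)))"
    unfolding law by (simp add: integral_distr)
  also have "\<dots> = (\<integral>\<omega>. \<phi> (W (Suc n) \<omega>) \<partial>?U)" by (subst integral_distr) auto
  also have "\<dots> = expectation (\<lambda>\<omega>. (indicator ?E \<omega> / prob ?E) * \<phi> (W (Suc n) \<omega>))"
    unfolding density by (subst integral_density) auto
  also have "\<dots> = expectation (\<lambda>\<omega>. \<phi> (W (Suc n) \<omega>) * indicator ?E \<omega>) / prob ?E"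
    by (simp add: mult.commute)
  finally show ?thesis using pos by (simp add: field_simps)
qed

text \<open>Unpredictability makes the noise symbols independent, although not identically distributed.\<close>

lemma expectation_word_prob:
  assumes unp: "unpredictable_given_noise M W N"
  shows "expectation (\<lambda>\<omega>. word_prob n (\<lambda>i. K (W i \<omega>)) \<nu>) = word_prob n marginal \<nu>"
proof (induction n)
  case 0
  then show ?case by (simp add: word_prob_def prob_space)
next
  case (Suc n)
  let ?E = "noise_event n \<nu>"
  have "expectation (\<lambda>\<omega>. word_prob (Suc n) (\<lambda>i. K (W i \<omega>)) \<nu>)
      = expectation (\<lambda>\<omega>. pmf (K (W (Suc n) \<omega>)) (\<nu> (Suc n)) * word_prob n (\<lambda>i. K (W i \<omega>)) \<nu>)"
    by (simp add: word_prob_def mult.commute)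
  \<comment> \<open>The conditional probability of the first \<open>n\<close> symbols is traded for
    the event itself, the form in which unpredictability applies; the constant test function trades
    it back below.\<close>
  also have "\<dots> = expectation (\<lambda>\<omega>. pmf (K (W (Suc n) \<omega>)) (\<nu> (Suc n)) * indicator ?E \<omega>)"
    by (rule expectation_word_prob_times[where B = 1]) (auto simp: pmf_le_1)
  also have "\<dots> = pmf (marginal (Suc n)) (\<nu> (Suc n)) * prob ?E"
    unfolding pmf_marginal by (rule expectation_times_noise_word[OF unp]) measurable
  also have "prob ?E = expectation (\<lambda>\<omega>. 1 * indicator ?E \<omega>)"
    using sets.sets_into_space[OF noise_event_sets] by (simp add: Int_absorb2)
  also have "\<dots> = expectation (\<lambda>\<omega>. 1 * word_prob n (\<lambda>i. K (W i \<omega>)) \<nu>)"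
    by (rule expectation_word_prob_times[where \<phi> = "\<lambda>_. 1" and B = 1 and k = 0, symmetric]) auto
  also have "\<dots> = word_prob n marginal \<nu>" using Suc by simp
  finally show ?case by (simp add: word_prob_def mult.commute)
qed

lemma capacity_timing_free:
  assumes unp: "unpredictable_given_noise M W N"
  shows "capacity M tau S Q timing_free_decoders
    = ereal (lam * (log 2 (real CARD('x)) - shannon_entropy (noise_mixture \<pi> K)))"
proof -
  interpret st: stable_channel M "\<lambda>_. marginal" g tau S Q timing_free_decoders lam
      "shannon_entropy (noise_mixture \<pi> K)"
    by (rule stable_channel_marginal)
  \<comment> \<open>For a decoder that ignores the timings, the error is linear in the word
    probabilities, so only their expectation enters: the law of the noise word, a product by
    unpredictability.\<close>
  have error: "error_probability M tau S Q n f (\<lambda>y _ _. d y) m = st.ch.code_error n f (\<lambda>_. d) m" for n f d m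
  proof -
    have int: "integrable M (\<lambda>\<omega>. word_prob n (\<lambda>i. K (W i \<omega>)) z)" for z
    proof (rule integrable_bounded)
      show "\<bar>word_prob n (\<lambda>i. K (W i \<omega>)) z\<bar> \<le> 1" for \<omega>
        unfolding abs_of_nonneg[OF word_prob_nonneg] by (simp add: word_prob_def prod_le_1 pmf_le_1)
    qed (simp add: word_prob_def)
    have "error_probability M tau S Q n f (\<lambda>y _ _. d y) m
        = expectation (\<lambda>\<omega>. \<Sum>z\<in>words n. word_prob n (\<lambda>i. K (W i \<omega>)) z * of_bool (d (word_output g n (f m) z) \<noteq> m))"
      unfolding error_probability_def prob_output_word ..
    also have "\<dots> = (\<Sum>z\<in>words n. word_prob n marginal z * of_bool (d (word_output g n (f m) z) \<noteq> m))"
      using int by (subst Bochner_Integration.integral_sum) (auto simp: expectation_word_prob[OF unp])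
    also have "\<dots> = st.ch.code_error n f (\<lambda>_. d) m"
      unfolding st.ch.code_error_def by (simp add: prob_space)
    finally show ?thesis .
  qed
  show ?thesis
  proof (rule st.capacity_stable_channel)
    show "(\<lambda>_ _ _. 0) \<in> timing_free_decoders n" for n by (auto simp: timing_free_decoders_def)
    show "\<exists>d'. (\<forall>y\<in>words n. (\<lambda>\<omega>. d' \<omega> y) \<in> M \<rightarrow>\<^sub>M count_space UNIV) \<and>
        (\<forall>m. error_probability M tau S Q n f d m = st.ch.code_error n f d' m)"
      if dec: "d \<in> timing_free_decoders n" for n f d
    proof -
      obtain d0 where "\<forall>y a b. d y a b = d0 y" using dec by (auto simp: timing_free_decoders_def)
      then have "d = (\<lambda>y _ _. d0 y)" by (simp add: fun_eq_iff)
      then show ?thesis using error by (intro exI[of _ "\<lambda>_. d0"]) simp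
    qed
    show "\<exists>d\<in>timing_free_decoders n. \<forall>m. error_probability M tau S Q n f d m
        = st.ch.code_error n f (\<lambda>\<omega>. threshold_decoder (word_noise g n) t (word_prob n marginal) f) m"
      for n f t
      by (rule bexI[of _ "\<lambda>y _ _. threshold_decoder (word_noise g n) t (word_prob n marginal) f y"])
         (auto simp: error timing_free_decoders_def)
  qed
qed

end

theorem theorem6:
  fixes M :: "'a measure" and lam :: real and F_S :: "real \<Rightarrow> real"
    and tau S :: "nat \<Rightarrow> 'a \<Rightarrow> real"
    and Q :: "'x :: finite \<Rightarrow> real \<Rightarrow> 'y pmf" and K :: "real \<Rightarrow> 'x pmf"
    and N :: "nat \<Rightarrow> 'a \<Rightarrow> 'x" and g :: "'x \<Rightarrow> 'x \<Rightarrow> 'y" and \<pi> :: "real measure"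
  assumes "queue_channel M lam F_S tau S Q K N g"
    and "random_bijective g"
    and "\<forall>z. bij (\<lambda>x. g x z)"
    and "limiting_distribution M (waiting tau S) \<pi>"
  shows "capacity M tau S Q timing_decoders =
           ereal (lam * (log 2 (real CARD('x)) - (\<integral>w. shannon_entropy (measure_pmf (K w)) \<partial>\<pi>)))
       \<and> (unpredictable_given_noise M (waiting tau S) N \<longrightarrow>
           capacity M tau S Q timing_free_decoders =
             ereal (lam * (log 2 (real CARD('x)) - shannon_entropy (noise_mixture \<pi> K))))"
proof -
  interpret queue_channel M lam F_S tau S Q K N g by fact
  interpret bijective_queue_channel M lam F_S tau S Q K N g \<pi>
    using assms by unfold_locales (auto simp: random_bijective_def)
  show ?thesis using capacity_timing capacity_timing_free by blast
qed

end
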